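(* Let $R$ be a (commutative Noetherian) local ring and $M$ a nonzero finitely generated $R$-module satisfying one of the following conditions: (1) $I(M)$ contains a non-zerodivisor of $R$; in this case, set $b=\nu_R(M)$; or (2) $M$ has rank; in this case, set $b=\operatorname{rank}_R(M)+1$. If $M$ is not free, then for each nonzero finitely generated $R$-module $N$ and each integer $n\ge b$, the torsion submodule of $(\otimes_R^nM)\otimes_RN$ is nonzero.
   Context: $\nu_R(M)$ denotes the minimal number of generators of $M$. $I(M)$ denotes the ideal $(r_{ij})$ of $R$ generated by the entries of the matrix in a minimal presentation $R^{\mu}\xrightarrow{[r_{ij}]}R^{\nu}\to M\to 0$ with $\nu=\nu_R(M)$; this ideal is independent of the choice of presentation. $Q(R)$ is the total quotient ring of $R$ (the localization at the set of all non-zerodivisors). $M$ has rank $r$ if $Q(R)\otimes_RM$ is a free $Q(R)$-module of rank $r$; then $\operatorname{rank}_R(M)=r$. The torsion submodule of an $R$-module $L$ is the kernel of the natural map $L\to Q(R)\otimes_RL$. $\otimes_R^nM$ is the $n$-fold tensor power of $M$ over $R$. *)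

theory Defs
  imports "HOL-Algebra.Module" "HOL-Algebra.QuotRing" "HOL-Algebra.Ring_Divisibility"
begin

section \<open>Rings\<close>

locale local_ring = cring +
  assumes unique_maximalideal: "\<exists>!I. maximalideal I R"

definition nonzerodivisors :: "('a, 'r) ring_scheme \<Rightarrow> 'a set" where
  "nonzerodivisors R =
    {s \<in> carrier R. \<forall>a \<in> carrier R. s \<otimes>\<^bsub>R\<^esub> a = \<zero>\<^bsub>R\<^esub> \<longrightarrow> a = \<zero>\<^bsub>R\<^esub>}"

definition fraction_rel :: "('a, 'r) ring_scheme \<Rightarrow> 'a set \<Rightarrow> (('a \<times> 'a) \<times> ('a \<times> 'a)) set" where
  "fraction_rel R S = {((a, s), (b, t)). a \<in> carrier R \<and> s \<in> S \<and> b \<in> carrier R \<and> t \<in> S \<and>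
    (\<exists>u \<in> S. u \<otimes>\<^bsub>R\<^esub> (a \<otimes>\<^bsub>R\<^esub> t \<ominus>\<^bsub>R\<^esub> b \<otimes>\<^bsub>R\<^esub> s) = \<zero>\<^bsub>R\<^esub>)}"

definition fraction :: "('a, 'r) ring_scheme \<Rightarrow> 'a set \<Rightarrow> 'a \<Rightarrow> 'a \<Rightarrow> ('a \<times> 'a) set" where
  "fraction R S a s = fraction_rel R S `` {(a, s)}"

text \<open>The operations are given on representatives; the unions are over families of equal classes,
  so that each of them is the common value.\<close>

definition localization :: "('a, 'r) ring_scheme \<Rightarrow> 'a set \<Rightarrow> ('a \<times> 'a) set ring" where
  "localization R S =
    \<lparr> carrier = (carrier R \<times> S) // fraction_rel R S,
      mult = (\<lambda>X Y. \<Union>x \<in> X. \<Union>y \<in> Y.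
        fraction R S (fst x \<otimes>\<^bsub>R\<^esub> fst y) (snd x \<otimes>\<^bsub>R\<^esub> snd y)),
      one = fraction R S \<one>\<^bsub>R\<^esub> \<one>\<^bsub>R\<^esub>,
      zero = fraction R S \<zero>\<^bsub>R\<^esub> \<one>\<^bsub>R\<^esub>,
      add = (\<lambda>X Y. \<Union>x \<in> X. \<Union>y \<in> Y.
        fraction R S (fst x \<otimes>\<^bsub>R\<^esub> snd y \<oplus>\<^bsub>R\<^esub> fst y \<otimes>\<^bsub>R\<^esub> snd x) (snd x \<otimes>\<^bsub>R\<^esub> snd y)) \<rparr>"

definition total_quotient_ring :: "('a, 'r) ring_scheme \<Rightarrow> ('a \<times> 'a) set ring" where
  "total_quotient_ring R = localization R (nonzerodivisors R)"

definition to_total_quotient :: "('a, 'r) ring_scheme \<Rightarrow> 'a \<Rightarrow> ('a \<times> 'a) set" where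
  "to_total_quotient R a = fraction R (nonzerodivisors R) a \<one>\<^bsub>R\<^esub>"


section \<open>Modules\<close>

text \<open>The record of modules extends that of rings; its fields \<open>mult\<close> and \<open>one\<close> play no role
  for a module and are left undefined below.\<close>

definition module_hom ::
  "('a, 'r) ring_scheme \<Rightarrow> ('a, 'm, 'x) module_scheme \<Rightarrow> ('a, 'n, 'y) module_scheme \<Rightarrow> ('m \<Rightarrow> 'n) set"
where
  "module_hom R M N = {h \<in> hom (add_monoid M) (add_monoid N).
    \<forall>a \<in> carrier R. \<forall>x \<in> carrier M. h (a \<odot>\<^bsub>M\<^esub> x) = a \<odot>\<^bsub>N\<^esub> h x}"

definition submodule_span ::
  "('a, 'r) ring_scheme \<Rightarrow> ('a, 'm, 'x) module_scheme \<Rightarrow> 'm set \<Rightarrow> 'm set" where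
  "submodule_span R M A = \<Inter>{H. submodule H R M \<and> A \<subseteq> H}"

definition generating_set ::
  "('a, 'r) ring_scheme \<Rightarrow> ('a, 'm, 'x) module_scheme \<Rightarrow> 'm set \<Rightarrow> bool" where
  "generating_set R M A \<longleftrightarrow> A \<subseteq> carrier M \<and> submodule_span R M A = carrier M"

definition finitely_generated ::
  "('a, 'r) ring_scheme \<Rightarrow> ('a, 'm, 'x) module_scheme \<Rightarrow> bool" where
  "finitely_generated R M \<longleftrightarrow> (\<exists>A. finite A \<and> generating_set R M A)"

definition min_num_generators ::
  "('a, 'r) ring_scheme \<Rightarrow> ('a, 'm, 'x) module_scheme \<Rightarrow> nat" where
  "min_num_generators R M = (LEAST k. \<exists>A. finite A \<and> card A = k \<and> generating_set R M A)"

text \<open>The free module on a set \<open>X\<close>: finitely supported functions on \<open>X\<close>, extended by zero.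
  In particular \<open>free_module R {..<k}\<close> is the module of \<open>k\<close>-tuples.\<close>

definition free_module :: "('a, 'r) ring_scheme \<Rightarrow> 'x set \<Rightarrow> ('a, 'x \<Rightarrow> 'a) module" where
  "free_module R X =
    \<lparr> carrier = {f. f \<in> X \<rightarrow> carrier R \<and> (\<forall>x. x \<notin> X \<longrightarrow> f x = \<zero>\<^bsub>R\<^esub>) \<and> finite {x. f x \<noteq> \<zero>\<^bsub>R\<^esub>}},
      mult = undefined,
      one = undefined,
      zero = (\<lambda>x. \<zero>\<^bsub>R\<^esub>),
      add = (\<lambda>f g x. f x \<oplus>\<^bsub>R\<^esub> g x),
      smult = (\<lambda>a f x. a \<otimes>\<^bsub>R\<^esub> f x) \<rparr>"

definition basis_vector :: "('a, 'r) ring_scheme \<Rightarrow> 'x \<Rightarrow> 'x \<Rightarrow> 'a" where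
  "basis_vector R x = (\<lambda>y. if y = x then \<one>\<^bsub>R\<^esub> else \<zero>\<^bsub>R\<^esub>)"

definition linear_combination ::
  "('a, 'r) ring_scheme \<Rightarrow> ('a, 'm, 'x) module_scheme \<Rightarrow> ('m \<Rightarrow> 'a) \<Rightarrow> 'm" where
  "linear_combination R M f = (\<Oplus>\<^bsub>M\<^esub>x \<in> {x. f x \<noteq> \<zero>\<^bsub>R\<^esub>}. f x \<odot>\<^bsub>M\<^esub> x)"

text \<open>Every element is a linear combination of \<open>B\<close> in exactly one way.\<close>

definition is_basis ::
  "('a, 'r) ring_scheme \<Rightarrow> ('a, 'm, 'x) module_scheme \<Rightarrow> 'm set \<Rightarrow> bool" where
  "is_basis R M B \<longleftrightarrow> B \<subseteq> carrier M \<and>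
    bij_betw (linear_combination R M) (carrier (free_module R B)) (carrier M)"

definition is_free :: "('a, 'r) ring_scheme \<Rightarrow> ('a, 'm, 'x) module_scheme \<Rightarrow> bool" where
  "is_free R M \<longleftrightarrow> (\<exists>B. is_basis R M B)"

definition is_free_of_rank ::
  "('a, 'r) ring_scheme \<Rightarrow> ('a, 'm, 'x) module_scheme \<Rightarrow> nat \<Rightarrow> bool" where
  "is_free_of_rank R M r \<longleftrightarrow> (\<exists>B. finite B \<and> card B = r \<and> is_basis R M B)"

definition quotient_module ::
  "('a, 'r) ring_scheme \<Rightarrow> ('a, 'm, 'x) module_scheme \<Rightarrow> 'm set \<Rightarrow> ('a, 'm set) module" where
  "quotient_module R M K =
    \<lparr> carrier = a_rcosets\<^bsub>M\<^esub> K,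
      mult = undefined,
      one = undefined,
      zero = K,
      add = (\<lambda>X Y. X <+>\<^bsub>M\<^esub> Y),
      smult = (\<lambda>a X. \<Union>x \<in> X. K +>\<^bsub>M\<^esub> (a \<odot>\<^bsub>M\<^esub> x)) \<rparr>"


section \<open>Minimal presentations\<close>

definition matrix_map ::
  "('a, 'r) ring_scheme \<Rightarrow> nat \<Rightarrow> nat \<Rightarrow> (nat \<Rightarrow> nat \<Rightarrow> 'a) \<Rightarrow> (nat \<Rightarrow> 'a) \<Rightarrow> nat \<Rightarrow> 'a" where
  "matrix_map R m k A f =
    (\<lambda>i. if i < k then (\<Oplus>\<^bsub>R\<^esub>j \<in> {..<m}. A i j \<otimes>\<^bsub>R\<^esub> f j) else \<zero>\<^bsub>R\<^esub>)"

text \<open>\<open>R\<^sup>m \<rightarrow> R\<^sup>k \<rightarrow> M \<rightarrow> 0\<close> is exact, where \<open>k\<close> is the minimal number of generators of \<open>M\<close>, the first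
  map is given by the matrix \<open>A\<close> and the second one is \<open>p\<close>. Nothing is required of \<open>m\<close>.\<close>

definition minimal_presentation ::
  "('a, 'r) ring_scheme \<Rightarrow> ('a, 'm, 'x) module_scheme \<Rightarrow>
    nat \<Rightarrow> (nat \<Rightarrow> nat \<Rightarrow> 'a) \<Rightarrow> ((nat \<Rightarrow> 'a) \<Rightarrow> 'm) \<Rightarrow> bool" where
  "minimal_presentation R M m A p \<longleftrightarrow>
    (let k = min_num_generators R M; F = free_module R {..<k} in
      (\<forall>i<k. \<forall>j<m. A i j \<in> carrier R) \<and>
      p \<in> module_hom R F M \<and>
      p ` carrier F = carrier M \<and>
      a_kernel F M p = matrix_map R m k A ` carrier (free_module R {..<m}))"

text \<open>The ideal does not depend on the presentation, so it is immaterial which one is chosen.\<close>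

definition presentation_ideal ::
  "('a, 'r) ring_scheme \<Rightarrow> ('a, 'm, 'x) module_scheme \<Rightarrow> 'a set" where
  "presentation_ideal R M =
    (SOME I. \<exists>m A p. minimal_presentation R M m A p \<and>
      I = genideal R {A i j |i j. i < min_num_generators R M \<and> j < m})"


section \<open>Tensor products\<close>

definition bilinear_relations ::
  "('a, 'r) ring_scheme \<Rightarrow> ('a, 'm, 'x) module_scheme \<Rightarrow> ('a, 'n, 'y) module_scheme \<Rightarrow>
    ('m \<times> 'n \<Rightarrow> 'a) set" where
  "bilinear_relations R M N =
    (let F = free_module R (carrier M \<times> carrier N); e = basis_vector R in
      {e (x \<oplus>\<^bsub>M\<^esub> x', y) \<ominus>\<^bsub>F\<^esub> (e (x, y) \<oplus>\<^bsub>F\<^esub> e (x', y)) |x x' y.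
        x \<in> carrier M \<and> x' \<in> carrier M \<and> y \<in> carrier N} \<union>
      {e (x, y \<oplus>\<^bsub>N\<^esub> y') \<ominus>\<^bsub>F\<^esub> (e (x, y) \<oplus>\<^bsub>F\<^esub> e (x, y')) |x y y'.
        x \<in> carrier M \<and> y \<in> carrier N \<and> y' \<in> carrier N} \<union>
      {e (a \<odot>\<^bsub>M\<^esub> x, y) \<ominus>\<^bsub>F\<^esub> a \<odot>\<^bsub>F\<^esub> e (x, y) |a x y.
        a \<in> carrier R \<and> x \<in> carrier M \<and> y \<in> carrier N} \<union>
      {e (x, a \<odot>\<^bsub>N\<^esub> y) \<ominus>\<^bsub>F\<^esub> a \<odot>\<^bsub>F\<^esub> e (x, y) |a x y.
        a \<in> carrier R \<and> x \<in> carrier M \<and> y \<in> carrier N})"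

definition tensor_kernel ::
  "('a, 'r) ring_scheme \<Rightarrow> ('a, 'm, 'x) module_scheme \<Rightarrow> ('a, 'n, 'y) module_scheme \<Rightarrow>
    ('m \<times> 'n \<Rightarrow> 'a) set" where
  "tensor_kernel R M N =
    submodule_span R (free_module R (carrier M \<times> carrier N)) (bilinear_relations R M N)"

definition tensor_product ::
  "('a, 'r) ring_scheme \<Rightarrow> ('a, 'm, 'x) module_scheme \<Rightarrow> ('a, 'n, 'y) module_scheme \<Rightarrow>
    ('a, ('m \<times> 'n \<Rightarrow> 'a) set) module" where
  "tensor_product R M N =
    quotient_module R (free_module R (carrier M \<times> carrier N)) (tensor_kernel R M N)"

definition pure_tensor ::
  "('a, 'r) ring_scheme \<Rightarrow> ('a, 'm, 'x) module_scheme \<Rightarrow> ('a, 'n, 'y) module_scheme \<Rightarrow>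
    'm \<Rightarrow> 'n \<Rightarrow> ('m \<times> 'n \<Rightarrow> 'a) set" where
  "pure_tensor R M N x y =
    tensor_kernel R M N +>\<^bsub>free_module R (carrier M \<times> carrier N)\<^esub> basis_vector R (x, y)"

text \<open>An iterated binary tensor product would have a type depending on the number of factors.
  The tensor power is therefore built in one step, as the quotient of the free module on the
  \<open>n\<close>-tuples of elements of \<open>M\<close> by the relations of multilinearity. For \<open>n = 0\<close> there are no
  relations and the result is the free module on the empty tuple.\<close>

definition tuples :: "('a, 'm, 'x) module_scheme \<Rightarrow> nat \<Rightarrow> 'm list set" where
  "tuples M n = {xs. length xs = n \<and> set xs \<subseteq> carrier M}"

definition multilinear_relations ::
  "('a, 'r) ring_scheme \<Rightarrow> nat \<Rightarrow> ('a, 'm, 'x) module_scheme \<Rightarrow> ('m list \<Rightarrow> 'a) set" where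
  "multilinear_relations R n M =
    (let F = free_module R (tuples M n); e = basis_vector R in
      {e (xs[i := x \<oplus>\<^bsub>M\<^esub> y]) \<ominus>\<^bsub>F\<^esub> (e (xs[i := x]) \<oplus>\<^bsub>F\<^esub> e (xs[i := y])) |xs i x y.
        xs \<in> tuples M n \<and> i < n \<and> x \<in> carrier M \<and> y \<in> carrier M} \<union>
      {e (xs[i := a \<odot>\<^bsub>M\<^esub> x]) \<ominus>\<^bsub>F\<^esub> a \<odot>\<^bsub>F\<^esub> e (xs[i := x]) |xs i a x.
        xs \<in> tuples M n \<and> i < n \<and> a \<in> carrier R \<and> x \<in> carrier M})"

definition tensor_power ::
  "('a, 'r) ring_scheme \<Rightarrow> nat \<Rightarrow> ('a, 'm, 'x) module_scheme \<Rightarrow>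
    ('a, ('m list \<Rightarrow> 'a) set) module" where
  "tensor_power R n M =
    (let F = free_module R (tuples M n) in
      quotient_module R F (submodule_span R F (multilinear_relations R n M)))"


section \<open>Base change to the total quotient ring, rank and torsion\<close>

definition total_quotient_module :: "('a, 'r) ring_scheme \<Rightarrow> ('a, ('a \<times> 'a) set) module" where
  "total_quotient_module R =
    (let Q = total_quotient_ring R in
      \<lparr> carrier = carrier Q, mult = mult Q, one = one Q, zero = zero Q, add = add Q,
        smult = (\<lambda>a q. to_total_quotient R a \<otimes>\<^bsub>Q\<^esub> q) \<rparr>)"

text \<open>The tensor product of \<open>Q(R)\<close> and \<open>L\<close> over \<open>R\<close>, as a module over \<open>Q(R)\<close>. An element \<open>X\<close> is the
  class of a formal linear combination \<open>f\<close> of pairs \<open>(p, x)\<close>, and \<open>q\<close> sends it to the sum of the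
  \<open>f (p, x) \<odot> (q p \<otimes> x)\<close>. The union is again over a family of equal classes.\<close>

definition quotient_base_change ::
  "('a, 'r) ring_scheme \<Rightarrow> ('a, 'm, 'x) module_scheme \<Rightarrow>
    (('a \<times> 'a) set, (('a \<times> 'a) set \<times> 'm \<Rightarrow> 'a) set) module" where
  "quotient_base_change R L =
    (let Q = total_quotient_ring R; QM = total_quotient_module R; T = tensor_product R QM L in
      \<lparr> carrier = carrier T, mult = undefined, one = undefined, zero = zero T, add = add T,
        smult = (\<lambda>q X. \<Union>f \<in> X.
          (\<Oplus>\<^bsub>T\<^esub>z \<in> {z. f z \<noteq> \<zero>\<^bsub>R\<^esub>}. f z \<odot>\<^bsub>T\<^esub> pure_tensor R QM L (q \<otimes>\<^bsub>Q\<^esub> fst z) (snd z))) \<rparr>)"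

definition has_rank :: "('a, 'r) ring_scheme \<Rightarrow> ('a, 'm, 'x) module_scheme \<Rightarrow> nat \<Rightarrow> bool" where
  "has_rank R M r \<longleftrightarrow> is_free_of_rank (total_quotient_ring R) (quotient_base_change R M) r"

definition to_quotient_base_change ::
  "('a, 'r) ring_scheme \<Rightarrow> ('a, 'm, 'x) module_scheme \<Rightarrow>
    'm \<Rightarrow> (('a \<times> 'a) set \<times> 'm \<Rightarrow> 'a) set" where
  "to_quotient_base_change R L x =
    pure_tensor R (total_quotient_module R) L \<one>\<^bsub>total_quotient_ring R\<^esub> x"

definition torsion_submodule ::
  "('a, 'r) ring_scheme \<Rightarrow> ('a, 'm, 'x) module_scheme \<Rightarrow> 'm set" where
  "torsion_submodule R L = a_kernel L (quotient_base_change R L) (to_quotient_base_change R L)"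

end

theory Submission
  imports Defs "HOL-Combinatorics.Permutations"
begin

text \<open>Let \<open>x\<^sub>0, x\<^sub>1, \<dots>\<close> be minimal generators of \<open>M\<close> and \<open>y\<close> a member of a minimal generating system of
  \<open>N\<close>. For \<open>b \<le> n\<close> the antisymmetrization of
  \<open>(z\<^sub>0, \<dots>, z\<^sub>b\<^sub>-\<^sub>1) \<mapsto> z\<^sub>0 \<otimes> \<dots> \<otimes> z\<^sub>b\<^sub>-\<^sub>1 \<otimes> x\<^sub>0 \<otimes> \<dots> \<otimes> x\<^sub>0 \<otimes> y\<close> is an alternating form \<open>D\<close> on \<open>M\<^sup>b\<close>
  with values in the tensor product of the theorem, and \<open>w = D (x\<^sub>0, \<dots>, x\<^sub>b\<^sub>-\<^sub>1)\<close> is a nonzero torsion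
  element.

  The element \<open>w\<close> is nonzero because it is nonzero modulo the maximal ideal: there the generators
  form a basis, and the product of the dual coordinate forms takes the value \<open>1\<close> on the summand of \<open>w\<close>
  that belongs to the identity permutation and the value \<open>0\<close> on the others
  (\<open>antisymmetrization_of_generators_nonzero\<close>).

  The element \<open>w\<close> is torsion because one nonzerodivisor kills it (\<open>annihilated_alternating_forms\<close>),
  for a different reason under each of the two hypotheses. Let \<open>b = \<nu>(M)\<close>. If \<open>\<Sum> a\<^sub>i x\<^sub>i = 0\<close>, then
  inserting this sum at position \<open>l\<close> of \<open>D\<close> shows \<open>a\<^sub>l w = 0\<close>; so \<open>I(M)\<close> annihilates \<open>w\<close>. Now let \<open>M\<close> have
  rank \<open>r = b - 1\<close>. Clearing denominators one finds a nonzerodivisor \<open>s\<close> that maps \<open>M\<close> into a submodule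
  generated by \<open>r\<close> elements. An alternating form in \<open>r + 1\<close> arguments vanishes on such a submodule, and
  therefore \<open>s\<^sup>b w = 0\<close>. Here \<open>w\<close> makes sense only if there are at least \<open>b\<close> generators, which holds
  as \<open>M\<close> is not free: if \<open>r\<close> elements generate a module of rank \<open>r\<close>, a determinant, which is again the
  antisymmetrization of a product of coordinate forms, shows that they form a basis
  (\<open>rank_less_number_of_generators\<close>).\<close>

section \<open>Linear maps, spans, free modules and quotients\<close>

lemma module_hom_iff:
  "h \<in> module_hom R M N \<longleftrightarrow>
    (\<forall>x\<in>carrier M. h x \<in> carrier N) \<and>
    (\<forall>x\<in>carrier M. \<forall>y\<in>carrier M. h (x \<oplus>\<^bsub>M\<^esub> y) = h x \<oplus>\<^bsub>N\<^esub> h y) \<and>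
    (\<forall>a\<in>carrier R. \<forall>x\<in>carrier M. h (a \<odot>\<^bsub>M\<^esub> x) = a \<odot>\<^bsub>N\<^esub> h x)"
  by (auto simp: module_hom_def hom_def)

lemma module_hom_closed: "h \<in> module_hom R M N \<Longrightarrow> x \<in> carrier M \<Longrightarrow> h x \<in> carrier N"
  and module_hom_add: "h \<in> module_hom R M N \<Longrightarrow> x \<in> carrier M \<Longrightarrow> y \<in> carrier M \<Longrightarrow>
    h (x \<oplus>\<^bsub>M\<^esub> y) = h x \<oplus>\<^bsub>N\<^esub> h y"
  and module_hom_smult: "h \<in> module_hom R M N \<Longrightarrow> a \<in> carrier R \<Longrightarrow> x \<in> carrier M \<Longrightarrow>
    h (a \<odot>\<^bsub>M\<^esub> x) = a \<odot>\<^bsub>N\<^esub> h x"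
  by (auto simp: module_hom_iff)

lemma module_hom_compose:
  "h \<in> module_hom R M N \<Longrightarrow> g \<in> module_hom R N P \<Longrightarrow> (\<lambda>x. g (h x)) \<in> module_hom R M P"
  by (auto simp: module_hom_iff)

lemma module_cring: "module R M \<Longrightarrow> cring R"
  by (rule module.axioms(1))

lemma (in abelian_group) minus_eq_zero_iff:
  assumes "x \<in> carrier G" "y \<in> carrier G"
  shows "x \<ominus> y = \<zero> \<longleftrightarrow> x = y"
  using assms minus_equality[of x "\<ominus> y"] by (auto simp: a_minus_def r_neg)

lemma module_hom_zero:
  assumes "module R M" "module R N" "h \<in> module_hom R M N"
  shows "h \<zero>\<^bsub>M\<^esub> = \<zero>\<^bsub>N\<^esub>"
proof -
  interpret M: module R M by fact
  interpret N: module R N by fact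
  have "h (\<zero>\<^bsub>R\<^esub> \<odot>\<^bsub>M\<^esub> \<zero>\<^bsub>M\<^esub>) = \<zero>\<^bsub>R\<^esub> \<odot>\<^bsub>N\<^esub> h \<zero>\<^bsub>M\<^esub>"
    by (rule module_hom_smult[OF assms(3)]) auto
  then show ?thesis using module_hom_closed[OF assms(3) M.zero_closed] by simp
qed

lemma module_hom_a_inv:
  assumes "module R M" "module R N" "h \<in> module_hom R M N" "x \<in> carrier M"
  shows "h (\<ominus>\<^bsub>M\<^esub> x) = \<ominus>\<^bsub>N\<^esub> h x"
proof -
  interpret M: module R M by fact
  interpret N: module R N by fact
  have "h (\<ominus>\<^bsub>M\<^esub> x) \<oplus>\<^bsub>N\<^esub> h x = \<zero>\<^bsub>N\<^esub>"
    using assms module_hom_zero[OF assms(1-3)]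
    by (simp add: module_hom_add[OF assms(3), symmetric] M.l_neg)
  then show ?thesis using assms(3,4) module_hom_closed[OF assms(3)]
    by (metis M.a_inv_closed N.minus_equality)
qed

lemma module_hom_minus:
  assumes "module R M" "module R N" "h \<in> module_hom R M N" "x \<in> carrier M" "y \<in> carrier M"
  shows "h (x \<ominus>\<^bsub>M\<^esub> y) = h x \<ominus>\<^bsub>N\<^esub> h y"
proof -
  interpret M: module R M by fact
  show ?thesis
    using assms by (simp add: a_minus_def module_hom_add[OF assms(3)] module_hom_a_inv[OF assms(1-3)])
qed

lemma module_hom_minus_eq_zero:
  assumes "module R M" "module R N" "h \<in> module_hom R M N" "x \<in> carrier M" "y \<in> carrier M" "h x = h y"
  shows "h (x \<ominus>\<^bsub>M\<^esub> y) = \<zero>\<^bsub>N\<^esub>"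
proof -
  interpret N: module R N by fact
  show ?thesis
    using module_hom_minus[OF assms(1-5)] module_hom_closed[OF assms(3,5)] assms(6)
    by (simp add: N.minus_eq_zero_iff)
qed

lemma module_hom_inj_onI:
  assumes "module R M" "module R N" "h \<in> module_hom R M N"
    and "\<And>x. x \<in> carrier M \<Longrightarrow> h x = \<zero>\<^bsub>N\<^esub> \<Longrightarrow> x = \<zero>\<^bsub>M\<^esub>"
  shows "inj_on h (carrier M)"
proof (rule inj_onI)
  interpret M: module R M by fact
  fix x y assume xy: "x \<in> carrier M" "y \<in> carrier M" "h x = h y"
  have "x \<ominus>\<^bsub>M\<^esub> y = \<zero>\<^bsub>M\<^esub>"
    using xy by (intro assms(4) module_hom_minus_eq_zero[OF assms(1-3)]) auto
  then show "x = y" using xy by (simp add: M.minus_eq_zero_iff)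
qed

lemma module_hom_finsum:
  assumes "module R M" "module R N" "h \<in> module_hom R M N" "f \<in> A \<rightarrow> carrier M"
  shows "h (\<Oplus>\<^bsub>M\<^esub>i\<in>A. f i) = (\<Oplus>\<^bsub>N\<^esub>i\<in>A. h (f i))"
proof -
  interpret M: module R M by fact
  interpret N: module R N by fact
  from assms(4) show ?thesis
  proof (induction A rule: infinite_finite_induct)
    case (insert x F)
    then have "f \<in> F \<rightarrow> carrier M" "f x \<in> carrier M" by auto
    moreover from this have "(\<lambda>i. h (f i)) \<in> F \<rightarrow> carrier N" "h (f x) \<in> carrier N"
      using module_hom_closed[OF assms(3)] by auto
    ultimately show ?case using insert
      by (simp add: module_hom_add[OF assms(3)])
  qed (simp_all add: module_hom_zero[OF assms(1-3)])
qed

lemma a_kernel_eq: "a_kernel M N h = {x \<in> carrier M. h x = \<zero>\<^bsub>N\<^esub>}"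
  by (simp add: a_kernel_def kernel_def)

lemma submodule_subset: "submodule H R M \<Longrightarrow> x \<in> H \<Longrightarrow> x \<in> carrier M"
  using submodule.axioms(1) subgroup.subset by fastforce

lemma submodule_zero_closed: "submodule H R M \<Longrightarrow> \<zero>\<^bsub>M\<^esub> \<in> H"
  using submodule.axioms(1) subgroup.one_closed by fastforce

lemma submodule_add_closed: "submodule H R M \<Longrightarrow> x \<in> H \<Longrightarrow> y \<in> H \<Longrightarrow> x \<oplus>\<^bsub>M\<^esub> y \<in> H"
  using submodule.axioms(1) subgroup.m_closed by fastforce

lemma submodule_smult_closed:
  "submodule H R M \<Longrightarrow> a \<in> carrier R \<Longrightarrow> x \<in> H \<Longrightarrow> a \<odot>\<^bsub>M\<^esub> x \<in> H"
  by (rule submodule.smult_closed)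

text \<open>Negatives come for free, being multiples by \<open>\<ominus> 1\<close>.\<close>

lemma (in module) submodule_intro:
  assumes "H \<subseteq> carrier M" "\<zero>\<^bsub>M\<^esub> \<in> H" "\<And>x y. x \<in> H \<Longrightarrow> y \<in> H \<Longrightarrow> x \<oplus>\<^bsub>M\<^esub> y \<in> H"
    "\<And>a x. a \<in> carrier R \<Longrightarrow> x \<in> H \<Longrightarrow> a \<odot>\<^bsub>M\<^esub> x \<in> H"
  shows "submodule H R M"
proof (rule submoduleI)
  fix x assume x: "x \<in> H"
  then have "\<ominus>\<^bsub>M\<^esub> x = (\<ominus>\<^bsub>R\<^esub> \<one>\<^bsub>R\<^esub>) \<odot>\<^bsub>M\<^esub> x" using assms(1) by (auto simp: smult_l_minus)
  then show "\<ominus>\<^bsub>M\<^esub> x \<in> H" using assms(4)[OF _ x] by simp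
qed (use assms in auto)

lemma submodule_minus_closed:
  assumes "module R M" "submodule H R M" "x \<in> H" "y \<in> H"
  shows "x \<ominus>\<^bsub>M\<^esub> y \<in> H"
proof -
  interpret M: module R M by fact
  show ?thesis using assms M.submoduleE(3,5)[OF assms(2)] by (simp add: a_minus_def)
qed

lemma submodule_finsum_closed:
  assumes "module R M" "submodule H R M" "f \<in> A \<rightarrow> H"
  shows "(\<Oplus>\<^bsub>M\<^esub>i\<in>A. f i) \<in> H"
proof -
  interpret M: module R M by fact
  from assms(3) show ?thesis
  proof (induction A rule: infinite_finite_induct)
    case (insert x F)
    then have "f \<in> F \<rightarrow> carrier M" "f x \<in> carrier M" "f x \<in> H" "f \<in> F \<rightarrow> H"
      using submodule_subset[OF assms(2)] by auto
    then show ?case using insert by (simp add: submodule_add_closed[OF assms(2)])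
  qed (simp_all add: submodule_zero_closed[OF assms(2)])
qed

lemma submodule_zero:
  assumes "module R M" shows "submodule {\<zero>\<^bsub>M\<^esub>} R M"
proof -
  interpret M: module R M by fact
  show ?thesis by (rule M.submodule_intro) auto
qed

lemma submodule_vimage:
  assumes "module R M" "module R N" "h \<in> module_hom R M N" "submodule H R N"
  shows "submodule {x \<in> carrier M. h x \<in> H} R M"
proof -
  interpret M: module R M by fact
  show ?thesis
    by (rule M.submodule_intro)
      (auto simp: module_hom_zero[OF assms(1-3)] module_hom_add[OF assms(3)]
        module_hom_smult[OF assms(3)] submodule_zero_closed[OF assms(4)]
        submodule_add_closed[OF assms(4)] submodule_smult_closed[OF assms(4)])
qed

lemma submodule_image:
  assumes "module R M" "module R N" "h \<in> module_hom R M N" "submodule H R M"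
  shows "submodule (h ` H) R N"
proof -
  interpret N: module R N by fact
  note H = submodule_subset[OF assms(4)]
  show ?thesis
  proof (rule N.submodule_intro)
    show "h ` H \<subseteq> carrier N" using H module_hom_closed[OF assms(3)] by auto
    show "\<zero>\<^bsub>N\<^esub> \<in> h ` H"
      using module_hom_zero[OF assms(1-3)] submodule_zero_closed[OF assms(4)] by force
    show "x \<oplus>\<^bsub>N\<^esub> y \<in> h ` H" if "x \<in> h ` H" "y \<in> h ` H" for x y
      using that H submodule_add_closed[OF assms(4)]
      by (auto simp: module_hom_add[OF assms(3), symmetric])
    show "a \<odot>\<^bsub>N\<^esub> x \<in> h ` H" if "a \<in> carrier R" "x \<in> h ` H" for a x
      using that H submodule_smult_closed[OF assms(4)]
      by (auto simp: module_hom_smult[OF assms(3), symmetric])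
  qed
qed

lemma (in module) smult_commute:
  "a \<in> carrier R \<Longrightarrow> b \<in> carrier R \<Longrightarrow> x \<in> carrier M \<Longrightarrow> a \<odot>\<^bsub>M\<^esub> (b \<odot>\<^bsub>M\<^esub> x) = b \<odot>\<^bsub>M\<^esub> (a \<odot>\<^bsub>M\<^esub> x)"
  by (simp add: smult_assoc1[symmetric] m_comm)

lemma smult_hom:
  assumes "module R M" "a \<in> carrier R"
  shows "(\<lambda>x. a \<odot>\<^bsub>M\<^esub> x) \<in> module_hom R M M"
proof -
  interpret M: module R M by fact
  have "a \<odot>\<^bsub>M\<^esub> (b \<odot>\<^bsub>M\<^esub> x) = b \<odot>\<^bsub>M\<^esub> (a \<odot>\<^bsub>M\<^esub> x)" if "b \<in> carrier R" "x \<in> carrier M" for b x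
    using that assms(2) by (metis M.smult_assoc1 M.m_comm)
  then show ?thesis using assms(2) by (auto simp: module_hom_iff M.smult_r_distr)
qed

lemma submodule_annihilated:
  assumes "module R M" "a \<in> carrier R"
  shows "submodule {x \<in> carrier M. a \<odot>\<^bsub>M\<^esub> x = \<zero>\<^bsub>M\<^esub>} R M"
  using submodule_vimage[OF assms(1,1) smult_hom[OF assms] submodule_zero[OF assms(1)]] by simp

lemma submodule_span_submodule:
  assumes "module R M" "A \<subseteq> carrier M"
  shows "submodule (submodule_span R M A) R M"
proof -
  interpret M: module R M by fact
  have "submodule (carrier M) R M" by (rule M.carrier_is_submodule)
  then show ?thesis using assms(2)
    by (intro M.submodule_intro)
      (auto simp: submodule_span_def submodule_zero_closed submodule_add_closed
        submodule_smult_closed)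
qed

lemma submodule_span_least: "submodule H R M \<Longrightarrow> A \<subseteq> H \<Longrightarrow> submodule_span R M A \<subseteq> H"
  by (auto simp: submodule_span_def)

lemma submodule_span_superset: "A \<subseteq> submodule_span R M A"
  by (auto simp: submodule_span_def)

lemma generating_setI:
  assumes "module R M" "A \<subseteq> carrier M" "\<And>H. submodule H R M \<Longrightarrow> A \<subseteq> H \<Longrightarrow> carrier M \<subseteq> H"
  shows "generating_set R M A"
  using assms(3)[OF submodule_span_submodule[OF assms(1,2)] submodule_span_superset]
    submodule_subset[OF submodule_span_submodule[OF assms(1,2)]] assms(2)
  by (auto simp: generating_set_def)

lemma generating_setD:
  "generating_set R M A \<Longrightarrow> submodule H R M \<Longrightarrow> A \<subseteq> H \<Longrightarrow> x \<in> carrier M \<Longrightarrow> x \<in> H"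
  using submodule_span_least[of H R M A] by (auto simp: generating_set_def)


subsection \<open>Free modules\<close>

lemma free_module_simps [simp]:
  "\<zero>\<^bsub>free_module R X\<^esub> = (\<lambda>x. \<zero>\<^bsub>R\<^esub>)"
  "f \<oplus>\<^bsub>free_module R X\<^esub> g = (\<lambda>x. f x \<oplus>\<^bsub>R\<^esub> g x)"
  "a \<odot>\<^bsub>free_module R X\<^esub> f = (\<lambda>x. a \<otimes>\<^bsub>R\<^esub> f x)"
  by (simp_all add: free_module_def)

lemma free_module_carrier:
  "f \<in> carrier (free_module R X) \<longleftrightarrow>
    (\<forall>x\<in>X. f x \<in> carrier R) \<and> (\<forall>x. x \<notin> X \<longrightarrow> f x = \<zero>\<^bsub>R\<^esub>) \<and> finite {x. f x \<noteq> \<zero>\<^bsub>R\<^esub>}"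
  by (auto simp: free_module_def)

lemma free_module_carrier_finite:
  assumes "finite X"
  shows "f \<in> carrier (free_module R X) \<longleftrightarrow>
    (\<forall>x\<in>X. f x \<in> carrier R) \<and> (\<forall>x. x \<notin> X \<longrightarrow> f x = \<zero>\<^bsub>R\<^esub>)"
proof -
  have "finite {x. f x \<noteq> \<zero>\<^bsub>R\<^esub>}" if "\<forall>x. x \<notin> X \<longrightarrow> f x = \<zero>\<^bsub>R\<^esub>"
    by (rule finite_subset[OF _ assms]) (use that in auto)
  then show ?thesis by (auto simp: free_module_carrier)
qed

lemma free_module_module:
  fixes R (structure)
  assumes "cring R"
  shows "module R (free_module R X)"
proof -
  interpret cring R by fact
  let ?F = "free_module R X"
  have cl: "f x \<in> carrier R" if "f \<in> carrier ?F" for f x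
    using that by (cases "x \<in> X") (auto simp: free_module_carrier)
  have fin: "finite {x. h (f x) (g x) \<noteq> \<zero>}"
    if "f \<in> carrier ?F" "g \<in> carrier ?F" "h \<zero> \<zero> = \<zero>" for f g h
    by (rule finite_subset[of _ "{x. f x \<noteq> \<zero>} \<union> {x. g x \<noteq> \<zero>}"])
      (use that in \<open>auto simp: free_module_carrier\<close>)
  have sc: "(\<lambda>x. a \<otimes> f x) \<in> carrier ?F" if "a \<in> carrier R" "f \<in> carrier ?F" for a f
    using that fin[of f f "\<lambda>u v. a \<otimes> u"] by (auto simp: free_module_carrier)
  have ab: "abelian_group ?F"
  proof (rule abelian_groupI)
    fix f g assume fg: "f \<in> carrier ?F" "g \<in> carrier ?F"
    then show "f \<oplus>\<^bsub>?F\<^esub> g \<in> carrier ?F"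
      using fin[of f g "\<lambda>u v. u \<oplus> v"] by (auto simp: free_module_carrier)
    show "f \<oplus>\<^bsub>?F\<^esub> g = g \<oplus>\<^bsub>?F\<^esub> f" using fg cl by (auto simp: a_comm)
    have "(\<lambda>x. (\<ominus> \<one>) \<otimes> f x) \<in> carrier ?F" using fg by (intro sc) auto
    moreover have "(\<lambda>x. (\<ominus> \<one>) \<otimes> f x) \<oplus>\<^bsub>?F\<^esub> f = \<zero>\<^bsub>?F\<^esub>"
      using fg cl by (auto simp: l_minus l_neg)
    ultimately show "\<exists>y\<in>carrier ?F. y \<oplus>\<^bsub>?F\<^esub> f = \<zero>\<^bsub>?F\<^esub>" by blast
  next
    show "\<zero>\<^bsub>?F\<^esub> \<in> carrier ?F" by (auto simp: free_module_carrier)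
  qed (auto simp: cl a_assoc)
  show ?thesis
    by (rule moduleI) (auto simp: assms ab sc cl l_distr r_distr m_assoc)
qed

lemma free_module_closed:
  "cring R \<Longrightarrow> f \<in> carrier (free_module R X) \<Longrightarrow> f x \<in> carrier R"
  by (cases "x \<in> X") (auto simp: free_module_carrier cring.cring_simprules)

lemma free_module_mono:
  "cring R \<Longrightarrow> f \<in> carrier (free_module R X) \<Longrightarrow> X \<subseteq> Y \<Longrightarrow> f \<in> carrier (free_module R Y)"
  using free_module_closed by (fastforce simp: free_module_carrier)

lemma free_module_minus:
  assumes "cring R" "f \<in> carrier (free_module R X)" "g \<in> carrier (free_module R X)"
  shows "f \<ominus>\<^bsub>free_module R X\<^esub> g = (\<lambda>x. f x \<ominus>\<^bsub>R\<^esub> g x)"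
proof -
  interpret cring R by fact
  interpret F: module R "free_module R X" by (rule free_module_module[OF assms(1)])
  note cl = free_module_closed[OF assms(1)]
  have "\<ominus>\<^bsub>free_module R X\<^esub> g = \<ominus>\<^bsub>R\<^esub> \<one>\<^bsub>R\<^esub> \<odot>\<^bsub>free_module R X\<^esub> g"
    using assms(3) F.smult_l_minus[OF one_closed, of g] F.smult_one[of g]
    by (simp del: free_module_simps)
  also have "\<dots> = (\<lambda>x. \<ominus>\<^bsub>R\<^esub> g x)" using cl[OF assms(3)] by (simp add: l_minus)
  finally show ?thesis by (simp add: a_minus_def)
qed

lemma basis_vector_closed:
  assumes "cring R" "x \<in> X"
  shows "basis_vector R x \<in> carrier (free_module R X)"
proof -
  interpret cring R by fact
  have "finite {y. basis_vector R x y \<noteq> \<zero>\<^bsub>R\<^esub>}"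
    by (rule finite_subset[of _ "{x}"]) (auto simp: basis_vector_def)
  then show ?thesis using assms(2) by (auto simp: free_module_carrier basis_vector_def)
qed

lemma free_module_generated:
  assumes "cring R" "submodule H R (free_module R X)" "\<And>x. x \<in> X \<Longrightarrow> basis_vector R x \<in> H"
    and "f \<in> carrier (free_module R X)"
  shows "f \<in> H"
proof -
  interpret cring R by fact
  have "f \<in> H" if "finite A" "f \<in> carrier (free_module R X)" "{x. f x \<noteq> \<zero>\<^bsub>R\<^esub>} \<subseteq> A" for A f
    using that
  proof (induction A arbitrary: f)
    case empty
    then have "f = \<zero>\<^bsub>free_module R X\<^esub>" by auto
    then show ?case using submodule_zero_closed[OF assms(2)] by metis
  next
    case (insert a A)
    note f = insert.prems(1) and cl = free_module_closed[OF assms(1) insert.prems(1)]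
    let ?g = "f(a := \<zero>\<^bsub>R\<^esub>)"
    have "finite {x. ?g x \<noteq> \<zero>\<^bsub>R\<^esub>}"
      by (rule finite_subset[of _ "{x. f x \<noteq> \<zero>\<^bsub>R\<^esub>}"]) (use f in \<open>auto simp: free_module_carrier\<close>)
    then have "?g \<in> carrier (free_module R X)"
      using f by (auto simp: free_module_carrier)
    moreover have "{x. ?g x \<noteq> \<zero>\<^bsub>R\<^esub>} \<subseteq> A" using insert.prems(2) by auto
    ultimately have g: "?g \<in> H" by (rule insert.IH)
    show ?case
    proof (cases "a \<in> X")
      case False
      then have "?g = f" using f by (auto simp: free_module_carrier)
      then show ?thesis using g by simp
    next
      case True
      have "f = ?g \<oplus>\<^bsub>free_module R X\<^esub> f a \<odot>\<^bsub>free_module R X\<^esub> basis_vector R a"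
        using cl by (auto simp: basis_vector_def)
      also have "\<dots> \<in> H"
        using g assms(3)[OF True] cl
        by (intro submodule_add_closed[OF assms(2)] submodule_smult_closed[OF assms(2)])
      finally show ?thesis .
    qed
  qed
  then show ?thesis using assms(4) by (auto simp: free_module_carrier)
qed

lemma free_module_hom_eqI:
  assumes "module R P" "g \<in> module_hom R (free_module R X) P" "h \<in> module_hom R (free_module R X) P"
    and eq: "\<And>x. x \<in> X \<Longrightarrow> g (basis_vector R x) = h (basis_vector R x)"
    and "f \<in> carrier (free_module R X)"
  shows "g f = h f"
proof -
  interpret P: module R P by fact
  have cr: "cring R" by unfold_locales
  interpret F: module R "free_module R X" by (rule free_module_module[OF cr])
  have "submodule {f \<in> carrier (free_module R X). g f = h f} R (free_module R X)"
    by (rule F.submodule_intro)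
      (auto simp: module_hom_zero[OF F.module_axioms assms(1)] assms(2,3)
        module_hom_add[OF assms(2)] module_hom_add[OF assms(3)] module_hom_smult[OF assms(2)]
        module_hom_smult[OF assms(3)] simp del: free_module_simps)
  then have "f \<in> {f \<in> carrier (free_module R X). g f = h f}"
    by (rule free_module_generated[OF cr]) (use eq assms(5) basis_vector_closed[OF cr] in auto)
  then show ?thesis by simp
qed

definition linear_extension ::
  "('a, 'r) ring_scheme \<Rightarrow> ('a, 'p, 'y) module_scheme \<Rightarrow> ('x \<Rightarrow> 'p) \<Rightarrow> ('x \<Rightarrow> 'a) \<Rightarrow> 'p" where
  "linear_extension R P \<phi> f = (\<Oplus>\<^bsub>P\<^esub>x \<in> {x. f x \<noteq> \<zero>\<^bsub>R\<^esub>}. f x \<odot>\<^bsub>P\<^esub> \<phi> x)"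

lemma linear_extension_superset:
  assumes "module R P" "\<phi> \<in> X \<rightarrow> carrier P" "f \<in> carrier (free_module R X)"
    "finite A" "A \<subseteq> X" "{x. f x \<noteq> \<zero>\<^bsub>R\<^esub>} \<subseteq> A"
  shows "linear_extension R P \<phi> f = (\<Oplus>\<^bsub>P\<^esub>x\<in>A. f x \<odot>\<^bsub>P\<^esub> \<phi> x)"
proof -
  interpret P: module R P by fact
  have cr: "cring R" by unfold_locales
  show ?thesis unfolding linear_extension_def
    using assms(2,4-6) free_module_closed[OF cr assms(3)]
    by (intro P.add.finprod_mono_neutral_cong_left) (auto simp: subset_iff Pi_iff)
qed

lemma linear_extension_finite:
  assumes "module R P" "finite X" "\<phi> \<in> X \<rightarrow> carrier P" "f \<in> carrier (free_module R X)"
  shows "linear_extension R P \<phi> f = (\<Oplus>\<^bsub>P\<^esub>x\<in>X. f x \<odot>\<^bsub>P\<^esub> \<phi> x)"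
  using assms by (intro linear_extension_superset) (auto simp: free_module_carrier)

lemma linear_extension_hom:
  assumes "module R P" "\<phi> \<in> X \<rightarrow> carrier P"
  shows "linear_extension R P \<phi> \<in> module_hom R (free_module R X) P"
proof -
  interpret P: module R P by fact
  have cr: "cring R" by unfold_locales
  interpret F: module R "free_module R X" by (rule free_module_module[OF cr])
  let ?F = "free_module R X"
  note cl = free_module_closed[OF cr, where X = X]
  have supp: "finite {x. f x \<noteq> \<zero>\<^bsub>R\<^esub>}" "{x. f x \<noteq> \<zero>\<^bsub>R\<^esub>} \<subseteq> X" if "f \<in> carrier ?F" for f
    using that by (auto simp: free_module_carrier)
  have "linear_extension R P \<phi> (f \<oplus>\<^bsub>?F\<^esub> g) =
      linear_extension R P \<phi> f \<oplus>\<^bsub>P\<^esub> linear_extension R P \<phi> g"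
    if fg: "f \<in> carrier ?F" "g \<in> carrier ?F" for f g
  proof -
    let ?A = "{x. f x \<noteq> \<zero>\<^bsub>R\<^esub>} \<union> {x. g x \<noteq> \<zero>\<^bsub>R\<^esub>}"
    have A: "finite ?A" "?A \<subseteq> X" "{x. (f \<oplus>\<^bsub>?F\<^esub> g) x \<noteq> \<zero>\<^bsub>R\<^esub>} \<subseteq> ?A"
      using fg supp by auto
    have \<phi>: "f x \<noteq> \<zero>\<^bsub>R\<^esub> \<Longrightarrow> \<phi> x \<in> carrier P" "g x \<noteq> \<zero>\<^bsub>R\<^esub> \<Longrightarrow> \<phi> x \<in> carrier P" for x
      using A(2) assms(2) by blast+
    have "linear_extension R P \<phi> (f \<oplus>\<^bsub>?F\<^esub> g) = (\<Oplus>\<^bsub>P\<^esub>x\<in>?A. (f \<oplus>\<^bsub>?F\<^esub> g) x \<odot>\<^bsub>P\<^esub> \<phi> x)"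
      by (rule linear_extension_superset[OF assms F.a_closed[OF fg] A])
    also have "\<dots> = (\<Oplus>\<^bsub>P\<^esub>x\<in>?A. f x \<odot>\<^bsub>P\<^esub> \<phi> x \<oplus>\<^bsub>P\<^esub> g x \<odot>\<^bsub>P\<^esub> \<phi> x)"
      using \<phi> cl fg by (intro P.finsum_cong') (auto simp: P.smult_l_distr)
    also have "\<dots> = (\<Oplus>\<^bsub>P\<^esub>x\<in>?A. f x \<odot>\<^bsub>P\<^esub> \<phi> x) \<oplus>\<^bsub>P\<^esub> (\<Oplus>\<^bsub>P\<^esub>x\<in>?A. g x \<odot>\<^bsub>P\<^esub> \<phi> x)"
      using \<phi> cl fg by (intro P.finsum_addf) auto
    finally show ?thesis
      using linear_extension_superset[OF assms fg(1) A(1,2)]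
        linear_extension_superset[OF assms fg(2) A(1,2)] by simp
  qed
  moreover have "linear_extension R P \<phi> (a \<odot>\<^bsub>?F\<^esub> f) = a \<odot>\<^bsub>P\<^esub> linear_extension R P \<phi> f"
    if f: "f \<in> carrier ?F" and a: "a \<in> carrier R" for a f
  proof -
    let ?A = "{x. f x \<noteq> \<zero>\<^bsub>R\<^esub>}"
    have \<phi>: "\<phi> x \<in> carrier P" if "x \<in> ?A" for x using that supp[OF f] assms(2) by blast
    have "linear_extension R P \<phi> (a \<odot>\<^bsub>?F\<^esub> f) = (\<Oplus>\<^bsub>P\<^esub>x\<in>?A. (a \<odot>\<^bsub>?F\<^esub> f) x \<odot>\<^bsub>P\<^esub> \<phi> x)"
      by (rule linear_extension_superset[OF assms F.smult_closed[OF a f] supp[OF f]]) (use a in auto)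
    also have "\<dots> = (\<Oplus>\<^bsub>P\<^esub>x\<in>?A. a \<odot>\<^bsub>P\<^esub> (f x \<odot>\<^bsub>P\<^esub> \<phi> x))"
      using \<phi> cl f a by (intro P.finsum_cong') (auto simp: P.smult_assoc1)
    also have "\<dots> = a \<odot>\<^bsub>P\<^esub> linear_extension R P \<phi> f"
      unfolding linear_extension_def
      using \<phi> cl f a supp[OF f] by (intro P.finsum_smult_ldistr[symmetric]) auto
    finally show ?thesis .
  qed
  moreover have "linear_extension R P \<phi> f \<in> carrier P" if "f \<in> carrier ?F" for f
    unfolding linear_extension_def
    using supp[OF that] assms(2) cl[OF that] by (intro P.finsum_closed) auto
  ultimately show ?thesis by (auto simp: module_hom_iff)
qed

lemma linear_extension_cong:
  assumes "module R P" "\<psi> \<in> X \<rightarrow> carrier P" "\<And>x. x \<in> X \<Longrightarrow> \<phi> x = \<psi> x" "f \<in> carrier (free_module R X)"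
  shows "linear_extension R P \<phi> f = linear_extension R P \<psi> f"
proof -
  interpret P: module R P by fact
  have cr: "cring R" by unfold_locales
  have "{x. f x \<noteq> \<zero>\<^bsub>R\<^esub>} \<subseteq> X" using assms(4) by (auto simp: free_module_carrier)
  then show ?thesis unfolding linear_extension_def
    using assms(2,3) free_module_closed[OF cr assms(4)] by (intro P.finsum_cong') (auto simp: subset_iff Pi_iff)
qed

lemma linear_extension_basis_vector:
  assumes "module R P" "\<phi> \<in> X \<rightarrow> carrier P" "x \<in> X"
  shows "linear_extension R P \<phi> (basis_vector R x) = \<phi> x"
proof -
  interpret P: module R P by fact
  have cr: "cring R" by unfold_locales
  have "linear_extension R P \<phi> (basis_vector R x) =
      (\<Oplus>\<^bsub>P\<^esub>y\<in>{x}. basis_vector R x y \<odot>\<^bsub>P\<^esub> \<phi> y)"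
    using assms basis_vector_closed[OF cr]
    by (intro linear_extension_superset[where X = X]) (auto simp: basis_vector_def)
  also have "\<dots> = \<phi> x" using assms by (subst P.finsum_insert) (auto simp: basis_vector_def Pi_iff)
  finally show ?thesis .
qed

lemma linear_extension_image:
  assumes "module R M" "x \<in> X \<rightarrow> carrier M"
  shows "linear_extension R M x ` carrier (free_module R X) = submodule_span R M (x ` X)"
proof -
  interpret M: module R M by fact
  have cr: "cring R" by unfold_locales
  note F = free_module_module[OF cr, of X]
  interpret F: module R "free_module R X" by (rule F)
  note L = linear_extension_hom[OF assms] and Lb = linear_extension_basis_vector[OF assms]
  have xM: "x ` X \<subseteq> carrier M" using assms(2) by auto
  show ?thesis
  proof
    have "f \<in> {f \<in> carrier (free_module R X). linear_extension R M x f \<in> submodule_span R M (x ` X)}"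
      if f: "f \<in> carrier (free_module R X)" for f
    proof (rule free_module_generated[OF cr submodule_vimage[OF F assms(1) L
            submodule_span_submodule[OF assms(1) xM]] _ f])
      show "basis_vector R z \<in> {f \<in> carrier (free_module R X). linear_extension R M x f \<in> submodule_span R M (x ` X)}"
        if "z \<in> X" for z
        using that basis_vector_closed[OF cr that] submodule_span_superset[of "x ` X" R M]
        by (auto simp: Lb)
    qed
    then show "linear_extension R M x ` carrier (free_module R X) \<subseteq> submodule_span R M (x ` X)"
      by auto
    have "x z \<in> linear_extension R M x ` carrier (free_module R X)" if "z \<in> X" for z
      using Lb[OF that] basis_vector_closed[OF cr that] by (metis imageI)
    then have "x ` X \<subseteq> linear_extension R M x ` carrier (free_module R X)" by auto
    then show "submodule_span R M (x ` X) \<subseteq> linear_extension R M x ` carrier (free_module R X)"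
      by (rule submodule_span_least[OF submodule_image[OF F assms(1) L F.carrier_is_submodule]])
  qed
qed


subsection \<open>Quotient modules\<close>

lemma submodule_abelian_subgroup:
  assumes "module R M" "submodule K R M"
  shows "abelian_subgroup K M"
proof -
  interpret M: module R M by fact
  show ?thesis using submodule.axioms(1)[OF assms(2)]
    by (intro abelian_subgroupI3) (auto intro: additive_subgroupI M.abelian_group_axioms)
qed

text \<open>The definition of the scalar multiplication takes a union over representatives; all members of the
  union are the same coset.\<close>

lemma quotient_module_smult:
  assumes "module R M" "submodule K R M" "a \<in> carrier R" "v \<in> carrier M"
  shows "(\<Union>x\<in>K +>\<^bsub>M\<^esub> v. K +>\<^bsub>M\<^esub> (a \<odot>\<^bsub>M\<^esub> x)) = K +>\<^bsub>M\<^esub> (a \<odot>\<^bsub>M\<^esub> v)"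
proof -
  interpret M: module R M by fact
  interpret K: abelian_subgroup K M by (rule submodule_abelian_subgroup[OF assms(1,2)])
  have "K +>\<^bsub>M\<^esub> (a \<odot>\<^bsub>M\<^esub> x) = K +>\<^bsub>M\<^esub> (a \<odot>\<^bsub>M\<^esub> v)" if "x \<in> K +>\<^bsub>M\<^esub> v" for x
  proof -
    have x: "x \<in> carrier M" using that assms(4) K.a_elemrcos_carrier by blast
    then have "x \<ominus>\<^bsub>M\<^esub> v \<in> K"
      using that K.a_rcos_module_imp[OF assms(4)] by (simp add: a_minus_def)
    then have "a \<odot>\<^bsub>M\<^esub> (x \<ominus>\<^bsub>M\<^esub> v) \<in> K" using assms(2,3) submodule_smult_closed by metis
    moreover have "a \<odot>\<^bsub>M\<^esub> (x \<ominus>\<^bsub>M\<^esub> v) = a \<odot>\<^bsub>M\<^esub> x \<ominus>\<^bsub>M\<^esub> a \<odot>\<^bsub>M\<^esub> v"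
      using x assms(3,4) by (simp add: a_minus_def M.smult_r_distr M.smult_r_minus)
    ultimately have "a \<odot>\<^bsub>M\<^esub> x \<in> K +>\<^bsub>M\<^esub> (a \<odot>\<^bsub>M\<^esub> v)"
      using x assms(3,4) by (intro K.a_rcos_module_rev) (auto simp: a_minus_def)
    then show ?thesis
      using assms(3,4) by (intro M.a_repr_independence[symmetric]) (auto intro: K.a_subgroup)
  qed
  moreover have "v \<in> K +>\<^bsub>M\<^esub> v" by (rule K.a_rcos_self[OF assms(4)])
  ultimately show ?thesis by blast
qed

lemma coset_eq_iff:
  assumes "module R M" "submodule K R M" "x \<in> carrier M" "y \<in> carrier M"
  shows "K +>\<^bsub>M\<^esub> x = K +>\<^bsub>M\<^esub> y \<longleftrightarrow> x \<ominus>\<^bsub>M\<^esub> y \<in> K"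
proof -
  interpret M: module R M by fact
  interpret K: abelian_subgroup K M by (rule submodule_abelian_subgroup[OF assms(1,2)])
  show ?thesis
    using assms(3,4) K.a_rcos_self[of x] K.a_rcos_module[of y x] K.a_repr_independence'[of x y]
    by (auto simp: a_minus_def)
qed

lemma quotient_module_simps [simp]:
  "\<zero>\<^bsub>quotient_module R M K\<^esub> = K"
  "X \<oplus>\<^bsub>quotient_module R M K\<^esub> Y = X <+>\<^bsub>M\<^esub> Y"
  by (simp_all add: quotient_module_def)

lemma quotient_module_carrier:
  "carrier (quotient_module R M K) = (\<lambda>x. K +>\<^bsub>M\<^esub> x) ` carrier M"
  by (auto simp: quotient_module_def A_RCOSETS_def RCOSETS_def a_r_coset_def)

lemma quotient_module_module:
  assumes "module R M" "submodule K R M"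
  shows "module R (quotient_module R M K)"
proof -
  interpret M: module R M by fact
  interpret K: abelian_subgroup K M by (rule submodule_abelian_subgroup[OF assms])
  let ?Q = "quotient_module R M K"
  have sm: "a \<odot>\<^bsub>?Q\<^esub> (K +>\<^bsub>M\<^esub> v) = K +>\<^bsub>M\<^esub> (a \<odot>\<^bsub>M\<^esub> v)"
    if "a \<in> carrier R" "v \<in> carrier M" for a v
    using quotient_module_smult[OF assms that] by (simp add: quotient_module_def)
  have z: "K +>\<^bsub>M\<^esub> \<zero>\<^bsub>M\<^esub> = K" using K.a_subset by simp
  have ab: "abelian_group ?Q"
  proof (rule abelian_groupI)
    show "\<zero>\<^bsub>?Q\<^esub> \<in> carrier ?Q" using z by (simp add: quotient_module_carrier image_iff bexI[of _ "\<zero>\<^bsub>M\<^esub>"])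
    fix X assume "X \<in> carrier ?Q"
    then obtain v where v: "v \<in> carrier M" "X = K +>\<^bsub>M\<^esub> v" by (auto simp: quotient_module_carrier)
    show "\<zero>\<^bsub>?Q\<^esub> \<oplus>\<^bsub>?Q\<^esub> X = X"
      using K.a_rcos_sum[of "\<zero>\<^bsub>M\<^esub>" v] v z by simp
    have "(K +>\<^bsub>M\<^esub> \<ominus>\<^bsub>M\<^esub> v) \<oplus>\<^bsub>?Q\<^esub> X = \<zero>\<^bsub>?Q\<^esub>"
      using v z K.a_rcos_sum[of "\<ominus>\<^bsub>M\<^esub> v" v] by (simp add: M.l_neg)
    moreover have "(K +>\<^bsub>M\<^esub> \<ominus>\<^bsub>M\<^esub> v) \<in> carrier ?Q" using v by (simp add: quotient_module_carrier)
    ultimately show "\<exists>Y\<in>carrier ?Q. Y \<oplus>\<^bsub>?Q\<^esub> X = \<zero>\<^bsub>?Q\<^esub>" by blast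
  qed (auto simp: quotient_module_carrier K.a_rcos_sum M.add.m_ac)
  show ?thesis
    by (rule moduleI)
      (auto simp: ab quotient_module_carrier sm K.a_rcos_sum M.smult_l_distr M.smult_r_distr
        M.smult_assoc1 M.is_cring)
qed

lemma coset_map_hom:
  assumes "module R M" "submodule K R M"
  shows "(\<lambda>x. K +>\<^bsub>M\<^esub> x) \<in> module_hom R M (quotient_module R M K)"
proof -
  interpret K: abelian_subgroup K M by (rule submodule_abelian_subgroup[OF assms])
  have "K +>\<^bsub>M\<^esub> (a \<odot>\<^bsub>M\<^esub> x) = a \<odot>\<^bsub>quotient_module R M K\<^esub> (K +>\<^bsub>M\<^esub> x)"
    if "a \<in> carrier R" "x \<in> carrier M" for a x
    using quotient_module_smult[OF assms that] by (simp add: quotient_module_def)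
  then show ?thesis by (auto simp: module_hom_iff quotient_module_carrier K.a_rcos_sum)
qed

lemma coset_eq_zero_iff:
  assumes "module R M" "submodule K R M" "x \<in> carrier M"
  shows "K +>\<^bsub>M\<^esub> x = K \<longleftrightarrow> x \<in> K"
proof -
  interpret M: module R M by fact
  interpret K: abelian_subgroup K M by (rule submodule_abelian_subgroup[OF assms(1,2)])
  have "K +>\<^bsub>M\<^esub> \<zero>\<^bsub>M\<^esub> = K" using K.a_subset by simp
  then show ?thesis using coset_eq_iff[OF assms M.zero_closed] assms(3)
    by (simp add: a_minus_def M.minus_equality[OF M.l_zero])
qed

lemma coset_add_eqI:
  assumes "module R M" "submodule K R M" "x \<ominus>\<^bsub>M\<^esub> (y \<oplus>\<^bsub>M\<^esub> z) \<in> K"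
    "x \<in> carrier M" "y \<in> carrier M" "z \<in> carrier M"
  shows "K +>\<^bsub>M\<^esub> x = (K +>\<^bsub>M\<^esub> y) \<oplus>\<^bsub>quotient_module R M K\<^esub> (K +>\<^bsub>M\<^esub> z)"
proof -
  interpret M: module R M by fact
  show ?thesis
    unfolding module_hom_add[OF coset_map_hom[OF assms(1,2)] assms(5,6), symmetric]
    using coset_eq_iff[OF assms(1,2,4) M.a_closed[OF assms(5,6)]] assms(3) by simp
qed

lemma coset_smult_eqI:
  assumes "module R M" "submodule K R M" "x \<ominus>\<^bsub>M\<^esub> a \<odot>\<^bsub>M\<^esub> y \<in> K"
    "x \<in> carrier M" "a \<in> carrier R" "y \<in> carrier M"
  shows "K +>\<^bsub>M\<^esub> x = a \<odot>\<^bsub>quotient_module R M K\<^esub> (K +>\<^bsub>M\<^esub> y)"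
proof -
  interpret M: module R M by fact
  show ?thesis
    unfolding module_hom_smult[OF coset_map_hom[OF assms(1,2)] assms(5,6), symmetric]
    using coset_eq_iff[OF assms(1,2,4) M.smult_closed[OF assms(5,6)]] assms(3) by simp
qed

text \<open>The hypothesis on the kernels makes \<open>q\<close> constant on the fibres of \<open>p\<close>.\<close>

lemma module_hom_factor:
  assumes "module R F" "module R M" "module R P"
    and p: "p \<in> module_hom R F M" "p ` carrier F = carrier M"
    and q: "q \<in> module_hom R F P"
    and ker: "\<And>f. f \<in> carrier F \<Longrightarrow> p f = \<zero>\<^bsub>M\<^esub> \<Longrightarrow> q f = \<zero>\<^bsub>P\<^esub>"
  obtains h where "h \<in> module_hom R M P" "\<And>f. f \<in> carrier F \<Longrightarrow> h (p f) = q f"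
proof -
  interpret F: module R F by fact
  interpret M: module R M by fact
  interpret P: module R P by fact
  define h where "h x = q (SOME f. f \<in> carrier F \<and> p f = x)" for x
  have h: "h (p f) = q f" if f: "f \<in> carrier F" for f
  proof -
    define g where "g = (SOME g. g \<in> carrier F \<and> p g = p f)"
    have g: "g \<in> carrier F" "p g = p f"
      using someI[of "\<lambda>g. g \<in> carrier F \<and> p g = p f" f] f by (auto simp: g_def)
    have "p (g \<ominus>\<^bsub>F\<^esub> f) = \<zero>\<^bsub>M\<^esub>"
      using f g module_hom_closed[OF p(1) f]
      by (simp add: module_hom_minus[OF assms(1,2) p(1)] M.minus_eq_zero_iff)
    then have "q g \<ominus>\<^bsub>P\<^esub> q f = \<zero>\<^bsub>P\<^esub>"
      using ker f g module_hom_minus[OF assms(1,3) q g(1) f] by simp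
    then have "q g = q f" using module_hom_closed[OF q] f g by (simp add: P.minus_eq_zero_iff)
    then show ?thesis by (simp add: h_def g_def)
  qed
  have "h \<in> module_hom R M P"
  proof -
    have "\<exists>f\<in>carrier F. x = p f" if "x \<in> carrier M" for x using that p(2) by blast
    note ex = this
    have "h (x \<oplus>\<^bsub>M\<^esub> y) = h x \<oplus>\<^bsub>P\<^esub> h y" if "x \<in> carrier M" "y \<in> carrier M" for x y
      using ex[OF that(1)] ex[OF that(2)]
      by (auto simp: module_hom_add[OF p(1), symmetric] h module_hom_add[OF q])
    moreover have "h (a \<odot>\<^bsub>M\<^esub> x) = a \<odot>\<^bsub>P\<^esub> h x" if "a \<in> carrier R" "x \<in> carrier M" for a x
      using ex[OF that(2)] that(1)
      by (auto simp: module_hom_smult[OF p(1), symmetric] h module_hom_smult[OF q])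
    moreover have "h x \<in> carrier P" if "x \<in> carrier M" for x
      using ex[OF that] by (auto simp: h module_hom_closed[OF q])
    ultimately show ?thesis by (auto simp: module_hom_iff)
  qed
  then show ?thesis using h that by blast
qed

text \<open>The universal property of a module given by generators and relations.\<close>

lemma quotient_of_free_universal:
  assumes "module R P" "\<phi> \<in> X \<rightarrow> carrier P" "rels \<subseteq> carrier (free_module R X)"
    and "\<And>f. f \<in> rels \<Longrightarrow> linear_extension R P \<phi> f = \<zero>\<^bsub>P\<^esub>"
  obtains h where
    "h \<in> module_hom R (quotient_module R (free_module R X) (submodule_span R (free_module R X) rels)) P"
    "\<And>f. f \<in> carrier (free_module R X) \<Longrightarrow>
      h (submodule_span R (free_module R X) rels +>\<^bsub>free_module R X\<^esub> f) = linear_extension R P \<phi> f"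
proof -
  interpret P: module R P by fact
  let ?F = "free_module R X"
  let ?K = "submodule_span R ?F rels"
  have F: "module R ?F" by (rule free_module_module) unfold_locales
  have K: "submodule ?K R ?F" by (rule submodule_span_submodule[OF F assms(3)])
  note L = linear_extension_hom[OF assms(1,2)]
  have "?K \<subseteq> {f \<in> carrier ?F. linear_extension R P \<phi> f \<in> {\<zero>\<^bsub>P\<^esub>}}"
    using assms(3,4)
    by (intro submodule_span_least submodule_vimage[OF F assms(1) L submodule_zero[OF assms(1)]]) auto
  then have "linear_extension R P \<phi> f = \<zero>\<^bsub>P\<^esub>"
    if "f \<in> carrier ?F" "?K +>\<^bsub>?F\<^esub> f = \<zero>\<^bsub>quotient_module R ?F ?K\<^esub>" for f
    using that coset_eq_zero_iff[OF F K, of f] by auto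
  then obtain h where "h \<in> module_hom R (quotient_module R ?F ?K) P"
      "\<And>f. f \<in> carrier ?F \<Longrightarrow> h (?K +>\<^bsub>?F\<^esub> f) = linear_extension R P \<phi> f"
    using module_hom_factor[OF F quotient_module_module[OF F K] assms(1) coset_map_hom[OF F K] _ L]
    by (metis quotient_module_carrier)
  then show ?thesis using that by blast
qed


section \<open>Alternating forms\<close>

text \<open>The arguments of a form are functions on all natural numbers, of which only the values below \<open>n\<close> are
  constrained. Permuting the arguments is then composition, and replacing one of them is function update.\<close>

definition multilinear ::
  "('a, 'r) ring_scheme \<Rightarrow> nat \<Rightarrow> ('a, 'm, 'x) module_scheme \<Rightarrow> ('a, 'p, 'y) module_scheme \<Rightarrow>
    ((nat \<Rightarrow> 'm) \<Rightarrow> 'p) \<Rightarrow> bool" where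
  "multilinear R n M P \<phi> \<longleftrightarrow> (\<forall>z. (\<forall>i<n. z i \<in> carrier M) \<longrightarrow>
    \<phi> z \<in> carrier P \<and> (\<forall>i<n. (\<lambda>x. \<phi> (z(i := x))) \<in> module_hom R M P))"

definition alternating ::
  "('a, 'r) ring_scheme \<Rightarrow> nat \<Rightarrow> ('a, 'm, 'x) module_scheme \<Rightarrow> ('a, 'p, 'y) module_scheme \<Rightarrow>
    ((nat \<Rightarrow> 'm) \<Rightarrow> 'p) \<Rightarrow> bool" where
  "alternating R n M P \<phi> \<longleftrightarrow> multilinear R n M P \<phi> \<and>
    (\<forall>z i j. (\<forall>l<n. z l \<in> carrier M) \<longrightarrow> i < n \<longrightarrow> j < n \<longrightarrow> i \<noteq> j \<longrightarrow> z i = z j \<longrightarrow> \<phi> z = \<zero>\<^bsub>P\<^esub>)"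

text \<open>Keeping the even and the odd permutations apart avoids signs as scalars.\<close>

definition antisymmetrization ::
  "nat \<Rightarrow> ('a, 'p, 'y) module_scheme \<Rightarrow> ((nat \<Rightarrow> 'm) \<Rightarrow> 'p) \<Rightarrow> (nat \<Rightarrow> 'm) \<Rightarrow> 'p" where
  "antisymmetrization n P \<phi> z =
    (\<Oplus>\<^bsub>P\<^esub>\<sigma> \<in> {\<sigma>. \<sigma> permutes {..<n} \<and> evenperm \<sigma>}. \<phi> (z \<circ> \<sigma>)) \<ominus>\<^bsub>P\<^esub>
    (\<Oplus>\<^bsub>P\<^esub>\<sigma> \<in> {\<sigma>. \<sigma> permutes {..<n} \<and> \<not> evenperm \<sigma>}. \<phi> (z \<circ> \<sigma>))"

lemma multilinear_closed:
  "multilinear R n M P \<phi> \<Longrightarrow> (\<And>i. i < n \<Longrightarrow> z i \<in> carrier M) \<Longrightarrow> \<phi> z \<in> carrier P"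
  by (simp add: multilinear_def)

lemma multilinear_hom:
  "multilinear R n M P \<phi> \<Longrightarrow> (\<And>i. i < n \<Longrightarrow> z i \<in> carrier M) \<Longrightarrow> i < n \<Longrightarrow>
    (\<lambda>x. \<phi> (z(i := x))) \<in> module_hom R M P"
  by (simp add: multilinear_def)

lemma finsum_hom:
  assumes "module R M" "module R N" "\<And>s. s \<in> A \<Longrightarrow> h s \<in> module_hom R M N"
  shows "(\<lambda>x. \<Oplus>\<^bsub>N\<^esub>s\<in>A. h s x) \<in> module_hom R M N"
proof -
  interpret M: module R M by fact
  interpret N: module R N by fact
  note cl = module_hom_closed[OF assms(3)]
  show ?thesis
  proof (cases "finite A")
    case True
    have "(\<Oplus>\<^bsub>N\<^esub>s\<in>A. h s (x \<oplus>\<^bsub>M\<^esub> y)) = (\<Oplus>\<^bsub>N\<^esub>s\<in>A. h s x) \<oplus>\<^bsub>N\<^esub> (\<Oplus>\<^bsub>N\<^esub>s\<in>A. h s y)"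
      if "x \<in> carrier M" "y \<in> carrier M" for x y
    proof -
      have "(\<Oplus>\<^bsub>N\<^esub>s\<in>A. h s (x \<oplus>\<^bsub>M\<^esub> y)) = (\<Oplus>\<^bsub>N\<^esub>s\<in>A. h s x \<oplus>\<^bsub>N\<^esub> h s y)"
        using that cl module_hom_add[OF assms(3)] by (intro N.finsum_cong') auto
      also have "\<dots> = (\<Oplus>\<^bsub>N\<^esub>s\<in>A. h s x) \<oplus>\<^bsub>N\<^esub> (\<Oplus>\<^bsub>N\<^esub>s\<in>A. h s y)"
        using that cl by (intro N.finsum_addf) auto
      finally show ?thesis .
    qed
    moreover have "(\<Oplus>\<^bsub>N\<^esub>s\<in>A. h s (a \<odot>\<^bsub>M\<^esub> x)) = a \<odot>\<^bsub>N\<^esub> (\<Oplus>\<^bsub>N\<^esub>s\<in>A. h s x)"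
      if "x \<in> carrier M" "a \<in> carrier R" for x a
      using that cl module_hom_smult[OF assms(3)]
      by (subst N.finsum_smult_ldistr[OF True]) (auto intro!: N.finsum_cong')
    ultimately show ?thesis using cl by (auto simp: module_hom_iff)
  qed (auto simp: module_hom_iff)
qed

lemma minus_hom:
  assumes "module R M" "module R N" "g \<in> module_hom R M N" "h \<in> module_hom R M N"
  shows "(\<lambda>x. g x \<ominus>\<^bsub>N\<^esub> h x) \<in> module_hom R M N"
proof -
  interpret M: module R M by fact
  interpret N: module R N by fact
  note cl = module_hom_closed[OF assms(3)] module_hom_closed[OF assms(4)]
  have "(g x \<oplus>\<^bsub>N\<^esub> g y) \<ominus>\<^bsub>N\<^esub> (h x \<oplus>\<^bsub>N\<^esub> h y) = (g x \<ominus>\<^bsub>N\<^esub> h x) \<oplus>\<^bsub>N\<^esub> (g y \<ominus>\<^bsub>N\<^esub> h y)"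
    if "x \<in> carrier M" "y \<in> carrier M" for x y
    using that cl by (simp add: a_minus_def N.minus_add N.a_ac)
  then show ?thesis
    using cl by (auto simp: module_hom_iff module_hom_add[OF assms(3)] module_hom_add[OF assms(4)]
        module_hom_smult[OF assms(3)] module_hom_smult[OF assms(4)] a_minus_def
        N.smult_r_distr N.smult_r_minus)
qed

lemma fun_upd_comp_permutes:
  assumes "\<sigma> permutes A"
  shows "z(i := x) \<circ> \<sigma> = (z \<circ> \<sigma>)(inv_into UNIV \<sigma> i := x)"
  using permutes_inverses[OF assms] by (auto simp: fun_eq_iff)

lemma permutes_lessThan: "\<sigma> permutes {..<n} \<Longrightarrow> i < n \<Longrightarrow> \<sigma> i < n"
  using permutes_in_image by fastforce

lemma permutes_moves: "\<sigma> permutes {..<n::nat} \<Longrightarrow> \<sigma> \<noteq> id \<Longrightarrow> \<exists>i<n. \<sigma> i \<noteq> i"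
  by (metis eq_id_iff lessThan_iff permutes_not_in)

text \<open>If \<open>z i = z j\<close>, then composing with the transposition of \<open>i\<close> and \<open>j\<close> matches the even
  permutations with the odd ones without changing the terms.\<close>

lemma antisymmetrization_alternating:
  assumes "module R M" "module R P" "multilinear R n M P \<phi>"
  shows "alternating R n M P (antisymmetrization n P \<phi>)"
proof -
  interpret M: module R M by fact
  interpret P: module R P by fact
  let ?E = "{\<sigma>. \<sigma> permutes {..<n} \<and> evenperm \<sigma>}"
  let ?O = "{\<sigma>. \<sigma> permutes {..<n} \<and> \<not> evenperm \<sigma>}"
  have cl: "\<phi> (z \<circ> \<sigma>) \<in> carrier P" if "\<forall>i<n. z i \<in> carrier M" "\<sigma> permutes {..<n}" for z \<sigma>
    using that permutes_lessThan by (intro multilinear_closed[OF assms(3)]) auto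
  have "antisymmetrization n P \<phi> z \<in> carrier P" if "\<forall>i<n. z i \<in> carrier M" for z
    unfolding antisymmetrization_def using cl[OF that]
    by (intro P.minus_closed P.finsum_closed) auto
  moreover have "(\<lambda>x. antisymmetrization n P \<phi> (z(i := x))) \<in> module_hom R M P"
    if z: "\<forall>i<n. z i \<in> carrier M" and i: "i < n" for z i
  proof -
    have "(\<lambda>x. \<phi> (z(i := x) \<circ> \<sigma>)) \<in> module_hom R M P" if "\<sigma> permutes {..<n}" for \<sigma>
      unfolding fun_upd_comp_permutes[OF that]
      using z i that permutes_lessThan[OF that] permutes_lessThan[OF permutes_inv[OF that]]
      by (intro multilinear_hom[OF assms(3)]) auto
    then show ?thesis unfolding antisymmetrization_def
      by (intro minus_hom[OF assms(1,2)] finsum_hom[OF assms(1,2)]) auto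
  qed
  moreover have "antisymmetrization n P \<phi> z = \<zero>\<^bsub>P\<^esub>"
    if z: "\<forall>l<n. z l \<in> carrier M" and ij: "i < n" "j < n" "i \<noteq> j" "z i = z j" for z i j
  proof -
    let ?\<tau> = "transpose i j"
    have \<tau>: "?\<tau> permutes {..<n}" using ij by (intro permutes_swap_id) auto
    have z\<tau>: "z \<circ> (?\<tau> \<circ> \<sigma>) = z \<circ> \<sigma>" for \<sigma>
      using ij(4) by (auto simp: fun_eq_iff transpose_def)
    have perm: "permutation \<sigma>" if "\<sigma> permutes {..<n}" for \<sigma>
      using that permutation_permutes by blast
    have par: "evenperm (?\<tau> \<circ> \<sigma>) \<longleftrightarrow> \<not> evenperm \<sigma>" if "\<sigma> permutes {..<n}" for \<sigma>
      using that ij(3) evenperm_comp[OF permutation_swap_id perm[OF that]] by (simp add: evenperm_swap)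
    have "?O = (\<lambda>\<sigma>. ?\<tau> \<circ> \<sigma>) ` ?E"
    proof (intro equalityI subsetI)
      fix \<sigma> assume \<sigma>: "\<sigma> \<in> ?O"
      then have "?\<tau> \<circ> \<sigma> \<in> ?E" using par permutes_compose[OF _ \<tau>] by auto
      moreover have "\<sigma> = ?\<tau> \<circ> (?\<tau> \<circ> \<sigma>)" by (simp add: comp_assoc[symmetric])
      ultimately show "\<sigma> \<in> (\<lambda>\<sigma>. ?\<tau> \<circ> \<sigma>) ` ?E" by blast
    qed (use par permutes_compose[OF _ \<tau>] in auto)
    moreover have "inj_on (\<lambda>\<sigma>. ?\<tau> \<circ> \<sigma>) ?E"
      by (rule inj_on_inverseI[where g = "\<lambda>\<sigma>. ?\<tau> \<circ> \<sigma>"]) (simp add: comp_assoc[symmetric])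
    moreover have "(\<lambda>\<sigma>. \<phi> (z \<circ> \<sigma>)) \<in> ?O \<rightarrow> carrier P" using cl[OF z] by auto
    ultimately have "(\<Oplus>\<^bsub>P\<^esub>\<sigma>\<in>?O. \<phi> (z \<circ> \<sigma>)) = (\<Oplus>\<^bsub>P\<^esub>\<sigma>\<in>?E. \<phi> (z \<circ> \<sigma>))"
      using P.finsum_reindex[of "\<lambda>\<sigma>. \<phi> (z \<circ> \<sigma>)" "\<lambda>\<sigma>. ?\<tau> \<circ> \<sigma>" ?E] by (simp add: z\<tau>)
    moreover have "(\<Oplus>\<^bsub>P\<^esub>\<sigma>\<in>?E. \<phi> (z \<circ> \<sigma>)) \<in> carrier P" using cl[OF z] by (intro P.finsum_closed) auto
    ultimately show ?thesis by (simp add: antisymmetrization_def P.minus_eq_zero_iff)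
  qed
  ultimately show ?thesis by (simp add: alternating_def multilinear_def)
qed

text \<open>This evaluates an antisymmetrization in the way in which a triangular determinant is evaluated: only
  the identity permutation contributes.\<close>

lemma antisymmetrization_eq:
  assumes "module R P" "\<phi> z \<in> carrier P"
    and "\<And>\<sigma>. \<sigma> permutes {..<n} \<Longrightarrow> \<sigma> \<noteq> id \<Longrightarrow> \<phi> (z \<circ> \<sigma>) = \<zero>\<^bsub>P\<^esub>"
  shows "antisymmetrization n P \<phi> z = \<phi> z"
proof -
  interpret P: module R P by fact
  let ?E = "{\<sigma>. \<sigma> permutes {..<n} \<and> evenperm \<sigma>}"
  have cl: "\<phi> (z \<circ> \<sigma>) \<in> carrier P" if "\<sigma> permutes {..<n}" for \<sigma>
    using assms(2) assms(3)[OF that] by (cases "\<sigma> = id") auto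
  have "(\<Oplus>\<^bsub>P\<^esub>\<sigma>\<in>{id}. \<phi> (z \<circ> \<sigma>)) = (\<Oplus>\<^bsub>P\<^esub>\<sigma>\<in>?E. \<phi> (z \<circ> \<sigma>))"
    using cl assms(3) finite_permutations[of "{..<n}"]
    by (intro P.add.finprod_mono_neutral_cong_left)
      (auto simp: evenperm_id permutes_id intro: finite_subset[rotated])
  moreover have "(\<Oplus>\<^bsub>P\<^esub>\<sigma>\<in>{id}. \<phi> (z \<circ> \<sigma>)) = \<phi> z"
    using assms(2) by (subst P.finsum_insert) auto
  moreover have "(\<Oplus>\<^bsub>P\<^esub>\<sigma>\<in>{\<sigma>. \<sigma> permutes {..<n} \<and> \<not> evenperm \<sigma>}. \<phi> (z \<circ> \<sigma>)) = \<zero>\<^bsub>P\<^esub>"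
    using assms(3) by (intro P.add.finprod_one_eqI) (metis (mono_tags, lifting) evenperm_id mem_Collect_eq)
  ultimately show ?thesis
    using assms(2) by (simp add: antisymmetrization_def a_minus_def P.minus_equality[OF P.l_zero])
qed

lemma antisymmetrization_hom:
  assumes "module R M" "module R P" "module R Q" "multilinear R n M P \<phi>" "h \<in> module_hom R P Q"
    and "\<And>i. i < n \<Longrightarrow> z i \<in> carrier M"
  shows "h (antisymmetrization n P \<phi> z) = antisymmetrization n Q (\<lambda>z. h (\<phi> z)) z"
proof -
  interpret P: module R P by fact
  have cl: "\<phi> (z \<circ> \<sigma>) \<in> carrier P" if "\<sigma> permutes {..<n}" for \<sigma>
    using that permutes_lessThan assms(6) by (intro multilinear_closed[OF assms(4)]) auto
  show ?thesis unfolding antisymmetrization_def using cl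
    by (subst module_hom_minus[OF assms(2,3,5)])
      (auto intro!: P.finsum_closed simp: module_hom_finsum[OF assms(2,3,5)] Pi_iff)
qed

text \<open>In \<open>0 = \<phi> (\<dots>, \<Sum> d\<^sub>i z\<^sub>i, \<dots>)\<close>, with the sum at position \<open>l\<close>, only the term with \<open>i = l\<close> has no
  repeated argument.\<close>

lemma alternating_relation:
  assumes "module R M" "module R P" "alternating R n M P \<phi>"
    and z: "\<And>i. i < n \<Longrightarrow> z i \<in> carrier M" and d: "\<And>i. i < n \<Longrightarrow> d i \<in> carrier R"
    and rel: "(\<Oplus>\<^bsub>M\<^esub>i\<in>{..<n}. d i \<odot>\<^bsub>M\<^esub> z i) = \<zero>\<^bsub>M\<^esub>" and l: "l < n"
  shows "d l \<odot>\<^bsub>P\<^esub> \<phi> z = \<zero>\<^bsub>P\<^esub>"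
proof -
  interpret M: module R M by fact
  interpret P: module R P by fact
  have mult: "multilinear R n M P \<phi>" using assms(3) by (simp add: alternating_def)
  let ?h = "\<lambda>x. \<phi> (z(l := x))"
  have h: "?h \<in> module_hom R M P" by (rule multilinear_hom[OF mult z l])
  have "?h (z i) = \<zero>\<^bsub>P\<^esub>" if "i < n" "i \<noteq> l" for i
  proof -
    have "\<forall>j<n. (z(l := z i)) j \<in> carrier M" using z that(1) by auto
    then show ?thesis using assms(3) that l unfolding alternating_def by (metis fun_upd_apply)
  qed
  then have "(\<Oplus>\<^bsub>P\<^esub>i\<in>{l}. d i \<odot>\<^bsub>P\<^esub> ?h (z i)) = (\<Oplus>\<^bsub>P\<^esub>i\<in>{..<n}. d i \<odot>\<^bsub>P\<^esub> ?h (z i))"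
    using l z d module_hom_closed[OF h]
    by (intro P.add.finprod_mono_neutral_cong_left) auto
  also have "\<dots> = ?h (\<Oplus>\<^bsub>M\<^esub>i\<in>{..<n}. d i \<odot>\<^bsub>M\<^esub> z i)"
    using z d module_hom_closed[OF h]
    by (subst module_hom_finsum[OF assms(1,2) h]) (auto intro!: P.finsum_cong' simp: module_hom_smult[OF h])
  also have "\<dots> = \<zero>\<^bsub>P\<^esub>" unfolding rel by (rule module_hom_zero[OF assms(1,2) h])
  finally show ?thesis
    using module_hom_closed[OF h z[OF l]] d[OF l] by (simp add: fun_upd_idem)
qed

text \<open>The arguments are moved from \<open>A\<close> to its span one position after the other.\<close>

lemma multilinear_span:
  assumes "module R M" "module R P" "multilinear R n M P \<phi>" "submodule H R P" "A \<subseteq> carrier M"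
    and A: "\<And>z. (\<And>i. i < n \<Longrightarrow> z i \<in> A) \<Longrightarrow> \<phi> z \<in> H"
    and z: "\<And>i. i < n \<Longrightarrow> z i \<in> submodule_span R M A"
  shows "\<phi> z \<in> H"
proof -
  have span: "submodule (submodule_span R M A) R M"
    by (rule submodule_span_submodule[OF assms(1,5)])
  have "\<phi> z \<in> H" if "j \<le> n" "\<And>i. i < n \<Longrightarrow> z i \<in> submodule_span R M A"
    "\<And>i. j \<le> i \<Longrightarrow> i < n \<Longrightarrow> z i \<in> A" for j z
    using that
  proof (induction j arbitrary: z)
    case 0
    then show ?case using A by simp
  next
    case (Suc j)
    have zM: "z i \<in> carrier M" if "i < n" for i
      using Suc.prems(2)[OF that] submodule_subset[OF span] by blast
    have h: "(\<lambda>x. \<phi> (z(j := x))) \<in> module_hom R M P"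
      using Suc.prems(1) by (intro multilinear_hom[OF assms(3)] zM) auto
    have "submodule_span R M A \<subseteq> {x \<in> carrier M. \<phi> (z(j := x)) \<in> H}"
    proof (rule submodule_span_least[OF submodule_vimage[OF assms(1,2) h assms(4)]])
      have "\<phi> (z(j := x)) \<in> H" if "x \<in> A" for x
        using Suc.prems that submodule_span_superset[of A R M] by (intro Suc.IH) auto
      then show "A \<subseteq> {x \<in> carrier M. \<phi> (z(j := x)) \<in> H}" using assms(5) by auto
    qed
    then have "\<phi> (z(j := z j)) \<in> H" using Suc.prems(1) Suc.prems(2)[of j] by auto
    then show ?case by simp
  qed
  from this[of n] show ?thesis using z by simp
qed

lemma multilinear_scale:
  assumes "module R M" "module R P" "multilinear R n M P \<phi>" "c \<in> carrier R"
    and z: "\<And>i. i < n \<Longrightarrow> z i \<in> carrier M"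
  shows "\<phi> (\<lambda>i. if i < n then c \<odot>\<^bsub>M\<^esub> z i else z i) = (c [^]\<^bsub>R\<^esub> n) \<odot>\<^bsub>P\<^esub> \<phi> z"
proof -
  interpret M: module R M by fact
  interpret P: module R P by fact
  have "\<phi> (\<lambda>i. if i < j then c \<odot>\<^bsub>M\<^esub> z i else z i) = (c [^]\<^bsub>R\<^esub> j) \<odot>\<^bsub>P\<^esub> \<phi> z" if "j \<le> n" for j
    using that
  proof (induction j)
    case 0
    then show ?case using multilinear_closed[OF assms(3) z] by simp
  next
    case (Suc j)
    let ?z = "\<lambda>i. if i < j then c \<odot>\<^bsub>M\<^esub> z i else z i"
    have h: "(\<lambda>x. \<phi> (?z(j := x))) \<in> module_hom R M P"
      using Suc.prems z assms(4) by (intro multilinear_hom[OF assms(3)]) auto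
    have "(\<lambda>i. if i < Suc j then c \<odot>\<^bsub>M\<^esub> z i else z i) = ?z(j := c \<odot>\<^bsub>M\<^esub> z j)" by auto
    moreover have "?z(j := z j) = ?z" by auto
    ultimately have "\<phi> (\<lambda>i. if i < Suc j then c \<odot>\<^bsub>M\<^esub> z i else z i) = c \<odot>\<^bsub>P\<^esub> \<phi> ?z"
      using module_hom_smult[OF h assms(4) z[of j]] Suc.prems by simp
    then show ?case
      using Suc assms(4) multilinear_closed[OF assms(3) z]
      by (simp add: P.smult_assoc1[symmetric] M.m_comm)
  qed
  then show ?thesis by simp
qed

text \<open>If the arguments come from fewer than \<open>n\<close> elements, two of them are equal.\<close>

lemma alternating_vanishes_on_small_span:
  assumes "module R M" "module R P" "alternating R n M P \<phi>" "A \<subseteq> carrier M" "finite A" "card A < n"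
    and z: "\<And>i. i < n \<Longrightarrow> z i \<in> submodule_span R M A"
  shows "\<phi> z = \<zero>\<^bsub>P\<^esub>"
proof -
  have mult: "multilinear R n M P \<phi>" using assms(3) by (simp add: alternating_def)
  have "\<phi> w \<in> {\<zero>\<^bsub>P\<^esub>}" if w: "\<And>i. i < n \<Longrightarrow> w i \<in> A" for w
  proof -
    have "\<not> inj_on w {..<n}"
      using card_inj_on_le[of w "{..<n}" A] w assms(5,6) by auto
    then obtain i j where "i < n" "j < n" "i \<noteq> j" "w i = w j" by (auto simp: inj_on_def)
    moreover have "\<forall>l<n. w l \<in> carrier M" using w assms(4) by auto
    ultimately show ?thesis using assms(3) by (simp add: alternating_def)
  qed
  then have "\<phi> z \<in> {\<zero>\<^bsub>P\<^esub>}"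
    by (rule multilinear_span[OF assms(1,2) mult submodule_zero[OF assms(2)] assms(4) _ z])
  then show ?thesis by simp
qed

text \<open>If the arguments are taken from the \<open>a\<^sub>i\<close>, then either two of them are equal or every \<open>a\<^sub>i\<close> occurs and
  the relation applies; multilinearity extends this to the span. For the determinant this generalizes
  the rule that the entries of a kernel vector annihilate the determinant of a square matrix.\<close>

lemma alternating_annihilated_on_span:
  assumes "module R M" "module R P" "alternating R n M P \<phi>"
    and a: "\<And>i. i < n \<Longrightarrow> a i \<in> carrier M" and d: "\<And>i. i < n \<Longrightarrow> d i \<in> carrier R"
    and rel: "(\<Oplus>\<^bsub>M\<^esub>i\<in>{..<n}. d i \<odot>\<^bsub>M\<^esub> a i) = \<zero>\<^bsub>M\<^esub>" and l: "l < n"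
    and z: "\<And>i. i < n \<Longrightarrow> z i \<in> submodule_span R M (a ` {..<n})"
  shows "d l \<odot>\<^bsub>P\<^esub> \<phi> z = \<zero>\<^bsub>P\<^esub>"
proof -
  interpret M: module R M by fact
  interpret P: module R P by fact
  let ?H = "{x \<in> carrier P. d l \<odot>\<^bsub>P\<^esub> x = \<zero>\<^bsub>P\<^esub>}"
  have mult: "multilinear R n M P \<phi>" using assms(3) by (simp add: alternating_def)
  have "\<phi> w \<in> ?H" if w: "\<And>i. i < n \<Longrightarrow> w i \<in> a ` {..<n}" for w
  proof -
    have wM: "w i \<in> carrier M" if "i < n" for i using w[OF that] a by auto
    have cl: "\<phi> w \<in> carrier P" by (rule multilinear_closed[OF mult wM])
    show ?thesis
    proof (cases "inj_on w {..<n}")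
      case False
      then obtain i j where "i < n" "j < n" "i \<noteq> j" "w i = w j" by (auto simp: inj_on_def)
      then have "\<phi> w = \<zero>\<^bsub>P\<^esub>" using assms(3) wM by (simp add: alternating_def)
      then show ?thesis using d[OF l] by simp
    next
      \<comment> \<open>Now \<open>w\<close> lists every \<open>a\<^sub>i\<close> exactly once, and the relation can be reordered along \<open>w\<close>.\<close>
      case True
      have sub: "w ` {..<n} \<subseteq> a ` {..<n}" using w by auto
      have "card (w ` {..<n}) = n" using True by (simp add: card_image)
      moreover have "card (a ` {..<n}) \<le> n" using card_image_le[of "{..<n}" a] by simp
      ultimately have eq: "w ` {..<n} = a ` {..<n}" using sub card_seteq[OF _ sub] by simp
      then have inj_a: "inj_on a {..<n}"
        using \<open>card (w ` {..<n}) = n\<close> by (intro eq_card_imp_inj_on) auto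
      define \<pi> where "\<pi> i = inv_into {..<n} a (w i)" for i
      have \<pi>: "\<pi> i < n" "a (\<pi> i) = w i" if "i < n" for i
        using inv_into_into[OF w[OF that]] f_inv_into_f[OF w[OF that]] by (simp_all add: \<pi>_def)
      have inj: "inj_on \<pi> {..<n}"
        using \<pi>(2) inj_onD[OF True] by (intro inj_onI) (metis lessThan_iff)
      have im: "\<pi> ` {..<n} = {..<n}"
        using \<pi>(1) inj by (intro endo_inj_surj) auto
      have "(\<Oplus>\<^bsub>M\<^esub>i\<in>\<pi> ` {..<n}. d i \<odot>\<^bsub>M\<^esub> a i) = (\<Oplus>\<^bsub>M\<^esub>i\<in>{..<n}. d (\<pi> i) \<odot>\<^bsub>M\<^esub> a (\<pi> i))"
        using im a d inj by (intro M.finsum_reindex) auto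
      also have "\<dots> = (\<Oplus>\<^bsub>M\<^esub>i\<in>{..<n}. d (\<pi> i) \<odot>\<^bsub>M\<^esub> w i)"
        using \<pi> wM d by (intro M.finsum_cong') auto
      finally have "(\<Oplus>\<^bsub>M\<^esub>i\<in>{..<n}. d (\<pi> i) \<odot>\<^bsub>M\<^esub> w i) = \<zero>\<^bsub>M\<^esub>" using rel im by simp
      moreover obtain p where "p < n" "\<pi> p = l" using im l by (metis imageE lessThan_iff)
      ultimately have "d l \<odot>\<^bsub>P\<^esub> \<phi> w = \<zero>\<^bsub>P\<^esub>"
        using alternating_relation[OF assms(1-3) wM, of "\<lambda>i. i" "\<lambda>i. d (\<pi> i)" p] d \<pi>(1) by simp
      then show ?thesis using cl by simp
    qed
  qed
  then have "\<phi> z \<in> ?H"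
    using a by (intro multilinear_span[OF assms(1,2) mult submodule_annihilated[OF assms(2) d[OF l]] _ _ z])
      blast+
  then show ?thesis by simp
qed


subsection \<open>Products of linear forms with values in an algebra\<close>

text \<open>An algebra as a module over its base ring. The instances are \<open>R\<close> itself, its total quotient ring
  and its residue field.\<close>

definition algebra_module ::
  "('q, 's) ring_scheme \<Rightarrow> ('a \<Rightarrow> 'q) \<Rightarrow> ('a, 'q) module" where
  "algebra_module Q h = \<lparr> carrier = carrier Q, mult = mult Q, one = one Q, zero = zero Q, add = add Q,
    smult = (\<lambda>a q. h a \<otimes>\<^bsub>Q\<^esub> q) \<rparr>"

lemma algebra_module_simps [simp]:
  "carrier (algebra_module Q h) = carrier Q"
  "\<zero>\<^bsub>algebra_module Q h\<^esub> = \<zero>\<^bsub>Q\<^esub>"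
  "x \<oplus>\<^bsub>algebra_module Q h\<^esub> y = x \<oplus>\<^bsub>Q\<^esub> y"
  "a \<odot>\<^bsub>algebra_module Q h\<^esub> x = h a \<otimes>\<^bsub>Q\<^esub> x"
  by (simp_all add: algebra_module_def)

lemma algebra_module_module:
  assumes "cring R" "cring Q" "h \<in> ring_hom R Q"
  shows "module R (algebra_module Q h)"
proof -
  interpret Q: cring Q by fact
  have "abelian_group (algebra_module Q h)"
  proof (rule abelian_groupI)
    show "\<exists>y\<in>carrier (algebra_module Q h). y \<oplus>\<^bsub>algebra_module Q h\<^esub> x = \<zero>\<^bsub>algebra_module Q h\<^esub>"
      if "x \<in> carrier (algebra_module Q h)" for x
      using that Q.l_neg by auto
  qed (auto simp: Q.a_ac)
  then show ?thesis
    using ring_hom_closed[OF assms(3)]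
    by (intro moduleI) (auto simp: assms(1) ring_hom_add[OF assms(3)] ring_hom_mult[OF assms(3)]
        ring_hom_one[OF assms(3)] Q.l_distr Q.r_distr Q.m_assoc)
qed

lemma (in comm_monoid) finprod_extract:
  assumes "finite A" "i \<in> A" "f \<in> A \<rightarrow> carrier G"
  shows "finprod G f A = f i \<otimes> finprod G f (A - {i})"
  using finprod_insert[of "A - {i}" i f] assms by (simp add: insert_absorb Pi_iff)

lemma (in cring) finprod_zero_factor:
  assumes "finite A" "i \<in> A" "f \<in> A \<rightarrow> carrier R" "f i = \<zero>"
  shows "(\<Otimes>i\<in>A. f i) = \<zero>"
proof -
  have "(\<Otimes>j\<in>A - {i}. f j) \<in> carrier R" using assms(3) by (intro finprod_closed) auto
  then show ?thesis using finprod_extract[OF assms(1-3)] assms(4) by simp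
qed

lemma multilinear_product:
  assumes "module R M" "cring Q" "h \<in> ring_hom R Q"
    and c: "\<And>i. i < n \<Longrightarrow> c i \<in> module_hom R M (algebra_module Q h)"
  shows "multilinear R n M (algebra_module Q h) (\<lambda>z. \<Otimes>\<^bsub>Q\<^esub>i\<in>{..<n}. c i (z i))"
proof -
  interpret M: module R M by fact
  interpret Q: cring Q by fact
  have cl: "c i x \<in> carrier Q" if "i < n" "x \<in> carrier M" for i x
    using module_hom_closed[OF c[OF that(1)] that(2)] by simp
  have "(\<lambda>x. \<Otimes>\<^bsub>Q\<^esub>j\<in>{..<n}. c j ((z(i := x)) j)) \<in> module_hom R M (algebra_module Q h)"
    if z: "\<forall>j<n. z j \<in> carrier M" and i: "i < n" for z i
  proof -
    let ?r = "\<Otimes>\<^bsub>Q\<^esub>j\<in>{..<n} - {i}. c j (z j)"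
    have r: "?r \<in> carrier Q" using z cl by (intro Q.finprod_closed) auto
    have eq: "(\<Otimes>\<^bsub>Q\<^esub>j\<in>{..<n}. c j ((z(i := x)) j)) = c i x \<otimes>\<^bsub>Q\<^esub> ?r" if "x \<in> carrier M" for x
    proof -
      have "(\<Otimes>\<^bsub>Q\<^esub>j\<in>{..<n}. c j ((z(i := x)) j)) =
          c i ((z(i := x)) i) \<otimes>\<^bsub>Q\<^esub> (\<Otimes>\<^bsub>Q\<^esub>j\<in>{..<n} - {i}. c j ((z(i := x)) j))"
        using z i that cl by (intro Q.finprod_extract) auto
      also have "(\<Otimes>\<^bsub>Q\<^esub>j\<in>{..<n} - {i}. c j ((z(i := x)) j)) = ?r"
        using z cl by (intro Q.finprod_cong') auto
      finally show ?thesis by simp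
    qed
    note hom = module_hom_closed[OF c[OF i]] module_hom_add[OF c[OF i]] module_hom_smult[OF c[OF i]]
    show ?thesis
      using r hom ring_hom_closed[OF assms(3)] by (auto simp: module_hom_iff eq Q.l_distr Q.m_assoc simp del: fun_upd_apply)
  qed
  then show ?thesis using cl
    by (auto simp: multilinear_def intro!: Q.finprod_closed)
qed


section \<open>Generators and relations over Noetherian and local rings\<close>

lemma min_num_generators_le:
  "finite A \<Longrightarrow> generating_set R M A \<Longrightarrow> min_num_generators R M \<le> card A"
  unfolding min_num_generators_def by (rule Least_le) blast

lemma obtain_minimal_generators:
  assumes "finitely_generated R M"
  obtains x :: "nat \<Rightarrow> 'm" where "generating_set R (M :: ('a, 'm, 'x) module_scheme) (x ` {..<min_num_generators R M})"
proof -
  have "\<exists>k A. finite A \<and> card A = k \<and> generating_set R M A"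
    using assms by (auto simp: finitely_generated_def)
  from LeastI_ex[OF this] obtain A where
    A: "finite A" "card A = min_num_generators R M" "generating_set R M A"
    unfolding min_num_generators_def by blast
  then obtain x where "bij_betw x {..<min_num_generators R M} A"
    using ex_bij_betw_nat_finite[OF A(1)] by (auto simp: atLeast0LessThan)
  then show ?thesis using A(3) that by (metis bij_betw_imp_surj_on)
qed

lemma generating_set_subset: "generating_set R M A \<Longrightarrow> A \<subseteq> carrier M"
  by (simp add: generating_set_def)

lemma finsum_algebra_module [simp]: "finsum (algebra_module Q h) = finsum Q"
  by (simp add: finsum_def finprod_def algebra_module_def fun_eq_iff)

lemma coordinate_hom:
  assumes "cring R"
  shows "(\<lambda>f. f i) \<in> module_hom R (free_module R X) (algebra_module R (\<lambda>a. a))"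
  using free_module_closed[OF assms] by (auto simp: module_hom_iff)

lemma self_module:
  assumes "cring R" shows "module R (algebra_module R (\<lambda>a. a))"
  by (rule algebra_module_module[OF assms assms]) (auto simp: ring_hom_def)

lemma submodule_imp_ideal:
  assumes "cring R" "submodule J R (algebra_module R (\<lambda>a. a))"
  shows "ideal J R"
proof -
  interpret cring R by fact
  have sub: "J \<subseteq> carrier R" using submodule_subset[OF assms(2)] by auto
  have cl: "x \<otimes>\<^bsub>R\<^esub> a \<in> J" if "x \<in> carrier R" "a \<in> J" for x a
    using submodule_smult_closed[OF assms(2) that] by simp
  have "subgroup J (add_monoid R)"
  proof (rule add.subgroupI)
    show "J \<noteq> {}" using submodule_zero_closed[OF assms(2)] by auto
    show "\<ominus>\<^bsub>R\<^esub> a \<in> J" if "a \<in> J" for a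
      using cl[OF _ that, of "\<ominus>\<^bsub>R\<^esub> \<one>\<^bsub>R\<^esub>"] that sub by (auto simp: l_minus)
    show "a \<oplus>\<^bsub>R\<^esub> b \<in> J" if "a \<in> J" "b \<in> J" for a b
      using submodule_add_closed[OF assms(2) that] by simp
  qed (rule sub)
  moreover have "a \<otimes>\<^bsub>R\<^esub> x \<in> J" if "x \<in> carrier R" "a \<in> J" for x a
    using cl[OF that] m_comm[OF that(1), of a] that(2) sub by auto
  ultimately show ?thesis using cl by (intro idealI) (auto simp: ring_axioms)
qed

lemma coordinate_ideal:
  assumes "cring R" "submodule H R (free_module R X)"
  shows "ideal ((\<lambda>f. f i) ` H) R"
  by (rule submodule_imp_ideal[OF assms(1) submodule_image[OF free_module_module[OF assms(1)]
        self_module[OF assms(1)] coordinate_hom[OF assms(1)] assms(2)]])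

text \<open>The induction splits off the last coordinate: the last coordinates of \<open>H\<close> form a finitely
  generated ideal, and the elements of \<open>H\<close> with last coordinate \<open>0\<close> are covered by the induction
  hypothesis.\<close>

lemma noetherian_free_module:
  assumes "noetherian_ring R" "cring R" "submodule H R (free_module R {..<k})"
  shows "\<exists>A. finite A \<and> A \<subseteq> H \<and> H \<subseteq> submodule_span R (free_module R {..<k::nat}) A"
  using assms(3)
proof (induction k arbitrary: H)
  case 0
  have "H \<subseteq> submodule_span R (free_module R {..<0}) {}"
  proof
    fix f assume "f \<in> H"
    then have "f = \<zero>\<^bsub>free_module R {..<0::nat}\<^esub>"
      using submodule_subset[OF 0] by (auto simp: free_module_carrier)
    then show "f \<in> submodule_span R (free_module R {..<0}) {}"
      using submodule_zero_closed by (auto simp: submodule_span_def simp del: free_module_simps)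
  qed
  then show ?case by blast
next
  case (Suc k)
  interpret cring R by fact
  let ?F = "free_module R {..<Suc k}" and ?F' = "free_module R {..<k}"
  note F = free_module_module[OF assms(2), of "{..<Suc k}"]
  interpret F: module R ?F by (rule F)
  interpret F': module R ?F' by (rule free_module_module[OF assms(2)])
  note HF = submodule_subset[OF Suc.prems]
  have restr: "f \<in> carrier ?F' \<longleftrightarrow> f k = \<zero>\<^bsub>R\<^esub>" if "f \<in> carrier ?F" for f
    using that by (auto simp: free_module_carrier_finite less_Suc_eq)
  have incl: "f \<in> carrier ?F" if "f \<in> carrier ?F'" for f
    using that by (auto simp: free_module_carrier_finite less_Suc_eq)
  obtain C where C: "C \<subseteq> carrier R" "finite C" "(\<lambda>f. f k) ` H = Idl\<^bsub>R\<^esub> C"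
    using noetherian_ring.finetely_gen[OF assms(1) coordinate_ideal[OF assms(2) Suc.prems, of k]] by auto
  have "\<exists>f\<in>H. f k = c" if "c \<in> C" for c
  proof -
    have "c \<in> (\<lambda>f. f k) ` H" unfolding C(3) using genideal_self[OF C(1)] that by blast
    then show ?thesis by auto
  qed
  then obtain g where g: "g c \<in> H" "g c k = c" if "c \<in> C" for c by metis
  let ?H' = "{f \<in> H. f k = \<zero>\<^bsub>R\<^esub>}"
  have "submodule ?H' R ?F'"
  proof (rule F'.submodule_intro)
    show "a \<odot>\<^bsub>?F'\<^esub> f \<in> ?H'" if "a \<in> carrier R" "f \<in> ?H'" for a f
      using that submodule_smult_closed[OF Suc.prems that(1), of f] by auto
    show "f \<oplus>\<^bsub>?F'\<^esub> h \<in> ?H'" if "f \<in> ?H'" "h \<in> ?H'" for f h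
      using that submodule_add_closed[OF Suc.prems, of f h] by auto
  qed (use HF restr submodule_zero_closed[OF Suc.prems] in auto)
  from Suc.IH[OF this] obtain A where
    A: "finite A" "A \<subseteq> ?H'" "?H' \<subseteq> submodule_span R ?F' A" by blast
  let ?B = "A \<union> g ` C"
  let ?G = "submodule_span R ?F ?B"
  have BH: "?B \<subseteq> H" using A g by auto
  then have BF: "?B \<subseteq> carrier ?F" using HF by auto
  have G: "submodule ?G R ?F" by (rule submodule_span_submodule[OF F BF])
  have GH: "?G \<subseteq> H" by (rule submodule_span_least[OF Suc.prems BH])
  have "submodule (?G \<inter> carrier ?F') R ?F'"
  proof (rule F'.submodule_intro)
    show "a \<odot>\<^bsub>?F'\<^esub> f \<in> ?G \<inter> carrier ?F'" if "a \<in> carrier R" "f \<in> ?G \<inter> carrier ?F'" for a f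
      using that submodule_smult_closed[OF G that(1), of f] F'.smult_closed[OF that(1), of f] by auto
    show "f \<oplus>\<^bsub>?F'\<^esub> h \<in> ?G \<inter> carrier ?F'" if "f \<in> ?G \<inter> carrier ?F'" "h \<in> ?G \<inter> carrier ?F'" for f h
      using that submodule_add_closed[OF G, of f h] F'.a_closed[of f h] by auto
  qed (use submodule_zero_closed[OF G] F'.zero_closed in auto)
  moreover have "A \<subseteq> ?G \<inter> carrier ?F'"
    using A(2) HF restr submodule_span_superset[of ?B R ?F] by auto
  ultimately have H'G: "?H' \<subseteq> ?G" using A(3) submodule_span_least by blast
  have "c \<in> (\<lambda>f. f k) ` ?G" if c: "c \<in> C" for c
  proof -
    have "g c \<in> ?G" using c submodule_span_superset[of ?B R ?F] by blast
    then have "g c k \<in> (\<lambda>f. f k) ` ?G" by (rule imageI)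
    then show ?thesis by (simp only: g(2)[OF c])
  qed
  then have Idl: "Idl\<^bsub>R\<^esub> C \<subseteq> (\<lambda>f. f k) ` ?G"
    by (intro genideal_minimal coordinate_ideal[OF assms(2) G] subsetI)
  have "h \<in> ?G" if h: "h \<in> H" for h
  proof -
    have "h k \<in> (\<lambda>f. f k) ` H" using h by simp
    then have "h k \<in> (\<lambda>f. f k) ` ?G" unfolding C(3) using Idl by blast
    then obtain f where f: "f \<in> ?G" "f k = h k" by auto
    have fH: "f \<in> H" using f GH by auto
    have "(h \<ominus>\<^bsub>?F\<^esub> f) k = \<zero>\<^bsub>R\<^esub>"
      using f(2) HF[OF h] HF[OF fH] free_module_closed[OF assms(2) HF[OF h]]
      by (simp add: free_module_minus[OF assms(2)] minus_eq_zero_iff)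
    then have "h \<ominus>\<^bsub>?F\<^esub> f \<in> ?G"
      using H'G submodule_minus_closed[OF F Suc.prems h fH] by auto
    then have "(h \<ominus>\<^bsub>?F\<^esub> f) \<oplus>\<^bsub>?F\<^esub> f \<in> ?G" using f(1) submodule_add_closed[OF G] by blast
    moreover have "(h \<ominus>\<^bsub>?F\<^esub> f) \<oplus>\<^bsub>?F\<^esub> f = h"
      using HF[OF h] HF[OF fH] by (simp add: a_minus_def F.a_assoc F.l_neg del: free_module_simps)
    ultimately show ?thesis by simp
  qed
  moreover have "finite ?B" using A C by auto
  ultimately show ?case using BH by blast
qed

lemma matrix_map_eq:
  assumes "cring R" "\<And>i j. i < k \<Longrightarrow> j < m \<Longrightarrow> A i j \<in> carrier R" "f \<in> carrier (free_module R {..<m})"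
  shows "matrix_map R m k A f =
    linear_extension R (free_module R {..<k}) (\<lambda>j i. if i < k then A i j else \<zero>\<^bsub>R\<^esub>) f"
proof
  fix i
  interpret cring R by fact
  let ?F = "free_module R {..<k}" and ?c = "\<lambda>j i. if i < k then A i j else \<zero>\<^bsub>R\<^esub>"
  note F = free_module_module[OF assms(1), of "{..<k}"]
  interpret F: module R ?F by (rule F)
  note f = free_module_closed[OF assms(1,3)]
  have c: "?c \<in> {..<m} \<rightarrow> carrier ?F" using assms(2) by (auto simp: free_module_carrier_finite)
  have "linear_extension R ?F ?c f i = (\<Oplus>\<^bsub>?F\<^esub>j\<in>{..<m}. f j \<odot>\<^bsub>?F\<^esub> ?c j) i"
    by (subst linear_extension_finite[OF F _ c assms(3)]) auto
  also have "\<dots> = (\<Oplus>\<^bsub>R\<^esub>j\<in>{..<m}. f j \<otimes>\<^bsub>R\<^esub> ?c j i)"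
    using c f F.smult_closed
    by (subst module_hom_finsum[OF F self_module[OF assms(1)] coordinate_hom[OF assms(1)]])
      (auto simp: Pi_iff simp del: free_module_simps(3), simp)
  also have "\<dots> = matrix_map R m k A f i"
  proof (cases "i < k")
    case True
    then show ?thesis
      using assms(2) f by (auto simp: matrix_map_def m_comm intro!: finsum_cong')
  next
    case False
    then show ?thesis using f by (simp add: matrix_map_def finsum_zero)
  qed
  finally show "matrix_map R m k A f i = linear_extension R ?F ?c f i" by simp
qed

lemma minimal_presentation_exists:
  assumes "noetherian_ring R" "module R M" "finitely_generated R M"
  shows "\<exists>m A p. minimal_presentation R M m A p"
proof -
  interpret M: module R M by fact
  have cr: "cring R" by unfold_locales
  let ?k = "min_num_generators R M"
  let ?F = "free_module R {..<?k}"
  note F = free_module_module[OF cr, of "{..<?k}"]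
  obtain x where x: "generating_set R M (x ` {..<?k})" by (rule obtain_minimal_generators[OF assms(3)])
  have xM: "x \<in> {..<?k} \<rightarrow> carrier M" using generating_set_subset[OF x] by auto
  let ?p = "linear_extension R M x"
  note p = linear_extension_hom[OF assms(2) xM]
  have surj: "?p ` carrier ?F = carrier M"
    using linear_extension_image[OF assms(2) xM] x by (simp add: generating_set_def)
  have K: "submodule (a_kernel ?F M ?p) R ?F"
    using submodule_vimage[OF F assms(2) p submodule_zero[OF assms(2)]] by (simp add: a_kernel_eq)
  obtain B where B: "finite B" "B \<subseteq> a_kernel ?F M ?p" "a_kernel ?F M ?p \<subseteq> submodule_span R ?F B"
    using noetherian_free_module[OF assms(1) cr K] by blast
  have KB: "submodule_span R ?F B = a_kernel ?F M ?p"
    using B submodule_span_least[OF K] by blast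
  have BF: "B \<subseteq> carrier ?F" using B(2) submodule_subset[OF K] by auto
  obtain v where v: "bij_betw v {..<card B} B"
    using ex_bij_betw_nat_finite[OF B(1)] by (auto simp: atLeast0LessThan)
  then have vB: "v ` {..<card B} = B" by (rule bij_betw_imp_surj_on)
  then have vF: "v j \<in> carrier ?F" if "j < card B" for j using that BF by auto
  define A where "A i j = v j i" for i j
  have A: "A i j \<in> carrier R" if "i < ?k" "j < card B" for i j
    using free_module_closed[OF cr vF[OF that(2)]] by (simp add: A_def)
  have "linear_extension R ?F (\<lambda>j i. if i < ?k then A i j else \<zero>\<^bsub>R\<^esub>) f = linear_extension R ?F v f"
    if "f \<in> carrier (free_module R {..<card B})" for f
    using vF by (intro linear_extension_cong[OF F _ _ that]) (auto simp: A_def free_module_carrier)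
  then have "matrix_map R (card B) ?k A ` carrier (free_module R {..<card B}) =
      linear_extension R ?F v ` carrier (free_module R {..<card B})"
    using matrix_map_eq[OF cr A] by (intro image_cong) auto
  also have "\<dots> = a_kernel ?F M ?p"
    using linear_extension_image[OF F, of v "{..<card B}"] vF vB KB by auto
  finally show ?thesis using A p surj unfolding minimal_presentation_def Let_def by metis
qed

text \<open>The presentation ideal is defined by choosing a presentation, so that the existence of one is needed
  before anything is known about the ideal.\<close>

lemma presentation_ideal_witness:
  assumes "noetherian_ring R" "module R M" "finitely_generated R M"
    and s: "s \<in> presentation_ideal R M"
  obtains x :: "nat \<Rightarrow> 'm" and m :: nat and A where
    "generating_set R (M :: ('a, 'm, 'x) module_scheme) (x ` {..<min_num_generators R M})"
    "\<And>i j. i < min_num_generators R M \<Longrightarrow> j < m \<Longrightarrow> A i j \<in> carrier R"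
    "\<And>j. j < m \<Longrightarrow> (\<Oplus>\<^bsub>M\<^esub>i\<in>{..<min_num_generators R M}. A i j \<odot>\<^bsub>M\<^esub> x i) = \<zero>\<^bsub>M\<^esub>"
    "s \<in> Idl\<^bsub>R\<^esub> {A i j |i j. i < min_num_generators R M \<and> j < m}"
proof -
  interpret M: module R M by fact
  have cr: "cring R" by unfold_locales
  let ?k = "min_num_generators R M"
  let ?F = "free_module R {..<?k}"
  note F = free_module_module[OF cr, of "{..<?k}"]
  have "\<exists>I m A p. minimal_presentation R M m A p \<and> I = Idl\<^bsub>R\<^esub> {A i j |i j. i < ?k \<and> j < m}"
    using minimal_presentation_exists[OF assms(1-3)] by blast
  from someI_ex[OF this] obtain m A p where mp: "minimal_presentation R M m A p"
    and I: "presentation_ideal R M = Idl\<^bsub>R\<^esub> {A i j |i j. i < ?k \<and> j < m}"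
    unfolding presentation_ideal_def by blast
  have A: "\<And>i j. i < ?k \<Longrightarrow> j < m \<Longrightarrow> A i j \<in> carrier R"
    and p: "p \<in> module_hom R ?F M" "p ` carrier ?F = carrier M"
    and ker: "a_kernel ?F M p = matrix_map R m ?k A ` carrier (free_module R {..<m})"
    using mp by (auto simp: minimal_presentation_def Let_def)
  define x where "x i = p (basis_vector R i)" for i
  have xM: "x \<in> {..<?k} \<rightarrow> carrier M"
    using module_hom_closed[OF p(1) basis_vector_closed[OF cr]] by (auto simp: x_def)
  have p_eq: "p f = linear_extension R M x f" if "f \<in> carrier ?F" for f
    using linear_extension_basis_vector[OF assms(2) xM]
    by (intro free_module_hom_eqI[OF assms(2) p(1) linear_extension_hom[OF assms(2) xM] _ that])
      (simp add: x_def)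
  have "linear_extension R M x ` carrier ?F = carrier M"
    using p(2) p_eq image_cong[of "carrier ?F" "carrier ?F" p "linear_extension R M x"] by simp
  then have gen: "generating_set R M (x ` {..<?k})"
    using linear_extension_image[OF assms(2) xM] xM by (auto simp: generating_set_def)
  have "(\<Oplus>\<^bsub>M\<^esub>i\<in>{..<?k}. A i j \<odot>\<^bsub>M\<^esub> x i) = \<zero>\<^bsub>M\<^esub>" if j: "j < m" for j
  proof -
    let ?c = "\<lambda>j i. if i < ?k then A i j else \<zero>\<^bsub>R\<^esub>"
    have c: "?c \<in> {..<m} \<rightarrow> carrier ?F" using A by (auto simp: free_module_carrier_finite)
    have "matrix_map R m ?k A (basis_vector R j) = ?c j"
      using matrix_map_eq[OF cr A basis_vector_closed[OF cr]] j
        linear_extension_basis_vector[OF F c] by simp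
    then have "?c j \<in> a_kernel ?F M p"
      using ker imageI[OF basis_vector_closed[OF cr, of j "{..<m}"], of "matrix_map R m ?k A"] j by simp
    then have "linear_extension R M x (?c j) = \<zero>\<^bsub>M\<^esub>" using p_eq by (auto simp: a_kernel_eq)
    moreover have "linear_extension R M x (?c j) = (\<Oplus>\<^bsub>M\<^esub>i\<in>{..<?k}. ?c j i \<odot>\<^bsub>M\<^esub> x i)"
      using c j by (intro linear_extension_finite[OF assms(2) _ xM]) auto
    moreover have "\<dots> = (\<Oplus>\<^bsub>M\<^esub>i\<in>{..<?k}. A i j \<odot>\<^bsub>M\<^esub> x i)"
      using xM A j by (intro M.finsum_cong') auto
    ultimately show ?thesis by simp
  qed
  then show ?thesis using s I by (intro that[of x m A, OF gen A]) auto
qed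

lemma annihilator_ideal:
  assumes "module R P" "t \<in> carrier P"
  shows "ideal {a \<in> carrier R. a \<odot>\<^bsub>P\<^esub> t = \<zero>\<^bsub>P\<^esub>} R"
proof -
  interpret P: module R P by fact
  have cr: "cring R" by unfold_locales
  have "(\<lambda>a. a \<odot>\<^bsub>P\<^esub> t) \<in> module_hom R (algebra_module R (\<lambda>a. a)) P"
    using assms(2) by (auto simp: module_hom_iff P.smult_l_distr P.smult_assoc1)
  from submodule_vimage[OF self_module[OF cr] assms(1) this submodule_zero[OF assms(1)]]
  show ?thesis by (intro submodule_imp_ideal[OF cr]) simp
qed

lemma alternating_annihilated_by_relations:
  assumes "module R M" "module R P" "alternating R n M P \<phi>"
    and x: "\<And>i. i < n \<Longrightarrow> x i \<in> carrier M"
    and A: "\<And>i j. i < n \<Longrightarrow> j < (m::nat) \<Longrightarrow> A i j \<in> carrier R"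
    and rel: "\<And>j. j < m \<Longrightarrow> (\<Oplus>\<^bsub>M\<^esub>i\<in>{..<n}. A i j \<odot>\<^bsub>M\<^esub> x i) = \<zero>\<^bsub>M\<^esub>"
    and s: "s \<in> Idl\<^bsub>R\<^esub> {A i j |i j. i < n \<and> j < m}"
  shows "s \<odot>\<^bsub>P\<^esub> \<phi> x = \<zero>\<^bsub>P\<^esub>"
proof -
  interpret P: module R P by fact
  have cl: "\<phi> x \<in> carrier P"
    using assms(3) x by (auto simp: alternating_def intro: multilinear_closed)
  have "A i j \<odot>\<^bsub>P\<^esub> \<phi> x = \<zero>\<^bsub>P\<^esub>" if "i < n" "j < m" for i j
    using alternating_relation[OF assms(1-3), of x "\<lambda>i. A i j" i] x A rel that by simp
  then have "Idl\<^bsub>R\<^esub> {A i j |i j. i < n \<and> j < m} \<subseteq> {a \<in> carrier R. a \<odot>\<^bsub>P\<^esub> \<phi> x = \<zero>\<^bsub>P\<^esub>}"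
    using A by (intro P.genideal_minimal annihilator_ideal[OF assms(2) cl]) auto
  then show ?thesis using s by auto
qed


subsection \<open>Coordinates modulo the maximal ideal\<close>

text \<open>A nonempty chain of ideals contains its union, which therefore is a proper ideal again.\<close>

lemma (in noetherian_ring) proper_ideal_in_maximal:
  assumes "ideal I R" "I \<noteq> carrier R"
  shows "\<exists>J. maximalideal J R \<and> I \<subseteq> J"
proof -
  let ?C = "{J. ideal J R \<and> I \<subseteq> J \<and> J \<noteq> carrier R}"
  have "\<exists>J\<in>?C. \<forall>X\<in>?C. J \<subseteq> X \<longrightarrow> X = J"
  proof (rule subset_Zorn_nonempty)
    show "?C \<noteq> {}" using assms by auto
    fix C assume C: "C \<noteq> {}" "subset.chain ?C C"
    then have "subset.chain {J. ideal J R} C" by (auto simp: pred_on.chain_def)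
    from ideal_chain_is_trivial[OF C(1) this] have "\<Union>C \<in> C" .
    moreover have "C \<subseteq> ?C" using C(2) by (simp add: pred_on.chain_def)
    ultimately show "\<Union>C \<in> ?C" by (rule subsetD[rotated])
  qed
  then obtain J where J: "J \<in> ?C" "\<forall>X\<in>?C. J \<subseteq> X \<longrightarrow> X = J" ..
  have "maximalideal J R"
  proof (rule maximalidealI)
    show "K = J \<or> K = carrier R" if "ideal K R" "J \<subseteq> K" "K \<subseteq> carrier R" for K
      using J(1) bspec[OF J(2), of K] that by auto
  qed (use J(1) in auto)
  then show ?thesis using J(1) by blast
qed

lemma local_ring_one_not_zero:
  assumes "local_ring R"
  shows "\<one>\<^bsub>R\<^esub> \<noteq> \<zero>\<^bsub>R\<^esub>"
proof
  interpret local_ring R by fact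
  assume "\<one>\<^bsub>R\<^esub> = \<zero>\<^bsub>R\<^esub>"
  obtain \<mm> where "maximalideal \<mm> R" using unique_maximalideal by blast
  then interpret I: maximalideal \<mm> R .
  have "\<one>\<^bsub>R\<^esub> \<in> \<mm>" using \<open>\<one>\<^bsub>R\<^esub> = \<zero>\<^bsub>R\<^esub>\<close> by simp
  then show False using I.one_imp_carrier I.I_notcarr by auto
qed

lemma local_ring_unit:
  assumes "local_ring R" "noetherian_ring R" "maximalideal \<mm> R" "d \<in> carrier R" "d \<notin> \<mm>"
  shows "d \<in> Units R"
proof -
  interpret local_ring R by fact
  interpret N: noetherian_ring R by fact
  have "PIdl\<^bsub>R\<^esub> d = carrier R"
  proof (rule ccontr)
    assume "PIdl\<^bsub>R\<^esub> d \<noteq> carrier R"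
    then obtain J where "maximalideal J R" "PIdl\<^bsub>R\<^esub> d \<subseteq> J"
      using N.proper_ideal_in_maximal[OF cgenideal_ideal[OF assms(4)]] by blast
    then show False using unique_maximalideal assms(3,5) cgenideal_self[OF assms(4)] by blast
  qed
  then have "\<one>\<^bsub>R\<^esub> \<in> PIdl\<^bsub>R\<^esub> d" by simp
  then show ?thesis using assms(4) m_comm unfolding cgenideal_def Units_def by force
qed

text \<open>A relation between minimal generators has no unit coefficient, as the corresponding generator
  could be dropped.\<close>

lemma minimal_generators_relation:
  assumes "local_ring R" "noetherian_ring R" "maximalideal \<mm> R" "module R M"
    and gen: "generating_set R M (x ` {..<min_num_generators R M})"
    and f: "\<And>i. i < min_num_generators R M \<Longrightarrow> f i \<in> carrier R"
    and rel: "(\<Oplus>\<^bsub>M\<^esub>i\<in>{..<min_num_generators R M}. f i \<odot>\<^bsub>M\<^esub> x i) = \<zero>\<^bsub>M\<^esub>"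
    and i: "i < min_num_generators R M"
  shows "f i \<in> \<mm>"
proof (rule ccontr)
  assume "f i \<notin> \<mm>"
  then have u: "f i \<in> Units R" by (rule local_ring_unit[OF assms(1-3) f[OF i]])
  interpret M: module R M by fact
  let ?k = "min_num_generators R M"
  let ?A = "x ` ({..<?k} - {i})"
  have x: "x j \<in> carrier M" if "j < ?k" for j using generating_set_subset[OF gen] that by auto
  have "generating_set R M ?A"
  proof (rule generating_setI[OF assms(4)])
    show "?A \<subseteq> carrier M" using x by auto
    fix H assume H: "submodule H R M" "?A \<subseteq> H"
    let ?r = "\<Oplus>\<^bsub>M\<^esub>j\<in>{..<?k} - {i}. f j \<odot>\<^bsub>M\<^esub> x j"
    have r: "?r \<in> H"
      using H(2) f by (intro submodule_finsum_closed[OF assms(4) H(1)]) (auto intro!: submodule_smult_closed[OF H(1)])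
    have "f i \<odot>\<^bsub>M\<^esub> x i \<oplus>\<^bsub>M\<^esub> ?r = \<zero>\<^bsub>M\<^esub>"
      using M.add.finprod_extract[of "{..<?k}" i "\<lambda>j. f j \<odot>\<^bsub>M\<^esub> x j"] rel i f x by auto
    then have "f i \<odot>\<^bsub>M\<^esub> x i = \<ominus>\<^bsub>M\<^esub> ?r"
      using M.minus_equality[of "f i \<odot>\<^bsub>M\<^esub> x i" ?r] submodule_subset[OF H(1) r] f[OF i] x[OF i] by simp
    then have "f i \<odot>\<^bsub>M\<^esub> x i \<in> H" using M.submoduleE(3)[OF H(1) r] by simp
    then have "inv\<^bsub>R\<^esub> f i \<odot>\<^bsub>M\<^esub> (f i \<odot>\<^bsub>M\<^esub> x i) \<in> H"
      using submodule_smult_closed[OF H(1)] M.Units_inv_closed[OF u] by blast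
    then have "x i \<in> H"
      using M.Units_inv_closed[OF u] M.Units_l_inv[OF u] f[OF i] x[OF i] by (simp add: M.smult_assoc1[symmetric])
    then have "x ` {..<?k} \<subseteq> H" using H(2) by auto
    then show "carrier M \<subseteq> H" using generating_setD[OF gen H(1)] by blast
  qed
  then have "?k \<le> card ?A" by (intro min_num_generators_le) auto
  also have "\<dots> \<le> card ({..<?k} - {i})" by (rule card_image_le) simp
  also have "\<dots> < ?k" using i by simp
  finally show False by simp
qed

text \<open>By the preceding lemma two expressions of an element by the generators have the same coefficients
  modulo \<open>\<mm>\<close>.\<close>

lemma minimal_generators_coordinate:
  assumes "local_ring R" "noetherian_ring R" "maximalideal \<mm> R" "module R M"
    and gen: "generating_set R M (x ` {..<min_num_generators R M})"
    and i: "i < min_num_generators R M"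
  obtains c where "c \<in> module_hom R M (algebra_module (R Quot \<mm>) ((+>\<^bsub>R\<^esub>) \<mm>))"
    "\<And>j. j < min_num_generators R M \<Longrightarrow>
      c (x j) = (if j = i then \<one>\<^bsub>R Quot \<mm>\<^esub> else \<zero>\<^bsub>R Quot \<mm>\<^esub>)"
proof -
  interpret M: module R M by fact
  interpret I: maximalideal \<mm> R by fact
  have cr: "cring R" by unfold_locales
  let ?k = "min_num_generators R M"
  let ?F = "free_module R {..<?k}" and ?K = "algebra_module (R Quot \<mm>) ((+>\<^bsub>R\<^esub>) \<mm>)"
  note F = free_module_module[OF cr, of "{..<?k}"]
  have K: "module R ?K"
    by (rule algebra_module_module[OF cr I.quotient_is_cring[OF cr] I.rcos_ring_hom])
  have x: "x \<in> {..<?k} \<rightarrow> carrier M" using generating_set_subset[OF gen] by auto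
  let ?p = "linear_extension R M x" and ?q = "\<lambda>f. \<mm> +>\<^bsub>R\<^esub> f i"
  have surj: "?p ` carrier ?F = carrier M"
    using linear_extension_image[OF assms(4) x] gen by (simp add: generating_set_def)
  have q: "?q \<in> module_hom R ?F ?K"
    using free_module_closed[OF cr, where X = "{..<?k}"] ring_hom_closed[OF I.rcos_ring_hom]
      ring_hom_add[OF I.rcos_ring_hom] ring_hom_mult[OF I.rcos_ring_hom]
    by (auto simp: module_hom_iff)
  have ker: "?q f = \<zero>\<^bsub>?K\<^esub>" if f: "f \<in> carrier ?F" "?p f = \<zero>\<^bsub>M\<^esub>" for f
  proof -
    have "f i \<in> \<mm>"
      using minimal_generators_relation[OF assms(1-5), of f i] i f free_module_closed[OF cr f(1)]
        linear_extension_finite[OF assms(4) _ x f(1)] by simp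
    then show ?thesis using M.a_rcos_zero[OF I.is_ideal] by (simp add: FactRing_def)
  qed
  obtain c where c: "c \<in> module_hom R M ?K" "\<And>f. f \<in> carrier ?F \<Longrightarrow> c (?p f) = ?q f"
    by (rule module_hom_factor[OF F assms(4) K linear_extension_hom[OF assms(4) x] surj q]) (simp_all only: ker)
  have "c (x j) = (if j = i then \<one>\<^bsub>R Quot \<mm>\<^esub> else \<zero>\<^bsub>R Quot \<mm>\<^esub>)" if "j < ?k" for j
  proof -
    have "c (x j) = ?q (basis_vector R j)"
      using c(2)[OF basis_vector_closed[OF cr]] linear_extension_basis_vector[OF assms(4) x] that by simp
    then show ?thesis
      using M.a_rcos_zero[OF I.is_ideal I.zero_closed] by (auto simp: basis_vector_def FactRing_def)
  qed
  then show ?thesis using c(1) that by blast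
qed


section \<open>The total quotient ring\<close>

context cring
begin

abbreviation S where "S \<equiv> nonzerodivisors R"
abbreviation fr where "fr \<equiv> fraction R S"
abbreviation Q where "Q \<equiv> total_quotient_ring R"

lemma nonzerodivisors_one [simp, intro]: "\<one> \<in> S"
  by (simp add: nonzerodivisors_def)

lemma nonzerodivisors_cancel_zero: "s \<in> S \<Longrightarrow> a \<in> carrier R \<Longrightarrow> s \<otimes> a = \<zero> \<longleftrightarrow> a = \<zero>"
  by (auto simp: nonzerodivisors_def)

lemma nonzerodivisorsI:
  "s \<in> carrier R \<Longrightarrow> (\<And>a. a \<in> carrier R \<Longrightarrow> s \<otimes> a = \<zero> \<Longrightarrow> a = \<zero>) \<Longrightarrow> s \<in> S"
  by (simp add: nonzerodivisors_def)

lemma nonzerodivisors_closed [simp, intro]: "s \<in> S \<Longrightarrow> s \<in> carrier R"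
  by (simp add: nonzerodivisors_def)

lemma nonzerodivisors_mult [simp, intro]: "s \<in> S \<Longrightarrow> t \<in> S \<Longrightarrow> s \<otimes> t \<in> S"
  by (rule nonzerodivisorsI) (simp_all add: m_assoc nonzerodivisors_cancel_zero)

lemma nonzerodivisors_pow [simp, intro]: "s \<in> S \<Longrightarrow> s [^] (n::nat) \<in> S"
  by (induction n) auto

lemma nonzerodivisors_cancel:
  assumes "s \<in> S" "a \<in> carrier R" "b \<in> carrier R"
  shows "s \<otimes> a = s \<otimes> b \<longleftrightarrow> a = b"
proof
  assume "s \<otimes> a = s \<otimes> b"
  then have "s \<otimes> (a \<ominus> b) = \<zero>" using assms by (simp add: a_minus_def r_distr r_minus r_neg)
  then show "a = b" using assms by (simp add: nonzerodivisors_cancel_zero minus_eq_zero_iff)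
qed simp

lemma fraction_rel_iff:
  "((a, s), (b, t)) \<in> fraction_rel R S \<longleftrightarrow>
    a \<in> carrier R \<and> s \<in> S \<and> b \<in> carrier R \<and> t \<in> S \<and> a \<otimes> t = b \<otimes> s"
proof -
  have "(\<exists>u\<in>S. u \<otimes> (a \<otimes> t \<ominus> b \<otimes> s) = \<zero>) \<longleftrightarrow> a \<otimes> t = b \<otimes> s"
    if "a \<in> carrier R" "s \<in> S" "b \<in> carrier R" "t \<in> S"
    using that nonzerodivisors_cancel_zero[of _ "a \<otimes> t \<ominus> b \<otimes> s"] nonzerodivisors_one
      minus_eq_zero_iff[of "a \<otimes> t" "b \<otimes> s"] by auto
  then show ?thesis by (auto simp: fraction_rel_def)
qed

lemma fraction_rel_equiv: "equiv (carrier R \<times> S) (fraction_rel R S)"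
proof (rule equivI)
  show "refl_on (carrier R \<times> S) (fraction_rel R S)"
    by (auto simp: refl_on_def fraction_rel_iff)
  show "sym (fraction_rel R S)" by (auto simp: sym_def fraction_rel_iff)
  show "fraction_rel R S \<subseteq> (carrier R \<times> S) \<times> (carrier R \<times> S)" by (auto simp: fraction_rel_iff)
  show "trans (fraction_rel R S)"
  proof (rule transI)
    fix x y z assume xy: "(x, y) \<in> fraction_rel R S" and yz: "(y, z) \<in> fraction_rel R S"
    obtain a s b t c u where [simp]: "x = (a, s)" "y = (b, t)" "z = (c, u)"
      by (cases x, cases y, cases z) auto
    have cl: "a \<in> carrier R" "b \<in> carrier R" "c \<in> carrier R" "s \<in> S" "t \<in> S" "u \<in> S"
      and eq: "a \<otimes> t = b \<otimes> s" "b \<otimes> u = c \<otimes> t"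
      using xy yz by (auto simp: fraction_rel_iff)
    have "t \<otimes> (a \<otimes> u) = (a \<otimes> t) \<otimes> u" using cl by (simp add: m_ac)
    also have "\<dots> = (b \<otimes> u) \<otimes> s" unfolding eq(1) using cl by (simp add: m_ac)
    also have "\<dots> = t \<otimes> (c \<otimes> s)" unfolding eq(2) using cl by (simp add: m_ac)
    finally have "a \<otimes> u = c \<otimes> s" using cl by (subst (asm) nonzerodivisors_cancel) auto
    then show "(x, z) \<in> fraction_rel R S" using cl by (simp add: fraction_rel_iff)
  qed
qed

lemma fraction_eq_iff:
  "a \<in> carrier R \<Longrightarrow> s \<in> S \<Longrightarrow> b \<in> carrier R \<Longrightarrow> t \<in> S \<Longrightarrow> fr a s = fr b t \<longleftrightarrow> a \<otimes> t = b \<otimes> s"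
  unfolding fraction_def
  by (subst eq_equiv_class_iff[OF fraction_rel_equiv]) (auto simp: fraction_rel_iff)

lemma fraction_mem:
  "x \<in> fr a s \<longleftrightarrow> fst x \<in> carrier R \<and> snd x \<in> S \<and> a \<in> carrier R \<and> s \<in> S \<and> a \<otimes> snd x = fst x \<otimes> s"
  by (cases x) (auto simp: fraction_def fraction_rel_iff)

lemma total_quotient_carrier: "carrier Q = {fr a s |a s. a \<in> carrier R \<and> s \<in> S}"
  by (auto simp: total_quotient_ring_def localization_def quotient_def fraction_def)

lemma fraction_closed [simp, intro]: "a \<in> carrier R \<Longrightarrow> s \<in> S \<Longrightarrow> fr a s \<in> carrier Q"
  by (auto simp: total_quotient_carrier)

lemma fraction_cases:
  assumes "q \<in> carrier Q"
  obtains a s where "a \<in> carrier R" "s \<in> S" "q = fr a s"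
  using assms by (auto simp: total_quotient_carrier)

lemma total_quotient_one: "\<one>\<^bsub>Q\<^esub> = fr \<one> \<one>" and total_quotient_zero: "\<zero>\<^bsub>Q\<^esub> = fr \<zero> \<one>"
  by (simp_all add: total_quotient_ring_def localization_def)

text \<open>The operations on fractions are unions over representatives. They are evaluated by showing that the
  result does not depend on the representatives.\<close>

lemma fraction_union_eq:
  assumes ab: "a \<in> carrier R" "s \<in> S" "b \<in> carrier R" "t \<in> S"
    and "\<And>a' s' b' t'. a' \<in> carrier R \<Longrightarrow> s' \<in> S \<Longrightarrow> b' \<in> carrier R \<Longrightarrow> t' \<in> S \<Longrightarrow>
      a \<otimes> s' = a' \<otimes> s \<Longrightarrow> b \<otimes> t' = b' \<otimes> t \<Longrightarrow> F (a', s') (b', t') = Z"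
  shows "(\<Union>x\<in>fr a s. \<Union>y\<in>fr b t. F x y) = Z"
proof -
  have "F x y = Z" if "x \<in> fr a s" "y \<in> fr b t" for x y
    using that assms(5)[of "fst x" "snd x" "fst y" "snd y"] by (auto simp: fraction_mem)
  moreover have "(a, s) \<in> fr a s" "(b, t) \<in> fr b t" using ab by (auto simp: fraction_mem)
  ultimately show ?thesis by blast
qed

lemma fraction_mult:
  assumes ab: "a \<in> carrier R" "s \<in> S" "b \<in> carrier R" "t \<in> S"
  shows "fr a s \<otimes>\<^bsub>Q\<^esub> fr b t = fr (a \<otimes> b) (s \<otimes> t)"
proof -
  have "fr (a' \<otimes> b') (s' \<otimes> t') = fr (a \<otimes> b) (s \<otimes> t)"
    if cl: "a' \<in> carrier R" "s' \<in> S" "b' \<in> carrier R" "t' \<in> S"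
      and eq: "a \<otimes> s' = a' \<otimes> s" "b \<otimes> t' = b' \<otimes> t" for a' s' b' t'
  proof -
    have "a' \<otimes> b' \<otimes> (s \<otimes> t) = (a' \<otimes> s) \<otimes> (b' \<otimes> t)" using ab cl by (simp add: m_ac)
    also have "\<dots> = a \<otimes> b \<otimes> (s' \<otimes> t')" unfolding eq[symmetric] using ab cl by (simp add: m_ac)
    finally show ?thesis using ab cl by (simp add: fraction_eq_iff)
  qed
  then show ?thesis
    using fraction_union_eq[OF ab, of "\<lambda>x y. fr (fst x \<otimes> fst y) (snd x \<otimes> snd y)"]
    by (simp add: total_quotient_ring_def localization_def)
qed

lemma fraction_add:
  assumes ab: "a \<in> carrier R" "s \<in> S" "b \<in> carrier R" "t \<in> S"
  shows "fr a s \<oplus>\<^bsub>Q\<^esub> fr b t = fr (a \<otimes> t \<oplus> b \<otimes> s) (s \<otimes> t)"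
proof -
  have "fr (a' \<otimes> t' \<oplus> b' \<otimes> s') (s' \<otimes> t') = fr (a \<otimes> t \<oplus> b \<otimes> s) (s \<otimes> t)"
    if cl: "a' \<in> carrier R" "s' \<in> S" "b' \<in> carrier R" "t' \<in> S"
      and eq: "a \<otimes> s' = a' \<otimes> s" "b \<otimes> t' = b' \<otimes> t" for a' s' b' t'
  proof -
    have "(a' \<otimes> t' \<oplus> b' \<otimes> s') \<otimes> (s \<otimes> t) = (a' \<otimes> s) \<otimes> (t \<otimes> t') \<oplus> (b' \<otimes> t) \<otimes> (s \<otimes> s')"
      using ab cl by (simp add: l_distr r_distr m_ac)
    also have "\<dots> = (a \<otimes> t \<oplus> b \<otimes> s) \<otimes> (s' \<otimes> t')"
      unfolding eq[symmetric] using ab cl by (simp add: l_distr r_distr m_ac)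
    finally show ?thesis using ab cl by (simp add: fraction_eq_iff)
  qed
  then show ?thesis
    using fraction_union_eq[OF ab, of "\<lambda>x y. fr (fst x \<otimes> snd y \<oplus> fst y \<otimes> snd x) (snd x \<otimes> snd y)"]
    by (simp add: total_quotient_ring_def localization_def)
qed

lemma total_quotient_cring: "cring Q"
proof (rule cringI)
  show "abelian_group Q"
  proof (rule abelian_groupI)
    fix p q assume "p \<in> carrier Q" "q \<in> carrier Q"
    then obtain a s b t where [simp]: "p = fr a s" "q = fr b t"
      and cl: "a \<in> carrier R" "s \<in> S" "b \<in> carrier R" "t \<in> S" by (auto elim!: fraction_cases)
    show "p \<oplus>\<^bsub>Q\<^esub> q \<in> carrier Q" using cl by (auto simp: fraction_add)
    show "p \<oplus>\<^bsub>Q\<^esub> q = q \<oplus>\<^bsub>Q\<^esub> p" using cl by (simp add: fraction_add m_ac a_ac)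
    show "\<zero>\<^bsub>Q\<^esub> \<oplus>\<^bsub>Q\<^esub> p = p" using cl by (simp add: fraction_add total_quotient_zero)
    have "fr (\<ominus> a) s \<oplus>\<^bsub>Q\<^esub> p = \<zero>\<^bsub>Q\<^esub>"
      using cl by (simp add: fraction_add total_quotient_zero fraction_eq_iff l_minus l_neg)
    then show "\<exists>y\<in>carrier Q. y \<oplus>\<^bsub>Q\<^esub> p = \<zero>\<^bsub>Q\<^esub>" using cl by (intro bexI[of _ "fr (\<ominus> a) s"]) auto
    fix r assume "r \<in> carrier Q"
    then obtain c u where [simp]: "r = fr c u" and cl': "c \<in> carrier R" "u \<in> S"
      by (auto elim!: fraction_cases)
    show "p \<oplus>\<^bsub>Q\<^esub> q \<oplus>\<^bsub>Q\<^esub> r = p \<oplus>\<^bsub>Q\<^esub> (q \<oplus>\<^bsub>Q\<^esub> r)"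
      using cl cl' by (simp add: fraction_add l_distr r_distr m_ac a_ac)
  qed (auto simp: total_quotient_zero)
  show "comm_monoid Q"
  proof (rule comm_monoidI)
    fix p q assume "p \<in> carrier Q" "q \<in> carrier Q"
    then obtain a s b t where [simp]: "p = fr a s" "q = fr b t"
      and cl: "a \<in> carrier R" "s \<in> S" "b \<in> carrier R" "t \<in> S" by (auto elim!: fraction_cases)
    show "p \<otimes>\<^bsub>Q\<^esub> q \<in> carrier Q" using cl by (auto simp: fraction_mult)
    show "p \<otimes>\<^bsub>Q\<^esub> q = q \<otimes>\<^bsub>Q\<^esub> p" using cl by (simp add: fraction_mult m_ac)
    show "\<one>\<^bsub>Q\<^esub> \<otimes>\<^bsub>Q\<^esub> p = p" using cl by (simp add: fraction_mult total_quotient_one)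
    fix r assume "r \<in> carrier Q"
    then obtain c u where [simp]: "r = fr c u" and cl': "c \<in> carrier R" "u \<in> S"
      by (auto elim!: fraction_cases)
    show "p \<otimes>\<^bsub>Q\<^esub> q \<otimes>\<^bsub>Q\<^esub> r = p \<otimes>\<^bsub>Q\<^esub> (q \<otimes>\<^bsub>Q\<^esub> r)" using cl cl' by (simp add: fraction_mult m_ac)
  qed (auto simp: total_quotient_one)
  fix p q r assume "p \<in> carrier Q" "q \<in> carrier Q" "r \<in> carrier Q"
  then obtain a s b t c u where [simp]: "p = fr a s" "q = fr b t" "r = fr c u"
    and cl: "a \<in> carrier R" "s \<in> S" "b \<in> carrier R" "t \<in> S" "c \<in> carrier R" "u \<in> S"
    by (auto elim!: fraction_cases)
  show "(p \<oplus>\<^bsub>Q\<^esub> q) \<otimes>\<^bsub>Q\<^esub> r = p \<otimes>\<^bsub>Q\<^esub> r \<oplus>\<^bsub>Q\<^esub> q \<otimes>\<^bsub>Q\<^esub> r"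
    using cl by (simp add: fraction_add fraction_mult fraction_eq_iff l_distr r_distr m_ac)
qed

lemma to_total_quotient_hom: "to_total_quotient R \<in> ring_hom R Q"
  by (rule ring_hom_memI)
    (auto simp: to_total_quotient_def fraction_add fraction_mult total_quotient_one)

lemma to_total_quotient_mult_fraction:
  "b \<in> carrier R \<Longrightarrow> a \<in> carrier R \<Longrightarrow> s \<in> S \<Longrightarrow> to_total_quotient R b \<otimes>\<^bsub>Q\<^esub> fr a s = fr (b \<otimes> a) s"
  by (simp add: to_total_quotient_def fraction_mult)

lemma clear_denominator:
  "a \<in> carrier R \<Longrightarrow> s \<in> S \<Longrightarrow> to_total_quotient R s \<otimes>\<^bsub>Q\<^esub> fr a s = to_total_quotient R a"
  by (simp add: to_total_quotient_mult_fraction) (simp add: to_total_quotient_def fraction_eq_iff m_comm)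

lemma total_quotient_module_eq:
  "total_quotient_module R = algebra_module Q (to_total_quotient R)"
  by (simp add: total_quotient_module_def algebra_module_def Let_def)

lemma total_quotient_module_module: "module R (total_quotient_module R)"
  unfolding total_quotient_module_eq
  by (rule algebra_module_module[OF is_cring total_quotient_cring to_total_quotient_hom])

end


section \<open>Tensor products and tensor powers\<close>

lemma pair_basis_vector_closed:
  "cring R \<Longrightarrow> x \<in> carrier M \<Longrightarrow> y \<in> carrier N \<Longrightarrow>
    basis_vector R (x, y) \<in> carrier (free_module R (carrier M \<times> carrier N))"
  by (rule basis_vector_closed) auto

lemma bilinear_relations_subset:
  assumes "module R M" "module R N"
  shows "bilinear_relations R M N \<subseteq> carrier (free_module R (carrier M \<times> carrier N))"
proof -
  interpret M: module R M by fact
  interpret N: module R N by fact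
  have cr: "cring R" by unfold_locales
  interpret F: module R "free_module R (carrier M \<times> carrier N)" by (rule free_module_module[OF cr])
  note e = pair_basis_vector_closed[OF cr]
  show ?thesis
    unfolding bilinear_relations_def Let_def
    by (auto intro!: F.minus_closed F.a_closed F.smult_closed e simp del: free_module_simps)
qed

lemma tensor_kernel_submodule:
  assumes "module R M" "module R N"
  shows "submodule (tensor_kernel R M N) R (free_module R (carrier M \<times> carrier N))"
  unfolding tensor_kernel_def
  by (rule submodule_span_submodule[OF free_module_module[OF module_cring[OF assms(1)]] bilinear_relations_subset[OF assms]])

lemma tensor_product_module:
  assumes "module R M" "module R N"
  shows "module R (tensor_product R M N)"
  unfolding tensor_product_def
  by (rule quotient_module_module[OF free_module_module[OF module_cring[OF assms(1)]] tensor_kernel_submodule[OF assms]])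

lemma tensor_coset_hom:
  assumes "module R M" "module R N"
  shows "(\<lambda>f. tensor_kernel R M N +>\<^bsub>free_module R (carrier M \<times> carrier N)\<^esub> f) \<in>
    module_hom R (free_module R (carrier M \<times> carrier N)) (tensor_product R M N)"
  unfolding tensor_product_def
  by (rule coset_map_hom[OF free_module_module[OF module_cring[OF assms(1)]] tensor_kernel_submodule[OF assms]])

lemma tensor_product_carrier:
  "carrier (tensor_product R M N) =
    (\<lambda>f. tensor_kernel R M N +>\<^bsub>free_module R (carrier M \<times> carrier N)\<^esub> f) `
      carrier (free_module R (carrier M \<times> carrier N))"
  by (simp add: tensor_product_def quotient_module_carrier)

lemma pure_tensor_closed:
  assumes "module R M" "module R N" "x \<in> carrier M" "y \<in> carrier N"
  shows "pure_tensor R M N x y \<in> carrier (tensor_product R M N)"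
  unfolding pure_tensor_def
  by (rule module_hom_closed[OF tensor_coset_hom[OF assms(1,2)] pair_basis_vector_closed[OF module_cring[OF assms(1)] assms(3,4)]])

lemma pure_tensor_hom:
  assumes "module R M" "module R N"
  shows "y \<in> carrier N \<Longrightarrow> (\<lambda>x. pure_tensor R M N x y) \<in> module_hom R M (tensor_product R M N)"
    and "x \<in> carrier M \<Longrightarrow> (\<lambda>y. pure_tensor R M N x y) \<in> module_hom R N (tensor_product R M N)"
proof -
  interpret M: module R M by fact
  interpret N: module R N by fact
  have cr: "cring R" by unfold_locales
  let ?F = "free_module R (carrier M \<times> carrier N)" and ?K = "tensor_kernel R M N"
  note F = free_module_module[OF cr, of "carrier M \<times> carrier N"]
  interpret F: module R ?F by (rule F)
  note e = pair_basis_vector_closed[OF cr]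
  note K = tensor_kernel_submodule[OF assms]
  note add = coset_add_eqI[OF F K, folded tensor_product_def]
    and smult = coset_smult_eqI[OF F K, folded tensor_product_def]
  have rel:
    "\<And>x x' y. x \<in> carrier M \<Longrightarrow> x' \<in> carrier M \<Longrightarrow> y \<in> carrier N \<Longrightarrow>
      basis_vector R (x \<oplus>\<^bsub>M\<^esub> x', y) \<ominus>\<^bsub>?F\<^esub> (basis_vector R (x, y) \<oplus>\<^bsub>?F\<^esub> basis_vector R (x', y))
        \<in> ?K"
    "\<And>x y y'. x \<in> carrier M \<Longrightarrow> y \<in> carrier N \<Longrightarrow> y' \<in> carrier N \<Longrightarrow>
      basis_vector R (x, y \<oplus>\<^bsub>N\<^esub> y') \<ominus>\<^bsub>?F\<^esub> (basis_vector R (x, y) \<oplus>\<^bsub>?F\<^esub> basis_vector R (x, y'))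
        \<in> ?K"
    "\<And>a x y. a \<in> carrier R \<Longrightarrow> x \<in> carrier M \<Longrightarrow> y \<in> carrier N \<Longrightarrow>
      basis_vector R (a \<odot>\<^bsub>M\<^esub> x, y) \<ominus>\<^bsub>?F\<^esub> a \<odot>\<^bsub>?F\<^esub> basis_vector R (x, y) \<in> ?K"
    "\<And>a x y. a \<in> carrier R \<Longrightarrow> x \<in> carrier M \<Longrightarrow> y \<in> carrier N \<Longrightarrow>
      basis_vector R (x, a \<odot>\<^bsub>N\<^esub> y) \<ominus>\<^bsub>?F\<^esub> a \<odot>\<^bsub>?F\<^esub> basis_vector R (x, y) \<in> ?K"
    unfolding tensor_kernel_def bilinear_relations_def Let_def
    by (rule subsetD[OF submodule_span_superset], blast)+
  show "(\<lambda>x. pure_tensor R M N x y) \<in> module_hom R M (tensor_product R M N)" if y: "y \<in> carrier N"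
    unfolding module_hom_iff
  proof (intro conjI ballI)
    fix x assume x: "x \<in> carrier M"
    show "pure_tensor R M N x y \<in> carrier (tensor_product R M N)"
      by (rule pure_tensor_closed[OF assms x y])
    show "pure_tensor R M N (x \<oplus>\<^bsub>M\<^esub> x') y =
        pure_tensor R M N x y \<oplus>\<^bsub>tensor_product R M N\<^esub> pure_tensor R M N x' y" if "x' \<in> carrier M" for x'
      unfolding pure_tensor_def using x y that by (intro add rel(1) e M.a_closed) auto
  next
    fix a x assume "a \<in> carrier R" "x \<in> carrier M"
    then show "pure_tensor R M N (a \<odot>\<^bsub>M\<^esub> x) y = a \<odot>\<^bsub>tensor_product R M N\<^esub> pure_tensor R M N x y"
      unfolding pure_tensor_def using y by (intro smult rel(3) e M.smult_closed)
  qed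
  show "(\<lambda>y. pure_tensor R M N x y) \<in> module_hom R N (tensor_product R M N)" if x: "x \<in> carrier M"
    unfolding module_hom_iff
  proof (intro conjI ballI)
    fix y assume y: "y \<in> carrier N"
    show "pure_tensor R M N x y \<in> carrier (tensor_product R M N)"
      by (rule pure_tensor_closed[OF assms x y])
    show "pure_tensor R M N x (y \<oplus>\<^bsub>N\<^esub> y') =
        pure_tensor R M N x y \<oplus>\<^bsub>tensor_product R M N\<^esub> pure_tensor R M N x y'" if "y' \<in> carrier N" for y'
      unfolding pure_tensor_def using x y that by (intro add rel(2) e N.a_closed) auto
  next
    fix a y assume "a \<in> carrier R" "y \<in> carrier N"
    then show "pure_tensor R M N x (a \<odot>\<^bsub>N\<^esub> y) = a \<odot>\<^bsub>tensor_product R M N\<^esub> pure_tensor R M N x y"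
      unfolding pure_tensor_def using x by (intro smult rel(4) e N.smult_closed)
  qed
qed

lemma tensor_product_generated:
  assumes "module R M" "module R N" "submodule H R (tensor_product R M N)"
    and "\<And>x y. x \<in> carrier M \<Longrightarrow> y \<in> carrier N \<Longrightarrow> pure_tensor R M N x y \<in> H"
    and "X \<in> carrier (tensor_product R M N)"
  shows "X \<in> H"
proof -
  interpret M: module R M by fact
  have cr: "cring R" by unfold_locales
  let ?F = "free_module R (carrier M \<times> carrier N)" and ?K = "tensor_kernel R M N"
  obtain f where f: "f \<in> carrier ?F" "X = ?K +>\<^bsub>?F\<^esub> f"
    using assms(5) by (auto simp: tensor_product_carrier)
  have "f \<in> {f \<in> carrier ?F. ?K +>\<^bsub>?F\<^esub> f \<in> H}"
  proof (rule free_module_generated[OF cr submodule_vimage[OF free_module_module[OF cr]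
          tensor_product_module[OF assms(1,2)] tensor_coset_hom[OF assms(1,2)] assms(3)] _ f(1)])
    show "basis_vector R z \<in> {f \<in> carrier ?F. ?K +>\<^bsub>?F\<^esub> f \<in> H}" if "z \<in> carrier M \<times> carrier N" for z
      using that assms(4)[of "fst z" "snd z"] basis_vector_closed[OF cr that]
      by (auto simp: pure_tensor_def)
  qed
  then show ?thesis using f(2) by simp
qed

lemma bilinear_relations_cases:
  assumes "f \<in> bilinear_relations R M N"
  obtains
    (add_left) x x' y where "x \<in> carrier M" "x' \<in> carrier M" "y \<in> carrier N"
      "f = basis_vector R (x \<oplus>\<^bsub>M\<^esub> x', y) \<ominus>\<^bsub>free_module R (carrier M \<times> carrier N)\<^esub>
        (basis_vector R (x, y) \<oplus>\<^bsub>free_module R (carrier M \<times> carrier N)\<^esub> basis_vector R (x', y))"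
  | (add_right) x y y' where "x \<in> carrier M" "y \<in> carrier N" "y' \<in> carrier N"
      "f = basis_vector R (x, y \<oplus>\<^bsub>N\<^esub> y') \<ominus>\<^bsub>free_module R (carrier M \<times> carrier N)\<^esub>
        (basis_vector R (x, y) \<oplus>\<^bsub>free_module R (carrier M \<times> carrier N)\<^esub> basis_vector R (x, y'))"
  | (smult_left) a x y where "a \<in> carrier R" "x \<in> carrier M" "y \<in> carrier N"
      "f = basis_vector R (a \<odot>\<^bsub>M\<^esub> x, y) \<ominus>\<^bsub>free_module R (carrier M \<times> carrier N)\<^esub>
        a \<odot>\<^bsub>free_module R (carrier M \<times> carrier N)\<^esub> basis_vector R (x, y)"
  | (smult_right) a x y where "a \<in> carrier R" "x \<in> carrier M" "y \<in> carrier N"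
      "f = basis_vector R (x, a \<odot>\<^bsub>N\<^esub> y) \<ominus>\<^bsub>free_module R (carrier M \<times> carrier N)\<^esub>
        a \<odot>\<^bsub>free_module R (carrier M \<times> carrier N)\<^esub> basis_vector R (x, y)"
  using assms unfolding bilinear_relations_def Let_def by blast

lemma tensor_product_universal:
  assumes "module R M" "module R N" "module R P"
    and left: "\<And>y. y \<in> carrier N \<Longrightarrow> (\<lambda>x. B x y) \<in> module_hom R M P"
    and right: "\<And>x. x \<in> carrier M \<Longrightarrow> (\<lambda>y. B x y) \<in> module_hom R N P"
  shows "\<exists>h \<in> module_hom R (tensor_product R M N) P.
    (\<forall>x\<in>carrier M. \<forall>y\<in>carrier N. h (pure_tensor R M N x y) = B x y) \<and>
    (\<forall>f\<in>carrier (free_module R (carrier M \<times> carrier N)).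
      h (tensor_kernel R M N +>\<^bsub>free_module R (carrier M \<times> carrier N)\<^esub> f) =
      linear_extension R P (\<lambda>z. B (fst z) (snd z)) f)"
proof -
  interpret M: module R M by fact
  interpret N: module R N by fact
  interpret P: module R P by fact
  have cr: "cring R" by unfold_locales
  let ?F = "free_module R (carrier M \<times> carrier N)" and ?\<phi> = "\<lambda>z. B (fst z) (snd z)"
  note F = free_module_module[OF cr, of "carrier M \<times> carrier N"]
  interpret F: module R ?F by (rule F)
  note e = pair_basis_vector_closed[OF cr]
  have \<phi>: "?\<phi> \<in> carrier M \<times> carrier N \<rightarrow> carrier P" using module_hom_closed[OF left] by auto
  let ?L = "linear_extension R P ?\<phi>"
  note L = linear_extension_hom[OF assms(3) \<phi>]
  have Le: "?L (basis_vector R (x, y)) = B x y" if "x \<in> carrier M" "y \<in> carrier N" for x y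
    using linear_extension_basis_vector[OF assms(3) \<phi>, of "(x, y)"] that by simp
  have B: "B x y \<in> carrier P" if "x \<in> carrier M" "y \<in> carrier N" for x y
    using module_hom_closed[OF left] that by blast
  note van = module_hom_minus_eq_zero[OF F assms(3) L]
  have "?L f = \<zero>\<^bsub>P\<^esub>" if "f \<in> bilinear_relations R M N" for f
    using that
  proof (cases rule: bilinear_relations_cases)
    case (add_left x x' y)
    show ?thesis unfolding add_left(4) using add_left(1-3)
      by (intro van) (simp_all add: e Le module_hom_add[OF L] module_hom_add[OF left] del: free_module_simps)
  next
    case (add_right x y y')
    show ?thesis unfolding add_right(4) using add_right(1-3)
      by (intro van) (simp_all add: e Le module_hom_add[OF L] module_hom_add[OF right] del: free_module_simps)
  next
    case (smult_left a x y)
    show ?thesis unfolding smult_left(4) using smult_left(1-3)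
      by (intro van) (simp_all add: e Le module_hom_smult[OF L] module_hom_smult[OF left] del: free_module_simps)
  next
    case (smult_right a x y)
    show ?thesis unfolding smult_right(4) using smult_right(1-3)
      by (intro van) (simp_all add: e Le module_hom_smult[OF L] module_hom_smult[OF right] del: free_module_simps)
  qed
  then obtain h where h: "h \<in> module_hom R (tensor_product R M N) P"
      "\<And>f. f \<in> carrier ?F \<Longrightarrow> h (tensor_kernel R M N +>\<^bsub>?F\<^esub> f) = ?L f"
    using quotient_of_free_universal[OF assms(3) \<phi> bilinear_relations_subset[OF assms(1,2)]]
    unfolding tensor_product_def tensor_kernel_def by blast
  then show ?thesis by (intro bexI[of _ h]) (auto simp: pure_tensor_def h(2)[OF e] Le)
qed


subsection \<open>Tensor powers\<close>

definition power_tensor ::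
  "('a, 'r) ring_scheme \<Rightarrow> nat \<Rightarrow> ('a, 'm, 'x) module_scheme \<Rightarrow> 'm list \<Rightarrow> ('m list \<Rightarrow> 'a) set" where
  "power_tensor R n M xs =
    submodule_span R (free_module R (tuples M n)) (multilinear_relations R n M)
      +>\<^bsub>free_module R (tuples M n)\<^esub> basis_vector R xs"

lemma tuples_update: "xs \<in> tuples M n \<Longrightarrow> x \<in> carrier M \<Longrightarrow> xs[i := x] \<in> tuples M n"
  using set_update_subset_insert[of xs i x] by (auto simp: tuples_def)

lemma tuples_nth: "xs \<in> tuples M n \<Longrightarrow> i < n \<Longrightarrow> xs ! i \<in> carrier M"
  by (auto simp: tuples_def)

lemma multilinear_relations_subset:
  assumes "module R M"
  shows "multilinear_relations R n M \<subseteq> carrier (free_module R (tuples M n))"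
proof -
  interpret M: module R M by fact
  have cr: "cring R" by unfold_locales
  interpret F: module R "free_module R (tuples M n)" by (rule free_module_module[OF cr])
  show ?thesis
    unfolding multilinear_relations_def Let_def
    by (auto intro!: F.minus_closed F.a_closed F.smult_closed basis_vector_closed[OF cr] tuples_update
        simp del: free_module_simps)
qed

lemma tensor_power_module:
  assumes "module R M"
  shows "module R (tensor_power R n M)"
  unfolding tensor_power_def Let_def
  by (intro quotient_module_module[OF free_module_module[OF module_cring[OF assms(1)]]]
  submodule_span_submodule[OF free_module_module[OF module_cring[OF assms(1)]] multilinear_relations_subset[OF assms]])

lemma power_tensor_closed:
  assumes "module R M" "xs \<in> tuples M n"
  shows "power_tensor R n M xs \<in> carrier (tensor_power R n M)"
  using basis_vector_closed[OF module_cring[OF assms(1)] assms(2)]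
  by (simp add: power_tensor_def tensor_power_def Let_def quotient_module_carrier)

lemma power_tensor_hom:
  assumes "module R M" "xs \<in> tuples M n" "i < n"
  shows "(\<lambda>x. power_tensor R n M (xs[i := x])) \<in> module_hom R M (tensor_power R n M)"
  unfolding module_hom_iff
proof (intro conjI ballI)
  interpret M: module R M by fact
  have cr: "cring R" by unfold_locales
  let ?F = "free_module R (tuples M n)"
  let ?K = "submodule_span R ?F (multilinear_relations R n M)"
  note F = free_module_module[OF cr, of "tuples M n"]
  interpret F: module R ?F by (rule F)
  note K = submodule_span_submodule[OF F multilinear_relations_subset[OF assms(1)]]
  have T: "tensor_power R n M = quotient_module R ?F ?K" by (simp add: tensor_power_def Let_def)
  have e: "basis_vector R (xs[i := x]) \<in> carrier ?F" if "x \<in> carrier M" for x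
    by (rule basis_vector_closed[OF cr tuples_update[OF assms(2) that]])
  fix x assume x: "x \<in> carrier M"
  show "power_tensor R n M (xs[i := x]) \<in> carrier (tensor_power R n M)"
    by (rule power_tensor_closed[OF assms(1) tuples_update[OF assms(2) x]])
  show "power_tensor R n M (xs[i := x \<oplus>\<^bsub>M\<^esub> y]) =
      power_tensor R n M (xs[i := x]) \<oplus>\<^bsub>tensor_power R n M\<^esub> power_tensor R n M (xs[i := y])"
    if y: "y \<in> carrier M" for y
  proof -
    have "basis_vector R (xs[i := x \<oplus>\<^bsub>M\<^esub> y]) \<ominus>\<^bsub>?F\<^esub>
        (basis_vector R (xs[i := x]) \<oplus>\<^bsub>?F\<^esub> basis_vector R (xs[i := y])) \<in> multilinear_relations R n M"
      unfolding multilinear_relations_def Let_def using assms(2,3) x y by blast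
    from coset_add_eqI[OF F K subsetD[OF submodule_span_superset this] e[OF M.a_closed[OF x y]] e[OF x] e[OF y]]
    show ?thesis unfolding power_tensor_def T .
  qed
  show "power_tensor R n M (xs[i := a \<odot>\<^bsub>M\<^esub> x]) = a \<odot>\<^bsub>tensor_power R n M\<^esub> power_tensor R n M (xs[i := x])"
    if a: "a \<in> carrier R" for a
  proof -
    have "basis_vector R (xs[i := a \<odot>\<^bsub>M\<^esub> x]) \<ominus>\<^bsub>?F\<^esub>
        a \<odot>\<^bsub>?F\<^esub> basis_vector R (xs[i := x]) \<in> multilinear_relations R n M"
      unfolding multilinear_relations_def Let_def using assms(2,3) x a by blast
    from coset_smult_eqI[OF F K subsetD[OF submodule_span_superset this] e[OF M.smult_closed[OF a x]] a e[OF x]]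
    show ?thesis unfolding power_tensor_def T .
  qed
qed

lemma nth_list_update_fun_upd: "i < length xs \<Longrightarrow> (!) (xs[i := x]) = ((!) xs)(i := x)"
  by (auto simp: fun_eq_iff)

lemma tensor_power_universal:
  assumes "module R M" "module R P" "multilinear R n M P \<phi>"
  shows "\<exists>h \<in> module_hom R (tensor_power R n M) P. \<forall>xs\<in>tuples M n. h (power_tensor R n M xs) = \<phi> ((!) xs)"
proof -
  interpret M: module R M by fact
  interpret P: module R P by fact
  have cr: "cring R" by unfold_locales
  let ?F = "free_module R (tuples M n)" and ?\<phi> = "\<lambda>xs. \<phi> ((!) xs)"
  note F = free_module_module[OF cr, of "tuples M n"]
  interpret F: module R ?F by (rule F)
  have \<phi>: "?\<phi> \<in> tuples M n \<rightarrow> carrier P"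
    using multilinear_closed[OF assms(3)] by (auto simp: tuples_nth)
  let ?L = "linear_extension R P ?\<phi>"
  note L = linear_extension_hom[OF assms(2) \<phi>]
  note Le = linear_extension_basis_vector[OF assms(2) \<phi>]
  have hom: "(\<lambda>x. ?\<phi> (xs[i := x])) \<in> module_hom R M P" if "xs \<in> tuples M n" "i < n" for xs i
    using multilinear_hom[OF assms(3), of "(!) xs" i] that tuples_nth[OF that(1)]
    by (auto simp: tuples_def nth_list_update_fun_upd)
  note van = module_hom_minus_eq_zero[OF F assms(2) L]
  have "?L f = \<zero>\<^bsub>P\<^esub>" if f: "f \<in> multilinear_relations R n M" for f
  proof -
    have e: "basis_vector R (xs[i := x]) \<in> carrier ?F" "?L (basis_vector R (xs[i := x])) = ?\<phi> (xs[i := x])"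
      if "xs \<in> tuples M n" "x \<in> carrier M" for xs i x
      using basis_vector_closed[OF cr tuples_update[OF that]] Le[OF tuples_update[OF that]] by auto
    from f consider
      (add) xs i x y where "xs \<in> tuples M n" "i < n" "x \<in> carrier M" "y \<in> carrier M"
        "f = basis_vector R (xs[i := x \<oplus>\<^bsub>M\<^esub> y]) \<ominus>\<^bsub>?F\<^esub>
          (basis_vector R (xs[i := x]) \<oplus>\<^bsub>?F\<^esub> basis_vector R (xs[i := y]))"
    | (smult) xs i a x where "xs \<in> tuples M n" "i < n" "a \<in> carrier R" "x \<in> carrier M"
        "f = basis_vector R (xs[i := a \<odot>\<^bsub>M\<^esub> x]) \<ominus>\<^bsub>?F\<^esub> a \<odot>\<^bsub>?F\<^esub> basis_vector R (xs[i := x])"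
      unfolding multilinear_relations_def Let_def by blast
    then show ?thesis
    proof cases
      case add
      show ?thesis unfolding add(5) using add(1-4)
        by (intro van) (simp_all add: e module_hom_add[OF L] module_hom_add[OF hom] del: free_module_simps)
    next
      case smult
      show ?thesis unfolding smult(5) using smult(1-4)
        by (intro van) (simp_all add: e module_hom_smult[OF L] module_hom_smult[OF hom] del: free_module_simps)
    qed
  qed
  then obtain h where "h \<in> module_hom R (tensor_power R n M) P"
      "\<And>f. f \<in> carrier ?F \<Longrightarrow>
        h (submodule_span R ?F (multilinear_relations R n M) +>\<^bsub>?F\<^esub> f) = ?L f"
    using quotient_of_free_universal[OF assms(2) \<phi> multilinear_relations_subset[OF assms(1)]]
    unfolding tensor_power_def Let_def by blast
  then show ?thesis
    using Le basis_vector_closed[OF cr, of _ "tuples M n"] by (intro bexI[of _ h]) (auto simp: power_tensor_def)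
qed


section \<open>Base change to the total quotient ring\<close>

lemma torsion_submodule_eq:
  "torsion_submodule R L =
    {x \<in> carrier L. to_quotient_base_change R L x = \<zero>\<^bsub>tensor_product R (total_quotient_module R) L\<^esub>}"
  by (simp add: torsion_submodule_def a_kernel_eq quotient_base_change_def Let_def)

lemma total_quotient_module_simps:
  "carrier (total_quotient_module R) = carrier (total_quotient_ring R)"
  "p \<oplus>\<^bsub>total_quotient_module R\<^esub> q = p \<oplus>\<^bsub>total_quotient_ring R\<^esub> q"
  "a \<odot>\<^bsub>total_quotient_module R\<^esub> q = to_total_quotient R a \<otimes>\<^bsub>total_quotient_ring R\<^esub> q"
  by (simp_all add: total_quotient_module_def Let_def)

locale base_change = module R L for R :: "('a, 'r) ring_scheme" (structure) and L (structure)
begin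

abbreviation QM where "QM \<equiv> total_quotient_module R"
abbreviation T where "T \<equiv> tensor_product R QM L"
abbreviation pure where "pure \<equiv> pure_tensor R QM L"
abbreviation \<iota> where "\<iota> \<equiv> to_quotient_base_change R L"
abbreviation toQ where "toQ \<equiv> to_total_quotient R"

lemma L: "module R L" by (rule module_axioms)
lemma QM: "module R QM" by (rule R.total_quotient_module_module)
lemma T: "module R T" by (rule tensor_product_module[OF QM L])

sublocale Q: cring "total_quotient_ring R" by (rule R.total_quotient_cring)
sublocale T: module R T by (rule T)

lemma toQ_closed [simp, intro]: "a \<in> carrier R \<Longrightarrow> toQ a \<in> carrier R.Q"
  by (rule ring_hom_closed[OF R.to_total_quotient_hom])

lemma \<iota>_hom: "\<iota> \<in> module_hom R L T"
  using pure_tensor_hom(2)[OF QM L, of "\<one>\<^bsub>R.Q\<^esub>"]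
  by (simp add: to_quotient_base_change_def[abs_def] total_quotient_module_simps)

lemma pure_closed [simp, intro]: "q \<in> carrier R.Q \<Longrightarrow> x \<in> carrier L \<Longrightarrow> pure q x \<in> carrier T"
  by (rule pure_tensor_closed[OF QM L]) (simp_all add: total_quotient_module_simps)

lemma pure_smult:
  assumes "q \<in> carrier R.Q" "x \<in> carrier L" "a \<in> carrier R"
  shows "pure (toQ a \<otimes>\<^bsub>R.Q\<^esub> q) x = a \<odot>\<^bsub>T\<^esub> pure q x" and "pure q (a \<odot>\<^bsub>L\<^esub> x) = a \<odot>\<^bsub>T\<^esub> pure q x"
  using module_hom_smult[OF pure_tensor_hom(1)[OF QM L], of x a q]
    module_hom_smult[OF pure_tensor_hom(2)[OF QM L], of q a x] assms
  by (simp_all add: total_quotient_module_simps)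

lemma pure_toQ:
  assumes "x \<in> carrier L" "a \<in> carrier R"
  shows "pure (toQ a) x = \<iota> (a \<odot>\<^bsub>L\<^esub> x)"
  using pure_smult[OF Q.one_closed assms] assms(2) by (simp add: to_quotient_base_change_def)

text \<open>\<open>1 \<otimes> x = (1 / s) \<otimes> s x = 0\<close>.\<close>

lemma torsionI:
  assumes "s \<in> R.S" "x \<in> carrier L" "s \<odot>\<^bsub>L\<^esub> x = \<zero>\<^bsub>L\<^esub>"
  shows "x \<in> torsion_submodule R L"
proof -
  have s: "s \<in> carrier R" using assms(1) by blast
  have "\<iota> x = pure (toQ s \<otimes>\<^bsub>R.Q\<^esub> R.fr \<one> s) x"
    using R.clear_denominator[OF R.one_closed assms(1)]
    by (simp add: to_quotient_base_change_def R.total_quotient_one to_total_quotient_def)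
  also have "\<dots> = pure (R.fr \<one> s) (s \<odot>\<^bsub>L\<^esub> x)"
    using pure_smult[OF R.fraction_closed[OF R.one_closed assms(1)] assms(2) s] by simp
  also have "\<dots> = \<zero>\<^bsub>T\<^esub>"
    unfolding assms(3)
    by (rule module_hom_zero[OF L T pure_tensor_hom(2)[OF QM L]])
      (simp add: total_quotient_module_simps assms(1))
  finally show ?thesis using assms(2) by (simp add: torsion_submodule_eq)
qed


subsection \<open>The kernel of the base change map\<close>

definition cleared where
  "cleared s = {q \<in> carrier R.Q. \<exists>a\<in>carrier R. toQ s \<otimes>\<^bsub>R.Q\<^esub> q = toQ a}"

text \<open>For \<open>q\<close> in \<open>cleared s\<close> this is \<open>s q\<close> as an element of \<open>R\<close>; elsewhere the value is arbitrary.\<close>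

definition numerator where
  "numerator s q = (SOME a. a \<in> carrier R \<and> toQ s \<otimes>\<^bsub>R.Q\<^esub> q = toQ a)"

lemma toQ_eq_iff: "a \<in> carrier R \<Longrightarrow> b \<in> carrier R \<Longrightarrow> toQ a = toQ b \<longleftrightarrow> a = b"
  by (simp add: to_total_quotient_def R.fraction_eq_iff)

lemma numerator:
  assumes "q \<in> cleared s"
  shows "numerator s q \<in> carrier R" "toQ s \<otimes>\<^bsub>R.Q\<^esub> q = toQ (numerator s q)"
  using someI_ex[of "\<lambda>a. a \<in> carrier R \<and> toQ s \<otimes>\<^bsub>R.Q\<^esub> q = toQ a"] assms
  by (auto simp: cleared_def numerator_def)

lemma numerator_eqI:
  assumes "q \<in> carrier R.Q" "a \<in> carrier R" "toQ s \<otimes>\<^bsub>R.Q\<^esub> q = toQ a"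
  shows "q \<in> cleared s" "numerator s q = a"
proof -
  show q: "q \<in> cleared s" using assms by (auto simp: cleared_def)
  show "numerator s q = a" using numerator[OF q] assms by (simp add: toQ_eq_iff)
qed

lemma cleared_closed: "q \<in> cleared s \<Longrightarrow> q \<in> carrier R.Q"
  by (simp add: cleared_def)

lemma numerator_add:
  assumes "s \<in> R.S" "p \<in> cleared s" "q \<in> cleared s"
  shows "p \<oplus>\<^bsub>R.Q\<^esub> q \<in> cleared s" "numerator s (p \<oplus>\<^bsub>R.Q\<^esub> q) = numerator s p \<oplus> numerator s q"
proof -
  have "toQ s \<otimes>\<^bsub>R.Q\<^esub> (p \<oplus>\<^bsub>R.Q\<^esub> q) = toQ (numerator s p \<oplus> numerator s q)"
    using assms cleared_closed numerator
    by (simp add: Q.r_distr ring_hom_add[OF R.to_total_quotient_hom] R.nonzerodivisors_closed)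
  from numerator_eqI[OF _ _ this]
  show "p \<oplus>\<^bsub>R.Q\<^esub> q \<in> cleared s" "numerator s (p \<oplus>\<^bsub>R.Q\<^esub> q) = numerator s p \<oplus> numerator s q"
    using assms cleared_closed numerator by auto
qed

lemma numerator_smult:
  assumes "s \<in> R.S" "q \<in> cleared s" "a \<in> carrier R"
  shows "toQ a \<otimes>\<^bsub>R.Q\<^esub> q \<in> cleared s" "numerator s (toQ a \<otimes>\<^bsub>R.Q\<^esub> q) = a \<otimes> numerator s q"
proof -
  have "toQ s \<otimes>\<^bsub>R.Q\<^esub> (toQ a \<otimes>\<^bsub>R.Q\<^esub> q) = toQ a \<otimes>\<^bsub>R.Q\<^esub> (toQ s \<otimes>\<^bsub>R.Q\<^esub> q)"
    using assms cleared_closed by (intro Q.m_lcomm) auto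
  also have "\<dots> = toQ (a \<otimes> numerator s q)"
    using assms numerator by (simp add: ring_hom_mult[OF R.to_total_quotient_hom])
  finally have eq: "toQ s \<otimes>\<^bsub>R.Q\<^esub> (toQ a \<otimes>\<^bsub>R.Q\<^esub> q) = toQ (a \<otimes> numerator s q)" .
  from numerator_eqI[OF _ _ this]
  show "toQ a \<otimes>\<^bsub>R.Q\<^esub> q \<in> cleared s" "numerator s (toQ a \<otimes>\<^bsub>R.Q\<^esub> q) = a \<otimes> numerator s q"
    using assms cleared_closed numerator by auto
qed

lemma numerator_scale:
  assumes "s \<in> R.S" "t \<in> R.S" "q \<in> cleared s"
  shows "q \<in> cleared (t \<otimes> s)" "numerator (t \<otimes> s) q = t \<otimes> numerator s q"
proof -
  have "toQ (t \<otimes> s) \<otimes>\<^bsub>R.Q\<^esub> q = toQ (t \<otimes> numerator s q)"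
    using assms cleared_closed numerator
    by (simp add: ring_hom_mult[OF R.to_total_quotient_hom] Q.m_assoc R.nonzerodivisors_closed)
  from numerator_eqI[OF _ _ this]
  show "q \<in> cleared (t \<otimes> s)" "numerator (t \<otimes> s) q = t \<otimes> numerator s q"
    using assms cleared_closed numerator by auto
qed

lemma exists_clearing:
  assumes "q \<in> carrier R.Q"
  obtains s where "s \<in> R.S" "q \<in> cleared s"
proof -
  obtain a s where "a \<in> carrier R" "s \<in> R.S" "q = R.fr a s" using assms by (rule R.fraction_cases)
  then show ?thesis using numerator_eqI(1)[OF assms _ ] R.clear_denominator that by blast
qed

text \<open>For a fixed denominator \<open>s\<close> the formal sums of pairs \<open>(q, x)\<close> with \<open>s q\<close> in \<open>R\<close> are mapped
  linearly to \<open>L\<close> by \<open>(q, x) \<mapsto> (s q) x\<close>. A formal sum representing \<open>0\<close> in the tensor product is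
  killed by one of these maps, as this holds for each of the bilinear relations and a change of
  denominator multiplies the value by an element of \<open>S\<close>. These maps take the place of a map to the
  localization of \<open>L\<close>.\<close>

definition ev where
  "ev s = linear_extension R L (\<lambda>z. numerator s (fst z) \<odot>\<^bsub>L\<^esub> snd z)"

abbreviation cleared_pairs where "cleared_pairs s \<equiv> free_module R (cleared s \<times> carrier L)"
abbreviation pairs where "pairs \<equiv> free_module R (carrier QM \<times> carrier L)"

lemma ev_hom: "ev s \<in> module_hom R (cleared_pairs s) L"
  unfolding ev_def using numerator(1) by (intro linear_extension_hom[OF L]) auto

lemma ev_basis_vector:
  "q \<in> cleared s \<Longrightarrow> x \<in> carrier L \<Longrightarrow> ev s (basis_vector R (q, x)) = numerator s q \<odot>\<^bsub>L\<^esub> x"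
  unfolding ev_def using numerator(1)
  by (subst linear_extension_basis_vector[OF L, of _ "cleared s \<times> carrier L"]) auto

lemma cleared_pairs_subset: "f \<in> carrier (cleared_pairs s) \<Longrightarrow> f \<in> carrier pairs"
  by (rule free_module_mono[OF R.is_cring])
    (auto simp: total_quotient_module_simps cleared_closed)

lemma cleared_pairs_scale:
  assumes "s \<in> R.S" "t \<in> R.S" "f \<in> carrier (cleared_pairs s)"
  shows "f \<in> carrier (cleared_pairs (t \<otimes> s))" "ev (t \<otimes> s) f = t \<odot>\<^bsub>L\<^esub> ev s f"
proof -
  show "f \<in> carrier (cleared_pairs (t \<otimes> s))"
    using assms(3) numerator_scale(1)[OF assms(1,2)] free_module_closed[OF R.is_cring assms(3)]
    by (auto simp: free_module_carrier)
  have "ev (t \<otimes> s) \<in> module_hom R (cleared_pairs s) L"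
    unfolding ev_def using numerator(1) numerator_scale(1)[OF assms(1,2)]
    by (intro linear_extension_hom[OF L]) auto
  moreover have "(\<lambda>f. t \<odot>\<^bsub>L\<^esub> ev s f) \<in> module_hom R (cleared_pairs s) L"
    by (rule module_hom_compose[OF ev_hom smult_hom[OF L]]) (use assms(2) in auto)
  moreover have "ev (t \<otimes> s) (basis_vector R z) = t \<odot>\<^bsub>L\<^esub> ev s (basis_vector R z)"
    if z: "z \<in> cleared s \<times> carrier L" for z
    using z assms(2) numerator_scale[OF assms(1,2), of "fst z"] numerator(1)[of "fst z" s]
    by (cases z) (auto simp: ev_basis_vector smult_assoc1)
  ultimately show "ev (t \<otimes> s) f = t \<odot>\<^bsub>L\<^esub> ev s f"
    by (rule free_module_hom_eqI[OF L _ _ _ assms(3)])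
qed

definition vanishing where
  "vanishing = {f. \<exists>s\<in>R.S. f \<in> carrier (cleared_pairs s) \<and> ev s f = \<zero>\<^bsub>L\<^esub>}"

lemma cleared_pairs_module: "module R (cleared_pairs s)"
  by (rule free_module_module[OF R.is_cring])

lemma vanishing_submodule: "submodule vanishing R pairs"
proof -
  interpret F: module R pairs by (rule free_module_module[OF R.is_cring])
  show ?thesis
  proof (rule F.submodule_intro)
    show "vanishing \<subseteq> carrier pairs" using cleared_pairs_subset by (auto simp: vanishing_def)
    have "\<zero>\<^bsub>cleared_pairs \<one>\<^esub> \<in> carrier (cleared_pairs \<one>)"
      by (auto simp: free_module_carrier)
    then show "\<zero>\<^bsub>pairs\<^esub> \<in> vanishing"
      using module_hom_zero[OF cleared_pairs_module L ev_hom, of \<one>] R.nonzerodivisors_one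
      by (auto simp: vanishing_def)
    fix f g assume "f \<in> vanishing" "g \<in> vanishing"
    then obtain s t where st: "s \<in> R.S" "f \<in> carrier (cleared_pairs s)" "ev s f = \<zero>\<^bsub>L\<^esub>"
        "t \<in> R.S" "g \<in> carrier (cleared_pairs t)" "ev t g = \<zero>\<^bsub>L\<^esub>" by (auto simp: vanishing_def)
    interpret C: module R "cleared_pairs (t \<otimes> s)" by (rule cleared_pairs_module)
    have f: "f \<in> carrier (cleared_pairs (t \<otimes> s))" "ev (t \<otimes> s) f = \<zero>\<^bsub>L\<^esub>"
      using cleared_pairs_scale[OF st(1,4,2)] st by auto
    have "g \<in> carrier (cleared_pairs (s \<otimes> t))" "ev (s \<otimes> t) g = \<zero>\<^bsub>L\<^esub>"
      using cleared_pairs_scale[OF st(4,1,5)] st by auto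
    then have g: "g \<in> carrier (cleared_pairs (t \<otimes> s))" "ev (t \<otimes> s) g = \<zero>\<^bsub>L\<^esub>"
      using R.m_comm[of s t] st by auto
    have "f \<oplus>\<^bsub>cleared_pairs (t \<otimes> s)\<^esub> g \<in> carrier (cleared_pairs (t \<otimes> s))" by (rule C.a_closed[OF f(1) g(1)])
    moreover have "ev (t \<otimes> s) (f \<oplus>\<^bsub>cleared_pairs (t \<otimes> s)\<^esub> g) = \<zero>\<^bsub>L\<^esub>"
      using module_hom_add[OF ev_hom f(1) g(1)] f g by simp
    ultimately show "f \<oplus>\<^bsub>pairs\<^esub> g \<in> vanishing" using st by (auto simp: vanishing_def)
  next
    fix a f assume a: "a \<in> carrier R" and "f \<in> vanishing"
    then obtain s where s: "s \<in> R.S" "f \<in> carrier (cleared_pairs s)" "ev s f = \<zero>\<^bsub>L\<^esub>"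
      by (auto simp: vanishing_def)
    interpret C: module R "cleared_pairs s" by (rule cleared_pairs_module)
    have "ev s (a \<odot>\<^bsub>cleared_pairs s\<^esub> f) = \<zero>\<^bsub>L\<^esub>" using module_hom_smult[OF ev_hom a s(2)] s(3) a by simp
    then show "a \<odot>\<^bsub>pairs\<^esub> f \<in> vanishing"
      using s C.smult_closed[OF a s(2)] by (auto simp: vanishing_def)
  qed
qed

lemma vanishingI:
  assumes "s \<in> R.S" "f \<in> carrier (cleared_pairs s)" "g \<in> carrier (cleared_pairs s)" "ev s f = ev s g"
  shows "f \<ominus>\<^bsub>pairs\<^esub> g \<in> vanishing"
proof -
  interpret C: module R "cleared_pairs s" by (rule cleared_pairs_module)
  have "f \<ominus>\<^bsub>pairs\<^esub> g = f \<ominus>\<^bsub>cleared_pairs s\<^esub> g"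
    using cleared_pairs_subset assms(2,3) by (simp add: free_module_minus[OF R.is_cring])
  moreover have "ev s (f \<ominus>\<^bsub>cleared_pairs s\<^esub> g) = \<zero>\<^bsub>L\<^esub>"
    using module_hom_minus[OF cleared_pairs_module L ev_hom assms(2,3)] module_hom_closed[OF ev_hom assms(3)] assms(4)
    by (simp add: M.minus_eq_zero_iff)
  ultimately show ?thesis using assms(1) C.minus_closed[OF assms(2,3)] by (auto simp: vanishing_def)
qed

lemma tensor_kernel_vanishing: "tensor_kernel R QM L \<subseteq> vanishing"
  unfolding tensor_kernel_def
proof (rule submodule_span_least[OF vanishing_submodule], rule subsetI)
  have e: "basis_vector R (q, x) \<in> carrier (cleared_pairs s)" if "q \<in> cleared s" "x \<in> carrier L" for q x s
    using that by (intro basis_vector_closed[OF R.is_cring]) auto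
  fix f assume "f \<in> bilinear_relations R QM L"
  then show "f \<in> vanishing"
  proof (cases rule: bilinear_relations_cases)
    case (add_left p q x)
    obtain s t where st: "s \<in> R.S" "p \<in> cleared s" "t \<in> R.S" "q \<in> cleared t"
      using add_left(1,2) exists_clearing by (metis total_quotient_module_simps(1))
    have pq: "p \<in> cleared (t \<otimes> s)" "q \<in> cleared (t \<otimes> s)" "t \<otimes> s \<in> R.S"
      using numerator_scale(1)[OF st(1,3,2)] numerator_scale(1)[OF st(3,1,4)] R.m_comm[of s t] st by auto
    interpret C: module R "cleared_pairs (t \<otimes> s)" by (rule cleared_pairs_module)
    have "ev (t \<otimes> s) (basis_vector R (p \<oplus>\<^bsub>R.Q\<^esub> q, x)) =
        ev (t \<otimes> s) (basis_vector R (p, x) \<oplus>\<^bsub>cleared_pairs (t \<otimes> s)\<^esub> basis_vector R (q, x))"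
      using pq add_left(3) numerator_add[OF pq(3,1,2)] numerator(1)[OF pq(1)] numerator(1)[OF pq(2)]
      by (simp add: module_hom_add[OF ev_hom] e ev_basis_vector smult_l_distr del: free_module_simps)
    from vanishingI[OF pq(3) _ _ this]
    show ?thesis unfolding add_left(4)
      using pq add_left(3) numerator_add(1)[OF pq(3,1,2)] C.a_closed[OF e[OF pq(1)] e[OF pq(2)]] e
      by (simp add: total_quotient_module_simps)
  next
    case (add_right q x y)
    obtain s where s: "s \<in> R.S" "q \<in> cleared s"
      using add_right(1) exists_clearing by (metis total_quotient_module_simps(1))
    interpret C: module R "cleared_pairs s" by (rule cleared_pairs_module)
    have "ev s (basis_vector R (q, x \<oplus>\<^bsub>L\<^esub> y)) =
        ev s (basis_vector R (q, x) \<oplus>\<^bsub>cleared_pairs s\<^esub> basis_vector R (q, y))"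
      using s add_right(2,3) numerator(1)[OF s(2)]
      by (simp add: module_hom_add[OF ev_hom] e ev_basis_vector smult_r_distr del: free_module_simps)
    from vanishingI[OF s(1) _ _ this]
    show ?thesis unfolding add_right(4)
      using s add_right(2,3) C.a_closed[OF e[OF s(2)] e[OF s(2)]] e by simp
  next
    case (smult_left a q x)
    obtain s where s: "s \<in> R.S" "q \<in> cleared s"
      using smult_left(2) exists_clearing by (metis total_quotient_module_simps(1))
    interpret C: module R "cleared_pairs s" by (rule cleared_pairs_module)
    have "ev s (basis_vector R (toQ a \<otimes>\<^bsub>R.Q\<^esub> q, x)) = ev s (a \<odot>\<^bsub>cleared_pairs s\<^esub> basis_vector R (q, x))"
      using s smult_left(1,3) numerator(1)[OF s(2)] numerator_smult[OF s smult_left(1)]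
      by (simp add: module_hom_smult[OF ev_hom] e ev_basis_vector smult_assoc1 del: free_module_simps)
    from vanishingI[OF s(1) _ _ this]
    show ?thesis unfolding smult_left(4)
      using s smult_left(1,3) numerator_smult(1)[OF s smult_left(1)] C.smult_closed[OF _ e[OF s(2)]] e
      by (simp add: total_quotient_module_simps)
  next
    case (smult_right a q x)
    obtain s where s: "s \<in> R.S" "q \<in> cleared s"
      using smult_right(2) exists_clearing by (metis total_quotient_module_simps(1))
    interpret C: module R "cleared_pairs s" by (rule cleared_pairs_module)
    have "numerator s q \<odot>\<^bsub>L\<^esub> (a \<odot>\<^bsub>L\<^esub> x) = a \<odot>\<^bsub>L\<^esub> (numerator s q \<odot>\<^bsub>L\<^esub> x)"
      using smult_right(1,3) numerator(1)[OF s(2)] by (simp add: smult_assoc1[symmetric] R.m_comm)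
    then have "ev s (basis_vector R (q, a \<odot>\<^bsub>L\<^esub> x)) = ev s (a \<odot>\<^bsub>cleared_pairs s\<^esub> basis_vector R (q, x))"
      using s smult_right(1,3)
      by (simp add: module_hom_smult[OF ev_hom] e ev_basis_vector del: free_module_simps)
    from vanishingI[OF s(1) _ _ this]
    show ?thesis unfolding smult_right(4)
      using s smult_right(1,3) C.smult_closed[OF _ e[OF s(2)]] e by simp
  qed
qed

lemma \<iota>_eq_zero:
  assumes "x \<in> carrier L" "\<iota> x = \<zero>\<^bsub>T\<^esub>"
  obtains u where "u \<in> R.S" "u \<odot>\<^bsub>L\<^esub> x = \<zero>\<^bsub>L\<^esub>"
proof -
  have F: "module R pairs" by (rule free_module_module[OF R.is_cring])
  have e: "basis_vector R (\<one>\<^bsub>R.Q\<^esub>, x) \<in> carrier pairs"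
    using assms(1) by (intro basis_vector_closed[OF R.is_cring]) (auto simp: total_quotient_module_simps)
  have "basis_vector R (\<one>\<^bsub>R.Q\<^esub>, x) \<in> tensor_kernel R QM L"
    using assms(2) coset_eq_zero_iff[OF F tensor_kernel_submodule[OF QM L] e]
    by (simp add: to_quotient_base_change_def pure_tensor_def tensor_product_def)
  then obtain s where s: "s \<in> R.S" "basis_vector R (\<one>\<^bsub>R.Q\<^esub>, x) \<in> carrier (cleared_pairs s)"
      "ev s (basis_vector R (\<one>\<^bsub>R.Q\<^esub>, x)) = \<zero>\<^bsub>L\<^esub>"
    using tensor_kernel_vanishing by (auto simp: vanishing_def)
  have one: "\<one>\<^bsub>R.Q\<^esub> \<in> cleared s" "numerator s \<one>\<^bsub>R.Q\<^esub> = s"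
    using s(1) by (auto intro: numerator_eqI)
  have "s \<odot>\<^bsub>L\<^esub> x = \<zero>\<^bsub>L\<^esub>" using s(3) ev_basis_vector[OF one(1) assms(1)] one(2) by simp
  then show ?thesis using s(1) that by blast
qed

end


subsection \<open>Modules with a rank\<close>

context base_change
begin

lemma tensor_hom_eqI:
  assumes "module R P" "g \<in> module_hom R T P" "h \<in> module_hom R T P"
    and "\<And>q x. q \<in> carrier R.Q \<Longrightarrow> x \<in> carrier L \<Longrightarrow> g (pure q x) = h (pure q x)"
    and "X \<in> carrier T"
  shows "g X = h X"
proof -
  interpret P: module R P by fact
  note d = minus_hom[OF T assms(1-3)]
  have "X \<in> {X \<in> carrier T. g X \<ominus>\<^bsub>P\<^esub> h X \<in> {\<zero>\<^bsub>P\<^esub>}}"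
  proof (rule tensor_product_generated[OF QM L submodule_vimage[OF T assms(1) d submodule_zero[OF assms(1)]] _ assms(5)])
    fix q x assume "q \<in> carrier QM" "x \<in> carrier L"
    then have qx: "q \<in> carrier R.Q" "x \<in> carrier L" by (simp_all add: total_quotient_module_simps)
    then show "pure q x \<in> {X \<in> carrier T. g X \<ominus>\<^bsub>P\<^esub> h X \<in> {\<zero>\<^bsub>P\<^esub>}}"
      using module_hom_closed[OF assms(2) pure_closed[OF qx]] module_hom_closed[OF assms(3) pure_closed[OF qx]]
        assms(4)[OF qx] pure_closed[OF qx]
      by (simp add: P.minus_eq_zero_iff)
  qed
  then show ?thesis
    using module_hom_closed[OF assms(2,5)] module_hom_closed[OF assms(3,5)] by (simp add: P.minus_eq_zero_iff)
qed

abbreviation BC where "BC \<equiv> quotient_base_change R L"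

lemma base_change_simps:
  "carrier BC = carrier T" "\<zero>\<^bsub>BC\<^esub> = \<zero>\<^bsub>T\<^esub>" "finsum BC = finsum T"
  by (simp_all add: quotient_base_change_def Let_def finsum_def finprod_def fun_eq_iff)

text \<open>On a class of formal sums the scalar multiplication by \<open>q\<close> is given by the linear map that the
  universal property provides, and so it is independent of the representative.\<close>

lemma base_change_smult:
  assumes q: "q \<in> carrier R.Q"
  obtains h where "h \<in> module_hom R T T" "\<And>X. X \<in> carrier T \<Longrightarrow> q \<odot>\<^bsub>BC\<^esub> X = h X"
    "\<And>p x. p \<in> carrier R.Q \<Longrightarrow> x \<in> carrier L \<Longrightarrow> h (pure p x) = pure (q \<otimes>\<^bsub>R.Q\<^esub> p) x"
proof -
  let ?B = "\<lambda>p x. pure (q \<otimes>\<^bsub>R.Q\<^esub> p) x"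
  have qhom: "(\<lambda>p. q \<otimes>\<^bsub>R.Q\<^esub> p) \<in> module_hom R QM QM"
    using q by (simp add: module_hom_iff total_quotient_module_simps Q.r_distr Q.m_lcomm)
  have left: "(\<lambda>p. ?B p x) \<in> module_hom R QM T" if "x \<in> carrier L" for x
    by (rule module_hom_compose[OF qhom pure_tensor_hom(1)[OF QM L that]])
  have right: "(\<lambda>x. ?B p x) \<in> module_hom R L T" if "p \<in> carrier QM" for p
    by (rule pure_tensor_hom(2)[OF QM L]) (use q that in \<open>simp add: total_quotient_module_simps\<close>)
  obtain h where h: "h \<in> module_hom R T T"
      "\<And>p x. p \<in> carrier QM \<Longrightarrow> x \<in> carrier L \<Longrightarrow> h (pure p x) = ?B p x"
      "\<And>f. f \<in> carrier pairs \<Longrightarrow> h (tensor_kernel R QM L +>\<^bsub>pairs\<^esub> f) =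
        linear_extension R T (\<lambda>z. ?B (fst z) (snd z)) f"
    using tensor_product_universal[OF QM L T, of ?B, OF left right] by auto
  have F: "module R pairs" by (rule free_module_module[OF R.is_cring])
  interpret K: abelian_subgroup "tensor_kernel R QM L" pairs
    by (rule submodule_abelian_subgroup[OF F tensor_kernel_submodule[OF QM L]])
  have "q \<odot>\<^bsub>BC\<^esub> X = h X" if X: "X \<in> carrier T" for X
  proof -
    obtain f where f: "f \<in> carrier pairs" "X = tensor_kernel R QM L +>\<^bsub>pairs\<^esub> f"
      using X by (auto simp: tensor_product_carrier)
    have eq: "linear_extension R T (\<lambda>z. ?B (fst z) (snd z)) g = h X" if "g \<in> X" for g
    proof -
      have g: "g \<in> tensor_kernel R QM L +>\<^bsub>pairs\<^esub> f" using that f(2) by simp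
      show ?thesis
        unfolding f(2) K.a_repr_independence'[OF g f(1)]
        by (rule h(3)[OF K.a_elemrcos_carrier[OF f(1) g], symmetric])
    qed
    have ne: "f \<in> X" unfolding f(2) by (rule K.a_rcos_self[OF f(1)])
    have "q \<odot>\<^bsub>BC\<^esub> X = (\<Union>g\<in>X. linear_extension R T (\<lambda>z. ?B (fst z) (snd z)) g)"
      by (simp add: quotient_base_change_def Let_def linear_extension_def)
    also have "\<dots> = (\<Union>g\<in>X. h X)" using eq by simp
    also have "\<dots> = h X" using ne by auto
    finally show ?thesis .
  qed
  then show ?thesis using that[OF h(1)] h(2) by (simp add: total_quotient_module_simps)
qed

lemma base_change_smult_clear:
  assumes "a \<in> carrier R" "t \<in> R.S" "X \<in> carrier T"
  shows "R.fr a t \<odot>\<^bsub>BC\<^esub> X \<in> carrier T" "t \<odot>\<^bsub>T\<^esub> (R.fr a t \<odot>\<^bsub>BC\<^esub> X) = a \<odot>\<^bsub>T\<^esub> X"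
proof -
  let ?q = "R.fr a t"
  have q: "?q \<in> carrier R.Q" using assms by blast
  obtain h where h: "h \<in> module_hom R T T" "\<And>X. X \<in> carrier T \<Longrightarrow> ?q \<odot>\<^bsub>BC\<^esub> X = h X"
    "\<And>p x. p \<in> carrier R.Q \<Longrightarrow> x \<in> carrier L \<Longrightarrow> h (pure p x) = pure (?q \<otimes>\<^bsub>R.Q\<^esub> p) x"
    using base_change_smult[OF q] by blast
  have t: "t \<in> carrier R" using assms(2) by blast
  show "?q \<odot>\<^bsub>BC\<^esub> X \<in> carrier T" using h(2)[OF assms(3)] module_hom_closed[OF h(1) assms(3)] by simp
  have "t \<odot>\<^bsub>T\<^esub> h X = a \<odot>\<^bsub>T\<^esub> X"
  proof (rule tensor_hom_eqI[OF T module_hom_compose[OF h(1) smult_hom[OF T t]] smult_hom[OF T assms(1)] _ assms(3)])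
    fix p x assume px: "p \<in> carrier R.Q" "x \<in> carrier L"
    have "t \<odot>\<^bsub>T\<^esub> h (pure p x) = pure (toQ t \<otimes>\<^bsub>R.Q\<^esub> (?q \<otimes>\<^bsub>R.Q\<^esub> p)) x"
      using h(3)[OF px] pure_smult(1)[OF _ px(2) t, of "?q \<otimes>\<^bsub>R.Q\<^esub> p"] px q by simp
    also have "toQ t \<otimes>\<^bsub>R.Q\<^esub> (?q \<otimes>\<^bsub>R.Q\<^esub> p) = toQ a \<otimes>\<^bsub>R.Q\<^esub> p"
      using px q t by (simp add: Q.m_assoc[symmetric] R.clear_denominator[OF assms(1,2)])
    also have "pure (toQ a \<otimes>\<^bsub>R.Q\<^esub> p) x = a \<odot>\<^bsub>T\<^esub> pure p x" by (rule pure_smult(1)[OF px assms(1)])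
    finally show "t \<odot>\<^bsub>T\<^esub> h (pure p x) = a \<odot>\<^bsub>T\<^esub> pure p x" .
  qed
  then show "t \<odot>\<^bsub>T\<^esub> (?q \<odot>\<^bsub>BC\<^esub> X) = a \<odot>\<^bsub>T\<^esub> X" using h(2)[OF assms(3)] by simp
qed

lemma base_change_smult_toQ:
  assumes "a \<in> carrier R" "X \<in> carrier T"
  shows "toQ a \<odot>\<^bsub>BC\<^esub> X = a \<odot>\<^bsub>T\<^esub> X"
  using base_change_smult_clear[OF assms(1) R.nonzerodivisors_one assms(2)]
  by (simp add: to_total_quotient_def)

text \<open>As these sets are submodules, properties that hold up to a denominator can be verified on
  generators.\<close>

definition saturation where
  "saturation N = {X \<in> carrier T. \<exists>s\<in>R.S. \<exists>y\<in>N. s \<odot>\<^bsub>T\<^esub> X = \<iota> y}"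

lemma saturation_submodule:
  assumes N: "submodule N R L"
  shows "submodule (saturation N) R T"
proof (rule T.submodule_intro)
  note NL = submodule_subset[OF N] and ih = module_hom_smult[OF \<iota>_hom]
  show "saturation N \<subseteq> carrier T" by (auto simp: saturation_def)
  have "\<one> \<odot>\<^bsub>T\<^esub> \<zero>\<^bsub>T\<^esub> = \<iota> \<zero>\<^bsub>L\<^esub>" using module_hom_zero[OF L T \<iota>_hom] by simp
  then show "\<zero>\<^bsub>T\<^esub> \<in> saturation N"
    using submodule_zero_closed[OF N] R.nonzerodivisors_one T.zero_closed unfolding saturation_def by blast
  show "X \<oplus>\<^bsub>T\<^esub> Y \<in> saturation N" if XY: "X \<in> saturation N" "Y \<in> saturation N" for X Y
  proof -
    obtain s x t y where *: "X \<in> carrier T" "s \<in> R.S" "x \<in> N" "s \<odot>\<^bsub>T\<^esub> X = \<iota> x"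
      "Y \<in> carrier T" "t \<in> R.S" "y \<in> N" "t \<odot>\<^bsub>T\<^esub> Y = \<iota> y"
      using XY by (auto simp: saturation_def)
    have st: "s \<in> carrier R" "t \<in> carrier R" using * by auto
    have "(t \<otimes> s) \<odot>\<^bsub>T\<^esub> X = \<iota> (t \<odot>\<^bsub>L\<^esub> x)"
      using * st NL by (simp add: T.smult_assoc1 ih)
    moreover have "(t \<otimes> s) \<odot>\<^bsub>T\<^esub> Y = \<iota> (s \<odot>\<^bsub>L\<^esub> y)"
      using * st NL by (simp add: R.m_comm[of t s] T.smult_assoc1 ih)
    ultimately have "(t \<otimes> s) \<odot>\<^bsub>T\<^esub> (X \<oplus>\<^bsub>T\<^esub> Y) = \<iota> (t \<odot>\<^bsub>L\<^esub> x \<oplus>\<^bsub>L\<^esub> s \<odot>\<^bsub>L\<^esub> y)"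
      using * st NL by (simp add: T.smult_r_distr module_hom_add[OF \<iota>_hom])
    moreover have "t \<odot>\<^bsub>L\<^esub> x \<oplus>\<^bsub>L\<^esub> s \<odot>\<^bsub>L\<^esub> y \<in> N"
      using * st by (intro submodule_add_closed[OF N] submodule_smult_closed[OF N])
    moreover have "t \<otimes> s \<in> R.S" "X \<oplus>\<^bsub>T\<^esub> Y \<in> carrier T" using * by auto
    ultimately show ?thesis unfolding saturation_def by blast
  qed
  show "a \<odot>\<^bsub>T\<^esub> X \<in> saturation N" if a: "a \<in> carrier R" and X: "X \<in> saturation N" for a X
  proof -
    obtain s x where *: "X \<in> carrier T" "s \<in> R.S" "x \<in> N" "s \<odot>\<^bsub>T\<^esub> X = \<iota> x"
      using X by (auto simp: saturation_def)
    have "s \<odot>\<^bsub>T\<^esub> (a \<odot>\<^bsub>T\<^esub> X) = a \<odot>\<^bsub>T\<^esub> (s \<odot>\<^bsub>T\<^esub> X)"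
      using * a by (intro T.smult_commute) auto
    also have "\<dots> = \<iota> (a \<odot>\<^bsub>L\<^esub> x)" using * a NL by (simp add: ih)
    finally have "s \<odot>\<^bsub>T\<^esub> (a \<odot>\<^bsub>T\<^esub> X) = \<iota> (a \<odot>\<^bsub>L\<^esub> x)" .
    moreover have "a \<odot>\<^bsub>L\<^esub> x \<in> N" by (rule submodule_smult_closed[OF N a *(3)])
    ultimately show ?thesis using * a T.smult_closed unfolding saturation_def by blast
  qed
qed

lemma saturation_carrier:
  assumes "X \<in> carrier T"
  shows "X \<in> saturation (carrier L)"
proof (rule tensor_product_generated[OF QM L saturation_submodule[OF carrier_is_submodule] _ assms])
  fix q x assume "q \<in> carrier QM" and x: "x \<in> carrier L"
  then have q: "q \<in> carrier R.Q" by (simp add: total_quotient_module_simps)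
  then obtain a s where as: "a \<in> carrier R" "s \<in> R.S" "q = R.fr a s" by (rule R.fraction_cases)
  have s: "s \<in> carrier R" using as(2) by blast
  have "s \<odot>\<^bsub>T\<^esub> pure q x = pure (toQ s \<otimes>\<^bsub>R.Q\<^esub> q) x"
    by (rule pure_smult(1)[OF q x s, symmetric])
  also have "\<dots> = \<iota> (a \<odot>\<^bsub>L\<^esub> x)"
    using R.clear_denominator[OF as(1,2)] as(3) pure_toQ[OF x as(1)] by simp
  finally have "s \<odot>\<^bsub>T\<^esub> pure q x = \<iota> (a \<odot>\<^bsub>L\<^esub> x)" .
  moreover have "a \<odot>\<^bsub>L\<^esub> x \<in> carrier L" using as(1) x by blast
  ultimately show "pure q x \<in> saturation (carrier L)"
    using as(2) pure_closed[OF q x] unfolding saturation_def by blast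
qed

text \<open>Up to torsion and denominators, a module of rank \<open>r\<close> is free on \<open>r\<close> of its elements: these are the
  members of a basis of the base change, multiplied by denominators so that they come from the module.\<close>

lemma has_rank_witness:
  assumes "has_rank R L r"
  obtains m :: "nat \<Rightarrow> 'b" where "m \<in> {..<r} \<rightarrow> carrier L"
    "\<And>f. f \<in> carrier (free_module R {..<r}) \<Longrightarrow> linear_extension R L m f = \<zero>\<^bsub>L\<^esub> \<Longrightarrow>
      f = \<zero>\<^bsub>free_module R {..<r}\<^esub>"
    "\<And>x. x \<in> carrier L \<Longrightarrow> \<exists>s\<in>R.S. s \<odot>\<^bsub>L\<^esub> x \<in> submodule_span R L (m ` {..<r})"
proof -
  let ?lc = "linear_combination R.Q BC"
  obtain B where B: "finite B" "card B = r" "B \<subseteq> carrier T"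
    and bij: "bij_betw ?lc (carrier (free_module R.Q B)) (carrier T)"
    using assms by (auto simp: has_rank_def is_free_of_rank_def is_basis_def base_change_simps)
  obtain e where e: "bij_betw e {..<r} B"
    using ex_bij_betw_nat_finite[OF B(1)] B(2) by (auto simp: atLeast0LessThan)
  have eT: "e j \<in> carrier T" if "j < r" for j using bij_betwE[OF e] that B(3) by auto
  have "\<exists>s x. s \<in> R.S \<and> x \<in> carrier L \<and> s \<odot>\<^bsub>T\<^esub> e j = \<iota> x" if "j < r" for j
    using saturation_carrier[OF eT[OF that]] by (auto simp: saturation_def)
  then obtain s m where sm: "\<And>j. j < r \<Longrightarrow> s j \<in> R.S \<and> m j \<in> carrier L \<and> s j \<odot>\<^bsub>T\<^esub> e j = \<iota> (m j)"
    by metis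
  have m: "m \<in> {..<r} \<rightarrow> carrier L" using sm by auto
  have mL: "m ` {..<r} \<subseteq> carrier L" using sm by auto
  let ?N = "submodule_span R L (m ` {..<r})"
  note N = submodule_span_submodule[OF L mL]
  have "f = \<zero>\<^bsub>free_module R {..<r}\<^esub>"
    if f: "f \<in> carrier (free_module R {..<r})" and f0: "linear_extension R L m f = \<zero>\<^bsub>L\<^esub>" for f
  proof -
    have fR: "f j \<in> carrier R" for j by (rule free_module_closed[OF R.is_cring f])
    define g where "g x = (if x \<in> B then toQ (f (inv_into {..<r} e x) \<otimes> s (inv_into {..<r} e x)) else \<zero>\<^bsub>R.Q\<^esub>)" for x
    have ge: "g (e j) = toQ (f j \<otimes> s j)" if "j < r" for j
      using that e bij_betwE[OF e] by (auto simp: g_def bij_betw_inv_into_left)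
    have gB: "g x = \<zero>\<^bsub>R.Q\<^esub>" if "x \<notin> B" for x using that by (simp add: g_def)
    have gQ: "g x \<in> carrier R.Q" for x
    proof (cases "x \<in> B")
      case True
      then obtain j where "j < r" "x = e j" using bij_betw_imp_surj_on[OF e] by auto
      then show ?thesis using ge sm fR by auto
    qed (simp add: gB)
    have g: "g \<in> carrier (free_module R.Q B)"
      using gQ gB B(1) by (simp add: free_module_carrier_finite)
    have z: "(\<lambda>x. \<zero>\<^bsub>R.Q\<^esub>) \<in> carrier (free_module R.Q B)"
      using B(1) by (simp add: free_module_carrier_finite)
    have summand: "g (e j) \<odot>\<^bsub>BC\<^esub> e j = \<iota> (f j \<odot>\<^bsub>L\<^esub> m j)" if j: "j < r" for j
    proof -
      have sj: "s j \<in> carrier R" "m j \<in> carrier L" using sm[OF j] by auto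
      have "g (e j) \<odot>\<^bsub>BC\<^esub> e j = (f j \<otimes> s j) \<odot>\<^bsub>T\<^esub> e j"
        unfolding ge[OF j] using fR sj eT[OF j] by (intro base_change_smult_toQ) auto
      also have "\<dots> = f j \<odot>\<^bsub>T\<^esub> \<iota> (m j)" using sm[OF j] fR sj eT[OF j] by (simp add: T.smult_assoc1)
      also have "\<dots> = \<iota> (f j \<odot>\<^bsub>L\<^esub> m j)" using fR sj by (simp add: module_hom_smult[OF \<iota>_hom])
      finally show ?thesis .
    qed
    have summand_closed: "g x \<odot>\<^bsub>BC\<^esub> x \<in> carrier T" if "x \<in> B" for x
    proof -
      obtain j where j: "j < r" "x = e j" using bij_betw_imp_surj_on[OF e] \<open>x \<in> B\<close> by auto
      have "\<iota> (f j \<odot>\<^bsub>L\<^esub> m j) \<in> carrier T"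
        using sm[OF j(1)] fR by (intro module_hom_closed[OF \<iota>_hom]) auto
      then show ?thesis using summand[OF j(1)] j(2) by simp
    qed
    have zero_summand: "\<zero>\<^bsub>R.Q\<^esub> \<odot>\<^bsub>BC\<^esub> x = \<zero>\<^bsub>T\<^esub>" if "x \<in> carrier T" for x
      using base_change_smult_toQ[OF R.zero_closed that] that
      by (simp add: R.total_quotient_zero to_total_quotient_def)
    have "?lc g = (\<Oplus>\<^bsub>T\<^esub>x\<in>{x. g x \<noteq> \<zero>\<^bsub>R.Q\<^esub>}. g x \<odot>\<^bsub>BC\<^esub> x)"
      by (simp add: linear_combination_def base_change_simps)
    also have "\<dots> = (\<Oplus>\<^bsub>T\<^esub>x\<in>B. g x \<odot>\<^bsub>BC\<^esub> x)"
      using B gB zero_summand summand_closed by (intro T.add.finprod_mono_neutral_cong_left) auto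
    also have "\<dots> = (\<Oplus>\<^bsub>T\<^esub>x\<in>e ` {..<r}. g x \<odot>\<^bsub>BC\<^esub> x)" by (simp only: bij_betw_imp_surj_on[OF e])
    also have "\<dots> = (\<Oplus>\<^bsub>T\<^esub>j\<in>{..<r}. g (e j) \<odot>\<^bsub>BC\<^esub> e j)"
      using e summand_closed by (intro T.finsum_reindex) (auto simp: bij_betw_def)
    also have "\<dots> = (\<Oplus>\<^bsub>T\<^esub>j\<in>{..<r}. \<iota> (f j \<odot>\<^bsub>L\<^esub> m j))"
      using summand sm fR by (intro T.finsum_cong') (auto intro!: module_hom_closed[OF \<iota>_hom])
    also have "\<dots> = \<iota> (\<Oplus>\<^bsub>L\<^esub>j\<in>{..<r}. f j \<odot>\<^bsub>L\<^esub> m j)"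
      using sm fR by (intro module_hom_finsum[OF L T \<iota>_hom, symmetric]) auto
    also have "\<dots> = \<zero>\<^bsub>T\<^esub>"
      using linear_extension_finite[OF L _ m f] f0 module_hom_zero[OF L T \<iota>_hom] by simp
    also have "\<dots> = ?lc (\<lambda>x. \<zero>\<^bsub>R.Q\<^esub>)" by (simp add: linear_combination_def base_change_simps)
    finally have "g = (\<lambda>x. \<zero>\<^bsub>R.Q\<^esub>)"
      using bij_betw_imp_inj_on[OF bij] g z by (simp add: inj_on_def)
    then have "f j = \<zero>" if j: "j < r" for j
    proof -
      have sj: "s j \<in> R.S" "s j \<in> carrier R" using sm[OF j] by auto
      have "toQ (f j \<otimes> s j) = toQ \<zero>"
        using \<open>g = (\<lambda>x. \<zero>\<^bsub>R.Q\<^esub>)\<close> ge[OF j] by (simp add: R.total_quotient_zero to_total_quotient_def)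
      then have "s j \<otimes> f j = \<zero>" using sj fR toQ_eq_iff[of "f j \<otimes> s j" \<zero>] by (simp add: R.m_comm)
      then show ?thesis using R.nonzerodivisors_cancel_zero[OF sj(1) fR] by simp
    qed
    then show ?thesis using f by (auto simp: free_module_carrier)
  qed
  moreover have "\<exists>u\<in>R.S. u \<odot>\<^bsub>L\<^esub> x \<in> ?N" if x: "x \<in> carrier L" for x
  proof -
    note H = saturation_submodule[OF N]
    have ix: "\<iota> x \<in> carrier T" by (rule module_hom_closed[OF \<iota>_hom x])
    then have "\<iota> x \<in> ?lc ` carrier (free_module R.Q B)" by (simp only: bij_betw_imp_surj_on[OF bij])
    then obtain g where g: "g \<in> carrier (free_module R.Q B)" "?lc g = \<iota> x" by (elim imageE) simp
    have "g y \<odot>\<^bsub>BC\<^esub> y \<in> saturation ?N" if y: "g y \<noteq> \<zero>\<^bsub>R.Q\<^esub>" for y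
    proof -
      have yB: "y \<in> B" using y g(1) by (auto simp: free_module_carrier)
      then obtain j where j: "j < r" "y = e j" using bij_betw_imp_surj_on[OF e] by auto
      have "g y \<in> carrier R.Q" using g(1) yB by (auto simp: free_module_carrier)
      then obtain a t where at: "a \<in> carrier R" "t \<in> R.S" "g y = R.fr a t" by (rule R.fraction_cases)
      have sj: "s j \<in> R.S" "s j \<in> carrier R" "m j \<in> carrier L" "s j \<odot>\<^bsub>T\<^esub> e j = \<iota> (m j)"
        using sm[OF j(1)] by auto
      have t: "t \<in> carrier R" using at(2) by blast
      note c = base_change_smult_clear[OF at(1,2) eT[OF j(1)]]
      have "(s j \<otimes> t) \<odot>\<^bsub>T\<^esub> (g y \<odot>\<^bsub>BC\<^esub> y) = s j \<odot>\<^bsub>T\<^esub> (a \<odot>\<^bsub>T\<^esub> e j)"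
        using c sj t by (simp add: at(3)[unfolded j(2)] j(2) T.smult_assoc1)
      also have "\<dots> = a \<odot>\<^bsub>T\<^esub> \<iota> (m j)"
        using T.smult_commute[OF sj(2) at(1) eT[OF j(1)]] sj(4) by simp
      also have "\<dots> = \<iota> (a \<odot>\<^bsub>L\<^esub> m j)" using at(1) sj by (simp add: module_hom_smult[OF \<iota>_hom])
      finally have "(s j \<otimes> t) \<odot>\<^bsub>T\<^esub> (g y \<odot>\<^bsub>BC\<^esub> y) = \<iota> (a \<odot>\<^bsub>L\<^esub> m j)" .
      moreover have "a \<odot>\<^bsub>L\<^esub> m j \<in> ?N"
        using submodule_span_superset[of "m ` {..<r}" R L] j(1) by (intro submodule_smult_closed[OF N at(1)]) auto
      moreover have "s j \<otimes> t \<in> R.S" using sj(1) at(2) by blast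
      moreover have "g y \<odot>\<^bsub>BC\<^esub> y \<in> carrier T" using c(1) at(3)[unfolded j(2)] j(2) by simp
      ultimately show ?thesis unfolding saturation_def by blast
    qed
    then have "(\<Oplus>\<^bsub>T\<^esub>y\<in>{y. g y \<noteq> \<zero>\<^bsub>R.Q\<^esub>}. g y \<odot>\<^bsub>BC\<^esub> y) \<in> saturation ?N"
      by (intro submodule_finsum_closed[OF T H]) auto
    then have "\<iota> x \<in> saturation ?N" using g(2) by (simp add: linear_combination_def base_change_simps)
    then obtain s' y where y: "s' \<in> R.S" "y \<in> ?N" "s' \<odot>\<^bsub>T\<^esub> \<iota> x = \<iota> y" by (auto simp: saturation_def)
    have s': "s' \<in> carrier R" and yL: "y \<in> carrier L" using y submodule_subset[OF N] by auto
    have "\<iota> (s' \<odot>\<^bsub>L\<^esub> x \<ominus>\<^bsub>L\<^esub> y) = \<zero>\<^bsub>T\<^esub>"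
      using y(3) x s' yL module_hom_closed[OF \<iota>_hom yL]
      by (simp add: module_hom_minus[OF L T \<iota>_hom] module_hom_smult[OF \<iota>_hom] T.minus_eq_zero_iff)
    then obtain u where u: "u \<in> R.S" "u \<odot>\<^bsub>L\<^esub> (s' \<odot>\<^bsub>L\<^esub> x \<ominus>\<^bsub>L\<^esub> y) = \<zero>\<^bsub>L\<^esub>"
      using \<iota>_eq_zero[of "s' \<odot>\<^bsub>L\<^esub> x \<ominus>\<^bsub>L\<^esub> y"] x s' yL by auto
    have uR: "u \<in> carrier R" using u(1) by blast
    have "(u \<otimes> s') \<odot>\<^bsub>L\<^esub> x = u \<odot>\<^bsub>L\<^esub> y"
      using u(2) x s' yL uR module_hom_minus[OF L L smult_hom[OF L uR], of "s' \<odot>\<^bsub>L\<^esub> x" y]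
      by (simp add: smult_assoc1 minus_eq_zero_iff)
    then have "(u \<otimes> s') \<odot>\<^bsub>L\<^esub> x \<in> ?N" using submodule_smult_closed[OF N uR y(2)] by simp
    then show ?thesis using u(1) y(1) by blast
  qed
  ultimately show ?thesis using that m by blast
qed

end


section \<open>Rank and number of generators\<close>

text \<open>The hypothesis \<open>1 \<noteq> 0\<close> makes the members of an independent family distinct, so that the family can be
  replaced by its set of members.\<close>

lemma is_freeI:
  assumes "module R M" "\<one>\<^bsub>R\<^esub> \<noteq> \<zero>\<^bsub>R\<^esub>" "x \<in> {..<r::nat} \<rightarrow> carrier M" "generating_set R M (x ` {..<r})"
    and indep: "\<And>f. f \<in> carrier (free_module R {..<r}) \<Longrightarrow> linear_extension R M x f = \<zero>\<^bsub>M\<^esub> \<Longrightarrow>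
      f = \<zero>\<^bsub>free_module R {..<r}\<^esub>"
  shows "is_free R M"
proof -
  interpret M: module R M by fact
  have cr: "cring R" by unfold_locales
  let ?F = "free_module R {..<r}" and ?B = "x ` {..<r}"
  note F = free_module_module[OF cr, of "{..<r}"] and FB = free_module_module[OF cr, of ?B]
  note L = linear_extension_hom[OF assms(1,3)]
  have inj: "inj_on (linear_extension R M x) (carrier ?F)"
    by (rule module_hom_inj_onI[OF F assms(1) L indep])
  have inj_x: "inj_on x {..<r}"
  proof (rule inj_onI, rule ccontr)
    fix i j assume ij: "i \<in> {..<r}" "j \<in> {..<r}" "x i = x j" "i \<noteq> j"
    have "basis_vector R i = basis_vector R j"
      using linear_extension_basis_vector[OF assms(1,3)] ij
      by (intro inj_onD[OF inj] basis_vector_closed[OF cr]) auto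
    then have "basis_vector R i i = basis_vector R j i" by simp
    then show False using ij(4) assms(2) by (simp add: basis_vector_def)
  qed
  have BM: "(\<lambda>y. y) \<in> ?B \<rightarrow> carrier M" using assms(3) by auto
  have lc: "linear_combination R M = linear_extension R M (\<lambda>y. y)"
    by (simp add: fun_eq_iff linear_combination_def linear_extension_def)
  note LB = linear_extension_hom[OF assms(1) BM]
  have "inj_on (linear_combination R M) (carrier (free_module R ?B))"
    unfolding lc
  proof (rule module_hom_inj_onI[OF FB assms(1) LB])
    fix f assume f: "f \<in> carrier (free_module R ?B)" "linear_extension R M (\<lambda>y. y) f = \<zero>\<^bsub>M\<^esub>"
    let ?g = "\<lambda>i. if i < r then f (x i) else \<zero>\<^bsub>R\<^esub>"
    note fR = free_module_closed[OF cr f(1)]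
    have g: "?g \<in> carrier ?F" using fR by (simp add: free_module_carrier_finite)
    have "linear_extension R M x ?g = (\<Oplus>\<^bsub>M\<^esub>i\<in>{..<r}. ?g i \<odot>\<^bsub>M\<^esub> x i)"
      by (rule linear_extension_finite[OF assms(1) _ assms(3) g]) simp
    also have "\<dots> = (\<Oplus>\<^bsub>M\<^esub>i\<in>{..<r}. f (x i) \<odot>\<^bsub>M\<^esub> x i)"
      using assms(3) fR by (intro M.finsum_cong') auto
    also have "\<dots> = (\<Oplus>\<^bsub>M\<^esub>y\<in>?B. f y \<odot>\<^bsub>M\<^esub> y)"
      using assms(3) fR inj_x by (intro M.finsum_reindex[symmetric]) auto
    also have "\<dots> = \<zero>\<^bsub>M\<^esub>"
      using linear_extension_finite[OF assms(1) _ BM f(1)] f(2) by simp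
    finally have "?g = (\<lambda>i. \<zero>\<^bsub>R\<^esub>)" using indep[OF g] by simp
    then have fx: "f (x i) = \<zero>\<^bsub>R\<^esub>" if "i < r" for i using that fun_cong[of ?g _ i] by simp
    have "f y = \<zero>\<^bsub>R\<^esub>" for y
      using f(1) fx by (cases "y \<in> ?B") (auto simp: free_module_carrier)
    then show "f = \<zero>\<^bsub>free_module R ?B\<^esub>" by auto
  qed
  moreover have "linear_combination R M ` carrier (free_module R ?B) = carrier M"
    unfolding lc using linear_extension_image[OF assms(1) BM] assms(4) by (simp add: generating_set_def)
  ultimately have "is_basis R M ?B"
    using BM by (auto simp: is_basis_def bij_betw_def)
  then show ?thesis by (auto simp: is_free_def)
qed

text \<open>A common denominator for finitely many generators is one for all elements.\<close>

lemma common_denominator: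
  assumes "module R M" "finitely_generated R M" "submodule N R M"
    and den: "\<And>x. x \<in> carrier M \<Longrightarrow> \<exists>s\<in>nonzerodivisors R. s \<odot>\<^bsub>M\<^esub> x \<in> N"
  obtains s where "s \<in> nonzerodivisors R" "\<And>x. x \<in> carrier M \<Longrightarrow> s \<odot>\<^bsub>M\<^esub> x \<in> N"
proof -
  interpret M: module R M by fact
  obtain A where A: "finite A" "generating_set R M A" using assms(2) by (auto simp: finitely_generated_def)
  have "\<exists>s\<in>nonzerodivisors R. \<forall>x\<in>A. s \<odot>\<^bsub>M\<^esub> x \<in> N"
    using A(1) generating_set_subset[OF A(2)]
  proof (induction A rule: finite_induct)
    case empty
    then show ?case using M.nonzerodivisors_one by blast
  next
    case (insert a A)
    then obtain s where s: "s \<in> nonzerodivisors R" "\<forall>x\<in>A. s \<odot>\<^bsub>M\<^esub> x \<in> N" by auto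
    obtain t where t: "t \<in> nonzerodivisors R" "t \<odot>\<^bsub>M\<^esub> a \<in> N" using den insert.prems by blast
    have st: "s \<in> carrier R" "t \<in> carrier R" using s t by auto
    have "(t \<otimes>\<^bsub>R\<^esub> s) \<odot>\<^bsub>M\<^esub> x \<in> N" if "x \<in> A" for x
      using submodule_smult_closed[OF assms(3) st(2), of "s \<odot>\<^bsub>M\<^esub> x"] s(2) that st insert.prems
      by (auto simp: M.smult_assoc1)
    moreover have "(t \<otimes>\<^bsub>R\<^esub> s) \<odot>\<^bsub>M\<^esub> a \<in> N"
      using submodule_smult_closed[OF assms(3) st(1) t(2)] st insert.prems
      by (simp add: M.smult_assoc1 M.smult_commute)
    ultimately show ?case using M.nonzerodivisors_mult[OF t(1) s(1)] by blast
  qed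
  then obtain s where s: "s \<in> nonzerodivisors R" "\<forall>x\<in>A. s \<odot>\<^bsub>M\<^esub> x \<in> N" by blast
  have sR: "s \<in> carrier R" using s(1) by blast
  have "x \<in> {x \<in> carrier M. s \<odot>\<^bsub>M\<^esub> x \<in> N}" if "x \<in> carrier M" for x
    using s(2) generating_set_subset[OF A(2)] that
    by (intro generating_setD[OF A(2) submodule_vimage[OF assms(1,1) smult_hom[OF assms(1) sR] assms(3)]]) auto
  then show ?thesis using that s(1) by blast
qed

text \<open>Suppose that at most \<open>r\<close> elements generate \<open>M\<close>, and add zeros to have \<open>r\<close> generators \<open>x'\<^sub>i\<close>. Let \<open>a\<^sub>i\<close> in
  \<open>R\<^sup>r\<close> be the coordinates of \<open>s x'\<^sub>i\<close> with respect to the \<open>m\<^sub>j\<close>. As the \<open>x'\<^sub>i\<close> generate \<open>M\<close>, the span of the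
  \<open>a\<^sub>i\<close> contains the multiples \<open>s e\<^sub>j\<close> of the unit vectors, whose determinant is \<open>s\<^sup>r\<close>. A relation between
  the \<open>x'\<^sub>i\<close> is a relation between the \<open>a\<^sub>i\<close>, hence its coefficients annihilate \<open>s\<^sup>r\<close> and are \<open>0\<close>. Thus \<open>M\<close>
  would be free.\<close>

lemma rank_less_number_of_generators:
  assumes "module R M" "\<one>\<^bsub>R\<^esub> \<noteq> \<zero>\<^bsub>R\<^esub>" "\<not> is_free R M"
    and m: "m \<in> {..<r} \<rightarrow> carrier M"
    and indep: "\<And>f. f \<in> carrier (free_module R {..<r}) \<Longrightarrow> linear_extension R M m f = \<zero>\<^bsub>M\<^esub> \<Longrightarrow>
      f = \<zero>\<^bsub>free_module R {..<r}\<^esub>"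
    and s: "s \<in> nonzerodivisors R" "\<And>x. x \<in> carrier M \<Longrightarrow> s \<odot>\<^bsub>M\<^esub> x \<in> submodule_span R M (m ` {..<r})"
    and gen: "generating_set R M (x ` {..<k})"
  shows "r < (k::nat)"
proof (rule ccontr)
  assume "\<not> r < k"
  then have kr: "k \<le> r" by simp
  interpret M: module R M by fact
  have cr: "cring R" by unfold_locales
  let ?F = "free_module R {..<r}" and ?R = "algebra_module R (\<lambda>a. a)"
  note F = free_module_module[OF cr, of "{..<r}"] and RR = self_module[OF cr]
  interpret F: module R ?F by (rule F)
  let ?\<Lambda> = "linear_extension R M m"
  note \<Lambda> = linear_extension_hom[OF assms(1) m]
  have \<Lambda>_inj: "inj_on ?\<Lambda> (carrier ?F)" by (rule module_hom_inj_onI[OF F assms(1) \<Lambda> indep])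
  have sR: "s \<in> carrier R" using s(1) by blast
  define x' where "x' i = (if i < k then x i else \<zero>\<^bsub>M\<^esub>)" for i
  have xM: "x i \<in> carrier M" if "i < k" for i using generating_set_subset[OF gen] that by auto
  have x'M: "x' i \<in> carrier M" for i using xM by (simp add: x'_def)
  have gen': "generating_set R M (x' ` {..<r})"
  proof (rule generating_setI[OF assms(1)])
    show "x' ` {..<r} \<subseteq> carrier M" using x'M by auto
    fix H assume H: "submodule H R M" "x' ` {..<r} \<subseteq> H"
    have "x i \<in> H" if "i < k" for i
    proof -
      have "x' i \<in> H" using H(2) that kr by auto
      then show ?thesis using that by (simp add: x'_def)
    qed
    then have "x ` {..<k} \<subseteq> H" by auto
    then show "carrier M \<subseteq> H" using generating_setD[OF gen H(1)] by blast
  qed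
  have "\<exists>f. f \<in> carrier ?F \<and> ?\<Lambda> f = s \<odot>\<^bsub>M\<^esub> x' i" for i
  proof -
    have "s \<odot>\<^bsub>M\<^esub> x' i \<in> ?\<Lambda> ` carrier ?F"
      unfolding linear_extension_image[OF assms(1) m] by (rule s(2)[OF x'M])
    then show ?thesis by (elim imageE) auto
  qed
  then obtain a where a: "\<And>i. a i \<in> carrier ?F" "\<And>i. ?\<Lambda> (a i) = s \<odot>\<^bsub>M\<^esub> x' i" by metis
  let ?G = "submodule_span R ?F (a ` {..<r})"
  have aF: "a ` {..<r} \<subseteq> carrier ?F" using a(1) by auto
  note G = submodule_span_submodule[OF F aF]
  define z where "z i = s \<odot>\<^bsub>?F\<^esub> basis_vector R i" for i
  have e: "basis_vector R i \<in> carrier ?F" if "i < r" for i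
    using basis_vector_closed[OF cr, of i "{..<r}"] that by simp
  have zF: "z i \<in> carrier ?F" if "i < r" for i
    unfolding z_def by (rule F.smult_closed[OF sR e[OF that]])
  have zG: "z j \<in> ?G" if j: "j < r" for j
  proof -
    have sub: "submodule {y \<in> carrier M. s \<odot>\<^bsub>M\<^esub> y \<in> ?\<Lambda> ` ?G} R M"
      by (rule submodule_vimage[OF assms(1,1) smult_hom[OF assms(1) sR] submodule_image[OF F assms(1) \<Lambda> G]])
    have "x' i \<in> {y \<in> carrier M. s \<odot>\<^bsub>M\<^esub> y \<in> ?\<Lambda> ` ?G}" if "i < r" for i
    proof -
      have "a i \<in> ?G" using that submodule_span_superset[of "a ` {..<r}" R ?F] by auto
      then have "?\<Lambda> (a i) \<in> ?\<Lambda> ` ?G" by (rule imageI)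
      then show ?thesis using x'M a(2) by simp
    qed
    then have "m j \<in> {y \<in> carrier M. s \<odot>\<^bsub>M\<^esub> y \<in> ?\<Lambda> ` ?G}"
      using m j by (intro generating_setD[OF gen' sub]) auto
    then obtain g where g: "g \<in> ?G" "s \<odot>\<^bsub>M\<^esub> m j = ?\<Lambda> g" by auto
    have "?\<Lambda> (z j) = ?\<Lambda> g"
      using module_hom_smult[OF \<Lambda> sR e[OF j]] linear_extension_basis_vector[OF assms(1) m] j g(2)
      by (simp add: z_def del: free_module_simps)
    then have "z j = g" using inj_onD[OF \<Lambda>_inj] zF[OF j] submodule_subset[OF G g(1)] by blast
    then show ?thesis using g(1) by simp
  qed
  let ?\<phi> = "\<lambda>z. \<Otimes>\<^bsub>R\<^esub>i\<in>{..<r}. z i i"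
  have mult: "multilinear R r ?F ?R ?\<phi>"
    by (rule multilinear_product[OF F cr _ coordinate_hom[OF cr]]) (simp add: ring_hom_def)
  let ?D = "antisymmetrization r ?R ?\<phi>"
  have alt: "alternating R r ?F ?R ?D" by (rule antisymmetrization_alternating[OF F RR mult])
  have zR: "z j i \<in> carrier R" if "j < r" for i j
    using free_module_closed[OF cr zF[OF that]] .
  have "?\<phi> (z \<circ> \<sigma>) = \<zero>\<^bsub>?R\<^esub>" if \<sigma>: "\<sigma> permutes {..<r}" "\<sigma> \<noteq> id" for \<sigma>
  proof -
    obtain i where i: "i < r" "\<sigma> i \<noteq> i" using permutes_moves[OF \<sigma>] by blast
    then have "z (\<sigma> i) i = \<zero>\<^bsub>R\<^esub>" using sR by (simp add: z_def basis_vector_def)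
    then have "?\<phi> (z \<circ> \<sigma>) = \<zero>\<^bsub>R\<^esub>"
      using i(1) zR permutes_lessThan[OF \<sigma>(1)] by (intro M.finprod_zero_factor[of _ i]) auto
    then show ?thesis by simp
  qed
  then have "?D z = ?\<phi> z"
    using zR by (intro antisymmetrization_eq[OF RR]) (auto intro!: M.finprod_closed)
  also have "?\<phi> z = (\<Otimes>\<^bsub>R\<^esub>i\<in>{..<r}. s)"
    using sR by (intro M.finprod_cong') (auto simp: z_def basis_vector_def)
  also have "\<dots> = s [^]\<^bsub>R\<^esub> r" using M.finprod_const[OF sR, of "{..<r}"] by simp
  finally have Dz: "?D z = s [^]\<^bsub>R\<^esub> r" .
  have x': "x' \<in> {..<r} \<rightarrow> carrier M" using x'M by auto
  have "f = \<zero>\<^bsub>?F\<^esub>" if f: "f \<in> carrier ?F" and f0: "linear_extension R M x' f = \<zero>\<^bsub>M\<^esub>" for f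
  proof -
    have fR: "f i \<in> carrier R" for i by (rule free_module_closed[OF cr f])
    let ?v = "\<Oplus>\<^bsub>?F\<^esub>i\<in>{..<r}. f i \<odot>\<^bsub>?F\<^esub> a i"
    have fa: "(\<lambda>i. f i \<odot>\<^bsub>?F\<^esub> a i) \<in> {..<r} \<rightarrow> carrier ?F"
      by (intro funcsetI F.smult_closed fR a(1))
    have v: "?v \<in> carrier ?F" by (rule F.finsum_closed[OF fa])
    have "?\<Lambda> ?v = (\<Oplus>\<^bsub>M\<^esub>i\<in>{..<r}. ?\<Lambda> (f i \<odot>\<^bsub>?F\<^esub> a i))"
      by (rule module_hom_finsum[OF F assms(1) \<Lambda> fa])
    also have "\<dots> = (\<Oplus>\<^bsub>M\<^esub>i\<in>{..<r}. s \<odot>\<^bsub>M\<^esub> (f i \<odot>\<^bsub>M\<^esub> x' i))"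
      using fR a sR x'M
      by (intro M.finsum_cong') (auto simp: module_hom_smult[OF \<Lambda>] M.smult_commute simp del: free_module_simps)
    also have "\<dots> = s \<odot>\<^bsub>M\<^esub> (\<Oplus>\<^bsub>M\<^esub>i\<in>{..<r}. f i \<odot>\<^bsub>M\<^esub> x' i)"
      using fR sR x'M by (intro M.finsum_smult_ldistr[symmetric]) auto
    also have "(\<Oplus>\<^bsub>M\<^esub>i\<in>{..<r}. f i \<odot>\<^bsub>M\<^esub> x' i) = \<zero>\<^bsub>M\<^esub>"
      using linear_extension_finite[OF assms(1) _ x' f] f0 by simp
    also have "s \<odot>\<^bsub>M\<^esub> \<zero>\<^bsub>M\<^esub> = \<zero>\<^bsub>M\<^esub>" by (rule M.smult_r_null[OF sR])
    finally have v0: "?v = \<zero>\<^bsub>?F\<^esub>" by (rule indep[OF v])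
    have "f l \<odot>\<^bsub>?R\<^esub> ?D z = \<zero>\<^bsub>?R\<^esub>" if "l < r" for l
      by (rule alternating_annihilated_on_span[OF F RR alt, where a = a and d = f])
        (use a(1) fR v0 that zG in \<open>simp_all del: free_module_simps\<close>)
    then have "f l = \<zero>\<^bsub>R\<^esub>" if "l < r" for l
      using that Dz fR[of l] sR M.nonzerodivisors_cancel_zero[OF M.nonzerodivisors_pow[OF s(1)] fR, of r l]
      by (simp add: M.m_comm)
    then show ?thesis using f by (auto simp: free_module_carrier)
  qed
  then have "is_free R M" by (rule is_freeI[OF assms(1,2) x' gen'])
  then show False using assms(3) by simp
qed


section \<open>Torsion in tensor powers\<close>

lemma min_num_generators_pos:
  assumes "module R M" "carrier M \<noteq> {\<zero>\<^bsub>M\<^esub>}"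
    and "generating_set R M (x ` {..<min_num_generators R M})"
  shows "0 < min_num_generators R M"
proof (rule ccontr)
  interpret M: module R M by fact
  assume "\<not> 0 < min_num_generators R M"
  then have "carrier M \<subseteq> {\<zero>\<^bsub>M\<^esub>}"
    using generating_setD[OF assms(3) submodule_zero[OF assms(1)]] by auto
  then show False using assms(2) M.zero_closed by auto
qed

text \<open>Only the first \<open>b\<close> factors vary; the other ones are filled up with \<open>x\<close>, and the last factor, from \<open>N\<close>,
  is \<open>y\<close>.\<close>

definition padded_tensor ::
  "('a, 'r) ring_scheme \<Rightarrow> nat \<Rightarrow> ('a, 'm, 'x) module_scheme \<Rightarrow> ('a, 'n, 'y) module_scheme \<Rightarrow>
    nat \<Rightarrow> 'm \<Rightarrow> 'n \<Rightarrow> (nat \<Rightarrow> 'm) \<Rightarrow> (('m list \<Rightarrow> 'a) set \<times> 'n \<Rightarrow> 'a) set" where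
  "padded_tensor R n M N b x y z =
    pure_tensor R (tensor_power R n M) N (power_tensor R n M (map z [0..<b] @ replicate (n - b) x)) y"

lemma padded_tuple:
  assumes "b \<le> n" "x \<in> carrier M" "\<And>i. i < b \<Longrightarrow> z i \<in> carrier M"
  shows "map z [0..<b] @ replicate (n - b) x \<in> tuples M n"
  using assms by (auto simp: tuples_def)

lemma padded_tensor_multilinear:
  assumes "module R M" "module R N" "b \<le> n" "x \<in> carrier M" "y \<in> carrier N"
  shows "multilinear R b M (tensor_product R (tensor_power R n M) N) (padded_tensor R n M N b x y)"
  unfolding multilinear_def
proof (intro allI impI conjI)
  note P = tensor_power_module[OF assms(1), of n]
  fix z assume "\<forall>i<b. z i \<in> carrier M"
  then have t: "map z [0..<b] @ replicate (n - b) x \<in> tuples M n" using padded_tuple[OF assms(3,4)] by blast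
  show "padded_tensor R n M N b x y z \<in> carrier (tensor_product R (tensor_power R n M) N)"
    unfolding padded_tensor_def
    by (rule pure_tensor_closed[OF P assms(2) power_tensor_closed[OF assms(1) t] assms(5)])
  fix i assume i: "i < b"
  have "map (z(i := v)) [0..<b] @ replicate (n - b) x = (map z [0..<b] @ replicate (n - b) x)[i := v]" for v
    using i by (intro nth_equalityI) (auto simp: nth_append nth_list_update)
  then show "(\<lambda>v. padded_tensor R n M N b x y (z(i := v))) \<in>
      module_hom R M (tensor_product R (tensor_power R n M) N)"
    unfolding padded_tensor_def
    using module_hom_compose[OF power_tensor_hom[OF assms(1) t, of i] pure_tensor_hom(1)[OF P assms(2,5)]]
      i assms(3) by simp
qed

text \<open>The product of the coordinate forms dual to the chosen minimal generators takes the value \<open>1\<close>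
  on the tensor of the generators in their given order and the value \<open>0\<close> after any nontrivial
  permutation.\<close>

lemma antisymmetrization_of_generators_nonzero:
  assumes "local_ring R" "noetherian_ring R" "module R M" "module R N"
    and x: "generating_set R M (x ` {..<min_num_generators R M})"
    and y: "generating_set R N (y ` {..<min_num_generators R N})"
    and pos: "0 < min_num_generators R M" "0 < min_num_generators R N"
    and b: "b \<le> min_num_generators R M" "b \<le> n"
  shows "antisymmetrization b (tensor_product R (tensor_power R n M) N)
      (padded_tensor R n M N b (x 0) (y 0)) x \<noteq> \<zero>\<^bsub>tensor_product R (tensor_power R n M) N\<^esub>"
proof -
  interpret local_ring R by fact
  obtain \<mm> where m: "maximalideal \<mm> R" using unique_maximalideal by blast
  interpret I: maximalideal \<mm> R by fact
  let ?Q = "R Quot \<mm>" and ?h = "(+>\<^bsub>R\<^esub>) \<mm>"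
  let ?K = "algebra_module ?Q ?h"
  let ?P = "tensor_power R n M"
  let ?T = "tensor_product R ?P N"
  interpret Q: field ?Q by (rule I.quotient_is_field[OF is_cring])
  note hom = I.rcos_ring_hom
  have K: "module R ?K" by (rule algebra_module_module[OF is_cring Q.is_cring hom])
  note P = tensor_power_module[OF assms(3), of n]
  note T = tensor_product_module[OF P assms(4)]
  have xM: "x i \<in> carrier M" if "i < min_num_generators R M" for i
    using generating_set_subset[OF x] that by auto
  have yN: "y 0 \<in> carrier N" using generating_set_subset[OF y] pos(2) by auto
  have "\<exists>c. c \<in> module_hom R M ?K \<and> (\<forall>j<min_num_generators R M. c (x j) = (if j = i then \<one>\<^bsub>?Q\<^esub> else \<zero>\<^bsub>?Q\<^esub>))"
    if "i < min_num_generators R M" for i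
    by (rule minimal_generators_coordinate[OF assms(1,2) m assms(3) x that]) blast
  then obtain c where c: "\<And>i. i < min_num_generators R M \<Longrightarrow> c i \<in> module_hom R M ?K"
    "\<And>i j. i < min_num_generators R M \<Longrightarrow> j < min_num_generators R M \<Longrightarrow>
      c i (x j) = (if j = i then \<one>\<^bsub>?Q\<^esub> else \<zero>\<^bsub>?Q\<^esub>)"
    by metis
  obtain d where d: "d \<in> module_hom R N ?K" "d (y 0) = \<one>\<^bsub>?Q\<^esub>"
    by (rule minimal_generators_coordinate[OF assms(1,2) m assms(4) y pos(2)]) (use pos(2) in auto)
  \<comment> \<open>The padding positions all contain \<open>x 0\<close> and are tested with its coordinate form.\<close>
  define c' where "c' i = (if i < b then c i else c 0)" for i
  have c': "c' i \<in> module_hom R M ?K" for i using c(1) b(1) pos(1) by (auto simp: c'_def)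
  let ?\<Phi> = "\<lambda>z. \<Otimes>\<^bsub>?Q\<^esub>i\<in>{..<n}. c' i (z i)"
  have \<Phi>: "multilinear R n M ?K ?\<Phi>" by (rule multilinear_product[OF assms(3) Q.is_cring hom c'])
  obtain g where g: "g \<in> module_hom R ?P ?K" "\<And>xs. xs \<in> tuples M n \<Longrightarrow> g (power_tensor R n M xs) = ?\<Phi> ((!) xs)"
    using tensor_power_universal[OF assms(3) K \<Phi>] by blast
  have hR: "\<mm> +>\<^bsub>R\<^esub> a \<in> carrier ?Q" if "a \<in> carrier R" for a by (rule ring_hom_closed[OF hom that])
  let ?B = "\<lambda>t v. g t \<otimes>\<^bsub>?Q\<^esub> d v"
  have left: "(\<lambda>t. ?B t v) \<in> module_hom R ?P ?K" if "v \<in> carrier N" for v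
    using module_hom_closed[OF g(1)] module_hom_closed[OF d(1) that] hR
    by (auto simp: module_hom_iff module_hom_add[OF g(1)] module_hom_smult[OF g(1)] Q.l_distr Q.m_assoc)
  have right: "(\<lambda>v. ?B t v) \<in> module_hom R N ?K" if "t \<in> carrier ?P" for t
    using module_hom_closed[OF g(1) that] module_hom_closed[OF d(1)] hR
    by (auto simp: module_hom_iff module_hom_add[OF d(1)] module_hom_smult[OF d(1)] Q.r_distr Q.m_lcomm)
  obtain f where f: "f \<in> module_hom R ?T ?K"
      "\<And>t v. t \<in> carrier ?P \<Longrightarrow> v \<in> carrier N \<Longrightarrow> f (pure_tensor R ?P N t v) = ?B t v"
    using tensor_product_universal[OF P assms(4) K, of ?B, OF left right] by blast
  let ?\<phi> = "padded_tensor R n M N b (x 0) (y 0)"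
  let ?l = "\<lambda>z. map z [0..<b] @ replicate (n - b) (x 0)"
  note mult = padded_tensor_multilinear[OF assms(3,4) b(2) xM[OF pos(1)] yN]
  have f\<phi>: "f (?\<phi> z) = ?\<Phi> ((!) (?l z))" if "\<And>i. i < b \<Longrightarrow> z i \<in> carrier M" for z
  proof -
    have t: "?l z \<in> tuples M n" using padded_tuple[OF b(2) xM[OF pos(1)]] that by blast
    have "?\<Phi> ((!) (?l z)) \<in> carrier ?K" using tuples_nth[OF t] by (intro multilinear_closed[OF \<Phi>]) auto
    then show ?thesis
      using f(2)[OF power_tensor_closed[OF assms(3) t] yN] g(2)[OF t] d(2) by (simp add: padded_tensor_def)
  qed
  have xb: "x i \<in> carrier M" if "i < b" for i using xM that b(1) by simp
  have nth: "?l z ! i = (if i < b then z i else x 0)" if "i < n" for z i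
    using that by (auto simp: nth_append)
  have "?\<Phi> ((!) (?l x)) = \<one>\<^bsub>?Q\<^esub>"
    using b pos(1) by (intro Q.finprod_one_eqI) (auto simp: nth c'_def c(2))
  then have one: "f (?\<phi> x) = \<one>\<^bsub>?Q\<^esub>" using f\<phi>[OF xb] by simp
  have "f (?\<phi> (x \<circ> \<sigma>)) = \<zero>\<^bsub>?K\<^esub>" if \<sigma>: "\<sigma> permutes {..<b}" "\<sigma> \<noteq> id" for \<sigma>
  proof -
    note perm = permutes_lessThan[OF \<sigma>(1)]
    obtain i where i: "i < b" "\<sigma> i \<noteq> i" using permutes_moves[OF \<sigma>] by blast
    have x\<sigma>: "(x \<circ> \<sigma>) j \<in> carrier M" if "j < b" for j using xb perm[OF that] by simp
    have t: "?l (x \<circ> \<sigma>) \<in> tuples M n" using padded_tuple[OF b(2) xM[OF pos(1)]] x\<sigma> by blast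
    have "c' i (?l (x \<circ> \<sigma>) ! i) = \<zero>\<^bsub>?Q\<^esub>"
      using i b perm[OF i(1)] nth[of i "x \<circ> \<sigma>"] c(2)[of i "\<sigma> i"] by (simp add: c'_def)
    then have "?\<Phi> ((!) (?l (x \<circ> \<sigma>))) = \<zero>\<^bsub>?Q\<^esub>"
      using i(1) b(2) module_hom_closed[OF c' tuples_nth[OF t]]
      by (intro Q.finprod_zero_factor[of _ i]) auto
    then show ?thesis by (simp only: f\<phi>[OF x\<sigma>] algebra_module_simps)
  qed
  then have "antisymmetrization b ?K (\<lambda>z. f (?\<phi> z)) x = \<one>\<^bsub>?Q\<^esub>"
    using antisymmetrization_eq[OF K, of "\<lambda>z. f (?\<phi> z)" x b] one by simp
  then have "f (antisymmetrization b ?T ?\<phi> x) = \<one>\<^bsub>?Q\<^esub>"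
    using antisymmetrization_hom[OF assms(3) T K mult f(1) xb] by simp
  moreover have "f \<zero>\<^bsub>?T\<^esub> = \<zero>\<^bsub>?Q\<^esub>" using module_hom_zero[OF T K f(1)] by simp
  ultimately show ?thesis using Q.one_not_zero by metis
qed

text \<open>If \<open>b = \<nu>(M)\<close>, the generators come from a presentation, whose relations annihilate alternating forms of
  all generators. If \<open>b = r + 1\<close> with the rank \<open>r\<close>, any minimal generators serve: a common denominator \<open>s\<close>
  moves them into the span of \<open>r\<close> elements, and this changes the value of a form by the factor \<open>s\<^sup>b\<close>.\<close>

lemma annihilated_alternating_forms:
  fixes M :: "('a, 'm, 'x) module_scheme" and P :: "('a, 'p, 'y) module_scheme"
  assumes "local_ring R" "noetherian_ring R" "module R M" "finitely_generated R M" "module R P"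
    and b: "(presentation_ideal R M \<inter> nonzerodivisors R \<noteq> {} \<and> b = min_num_generators R M) \<or>
      (\<exists>r. has_rank R M r \<and> b = r + 1)"
    and "\<not> is_free R M"
  obtains x s where "generating_set R M (x ` {..<min_num_generators R M})" "b \<le> min_num_generators R M"
    "s \<in> nonzerodivisors R" "\<And>D. alternating R b M P D \<Longrightarrow> s \<odot>\<^bsub>P\<^esub> D x = \<zero>\<^bsub>P\<^esub>"
  using b
proof (elim disjE exE conjE)
  assume "presentation_ideal R M \<inter> nonzerodivisors R \<noteq> {}" and b: "b = min_num_generators R M"
  then obtain s where s: "s \<in> presentation_ideal R M" "s \<in> nonzerodivisors R" by blast
  obtain x :: "nat \<Rightarrow> 'm" and m :: nat and A where x: "generating_set R M (x ` {..<min_num_generators R M})"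
    and A: "\<And>i j. i < min_num_generators R M \<Longrightarrow> j < m \<Longrightarrow> A i j \<in> carrier R"
    and rel: "\<And>j. j < m \<Longrightarrow> (\<Oplus>\<^bsub>M\<^esub>i\<in>{..<min_num_generators R M}. A i j \<odot>\<^bsub>M\<^esub> x i) = \<zero>\<^bsub>M\<^esub>"
    and sA: "s \<in> Idl\<^bsub>R\<^esub> {A i j |i j. i < min_num_generators R M \<and> j < m}"
    by (rule presentation_ideal_witness[OF assms(2-4) s(1)]) (rule that)
  have xM: "x i \<in> carrier M" if "i < min_num_generators R M" for i
    using generating_set_subset[OF x] that by auto
  have "s \<odot>\<^bsub>P\<^esub> D x = \<zero>\<^bsub>P\<^esub>" if "alternating R b M P D" for D
    by (rule alternating_annihilated_by_relations[OF assms(3,5) that[unfolded b] xM A rel sA])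
  then show thesis using x s(2) b by (intro that[of x s]) auto
next
  fix r assume rank: "has_rank R M r" and b: "b = r + 1"
  interpret M: base_change R M by (rule base_change.intro[OF assms(3)])
  obtain m where m: "m \<in> {..<r} \<rightarrow> carrier M"
    "\<And>f. f \<in> carrier (free_module R {..<r}) \<Longrightarrow> linear_extension R M m f = \<zero>\<^bsub>M\<^esub> \<Longrightarrow>
      f = \<zero>\<^bsub>free_module R {..<r}\<^esub>"
    "\<And>x. x \<in> carrier M \<Longrightarrow> \<exists>s\<in>nonzerodivisors R. s \<odot>\<^bsub>M\<^esub> x \<in> submodule_span R M (m ` {..<r})"
    by (rule M.has_rank_witness[OF rank]) (rule that)
  have mM: "m ` {..<r} \<subseteq> carrier M" using m(1) by auto
  obtain s where s: "s \<in> nonzerodivisors R"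
    "\<And>x. x \<in> carrier M \<Longrightarrow> s \<odot>\<^bsub>M\<^esub> x \<in> submodule_span R M (m ` {..<r})"
    by (rule common_denominator[OF assms(3,4) submodule_span_submodule[OF assms(3) mM] m(3)])
      (assumption, rule that)
  obtain x where x: "generating_set R M (x ` {..<min_num_generators R M})"
    by (rule obtain_minimal_generators[OF assms(4)]) (rule that)
  have bk: "b \<le> min_num_generators R M"
    using rank_less_number_of_generators[OF assms(3) local_ring_one_not_zero[OF assms(1)] assms(7)
        m(1,2) s x] b by simp
  have xM: "x i \<in> carrier M" if "i < b" for i
    using generating_set_subset[OF x] that bk by auto
  have sR: "s \<in> carrier R" using s(1) by blast
  have "card (m ` {..<r}) \<le> r" using card_image_le[of "{..<r}" m] by simp
  then have card: "card (m ` {..<r}) < b" using b by simp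
  have "s [^]\<^bsub>R\<^esub> b \<odot>\<^bsub>P\<^esub> D x = \<zero>\<^bsub>P\<^esub>" if D: "alternating R b M P D" for D
  proof -
    have mult: "multilinear R b M P D" using D by (simp add: alternating_def)
    have "D (\<lambda>i. if i < b then s \<odot>\<^bsub>M\<^esub> x i else x i) = \<zero>\<^bsub>P\<^esub>"
      by (rule alternating_vanishes_on_small_span[OF assms(3,5) D mM _ card]) (use s(2) xM in auto)
    then show ?thesis using multilinear_scale[OF assms(3,5) mult sR xM] by simp
  qed
  then show thesis using x bk M.R.nonzerodivisors_pow[OF s(1)] by (intro that[of x "s [^]\<^bsub>R\<^esub> b"]) auto
qed

theorem theorem2p10:
  fixes R :: "('a, 'r) ring_scheme"
    and M :: "('a, 'm, 'x) module_scheme"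
    and N :: "('a, 'n, 'y) module_scheme"
    and b n :: nat
  assumes "local_ring R" and "noetherian_ring R"
    and "module R M" and "finitely_generated R M" and "carrier M \<noteq> {\<zero>\<^bsub>M\<^esub>}"
    and "(presentation_ideal R M \<inter> nonzerodivisors R \<noteq> {} \<and> b = min_num_generators R M) \<or>
         (\<exists>r. has_rank R M r \<and> b = r + 1)"
    and "\<not> is_free R M"
    and "module R N" and "finitely_generated R N" and "carrier N \<noteq> {\<zero>\<^bsub>N\<^esub>}"
    and "n \<ge> b"
  shows "torsion_submodule R (tensor_product R (tensor_power R n M) N) \<noteq>
    {\<zero>\<^bsub>tensor_product R (tensor_power R n M) N\<^esub>}"
proof -
  let ?T = "tensor_product R (tensor_power R n M) N"
  note T = tensor_product_module[OF tensor_power_module[OF assms(3)] assms(8), of n]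
  interpret T: base_change R ?T by (rule base_change.intro[OF T])
  obtain x s where x: "generating_set R M (x ` {..<min_num_generators R M})"
    and b: "b \<le> min_num_generators R M" and s: "s \<in> nonzerodivisors R"
    and ann: "\<And>D. alternating R b M ?T D \<Longrightarrow> s \<odot>\<^bsub>?T\<^esub> D x = \<zero>\<^bsub>?T\<^esub>"
    using annihilated_alternating_forms[OF assms(1-4) T assms(6,7)] by blast
  obtain y where y: "generating_set R N (y ` {..<min_num_generators R N})"
    by (rule obtain_minimal_generators[OF assms(9)])
  note pos = min_num_generators_pos[OF assms(3,5) x] min_num_generators_pos[OF assms(8,10) y]
  have x0: "x 0 \<in> carrier M" and y0: "y 0 \<in> carrier N" and xM: "\<And>i. i < b \<Longrightarrow> x i \<in> carrier M"
    using generating_set_subset[OF x] generating_set_subset[OF y] pos b by auto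
  let ?D = "antisymmetrization b ?T (padded_tensor R n M N b (x 0) (y 0))"
  have alt: "alternating R b M ?T ?D"
    by (rule antisymmetrization_alternating[OF assms(3) T
          padded_tensor_multilinear[OF assms(3,8,11) x0 y0]])
  have "?D x \<in> carrier ?T"
    using alt xM by (auto simp: alternating_def intro: multilinear_closed)
  then have "?D x \<in> torsion_submodule R ?T" by (rule T.torsionI[OF s _ ann[OF alt]])
  moreover have "?D x \<noteq> \<zero>\<^bsub>?T\<^esub>"
    by (rule antisymmetrization_of_generators_nonzero[OF assms(1-3,8) x y pos b assms(11)])
  ultimately show ?thesis by blast
qed

end
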